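(* Consider the linearized two-class Aw-Rascle (AR) system on $x\in[0,L]$, $t\ge 0$, for the perturbations $z=(\tilde\rho_1,\tilde v_1,\tilde\rho_2,\tilde v_2)^T$, $$J_t\, z_t+J_x\, z_x+J\, z=0,$$ with boundary conditions $$\tilde\rho_1(0,t)=0,\qquad \tilde\rho_2(0,t)=0,$$ $$v_1^*\tilde\rho_1(0,t)+\rho_1^*\tilde v_1(0,t)+v_2^*\tilde\rho_2(0,t)+\rho_2^*\tilde v_2(0,t)=0,$$ $$v_1^*\tilde\rho_1(L,t)+\rho_1^*\tilde v_1(L,t)+v_2^*\tilde\rho_2(L,t)+\rho_2^*\tilde v_2(L,t)=U(t),$$ and initial profiles $\tilde\rho_1(\cdot,0),\tilde v_1(\cdot,0),\tilde\rho_2(\cdot,0),\tilde v_2(\cdot,0)\in\mathcal L^\infty([0,L])$, with the matrices and parameters defined in the context (congested regime). Suppose the output feedback law $$U(t)=\kappa_4 e^{\frac{\hat J_{44}}{\lambda_4}L}\left(-\bar R_1T_u^{-1}(L)\hat z(L,t)+\int_0^L K(L,\xi)T_u^{-1}(\xi)\hat z(\xi,t)\,d\xi+\int_0^L L_{11}(L,\xi)T_l^{-1}(\xi)\hat z(\xi,t)\,d\xi\right)$$ is applied, where the estimate $\hat z=(\hat\rho_1-\rho_1^*,\hat v_1-v_1^*,\hat\rho_2-\rho_2^*,\hat v_2-v_2^* )^T$ is given by $\hat z(x,t)=T(x)(\hat w_1,\hat w_2,\hat w_3,\hat w_4)^T(x,t)$ and $(\hat w_1,\hat w_2,\hat w_3,\hat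 w_4)$ (with $\hat w=(\hat w_1,\hat w_2,\hat w_3)^T$) is generated by the anti-collocated observer $$\hat w_t=-\Lambda^+\hat w_x+\Sigma^{++}(x)\hat w+\Sigma^{+-}(x)\hat w_4-P^+(x)\left(\hat w_4(0,t)-w_4(0,t)\right),$$ $$\hat w_{4t}=\Lambda^-\hat w_{4x}+\Sigma^{-+}(x)\hat w-P_{11}^-(x)\left(\hat w_4(0,t)-w_4(0,t)\right),$$ $$\hat w(0,t)=\bar Q_0w_4(0,t),\qquad \hat w_4(L,t)=\bar R_1\hat w(L,t)+\bar U(t),\qquad \bar U(t)=e^{-\frac{\hat J_{44}}{\lambda_4}L}\frac1{\kappa_4}U(t),$$ with initial data in $\mathcal L^\infty([0,L])$ and with $w_4(0,t)=T_l^{-1}(0)z(0,t)$ known from the measurement of the densities and velocities of both classes at $x=0$. Here, on $\mathcal T=\{0\le\xi\le x\le L\}$, the kernel $K=(k_{11},k_{12},k_{13})$ is the solution of the well-posed equations $$0=\lambda_4K_x(x,\xi)+K_\xi(x,\xi)\Lambda^++K(x,\xi)\Sigma^{++}(\xi)-\frac1{\lambda_4}K(x-\xi,0)\Lambda^+\bar Q_0\Sigma^{-+}(\xi)+\left(\int_0^{-\xi/\lambda_4}K(\lambda_4\nu+x,\lambda_4\nu+\xi)\Sigma^{+-}(\lambda_4\nu+\xi)\,d\nu\right)\Sigma^{-+}(\xi),$$ $$0=K(x,x)\Lambda^++\Lambda^-K(x,x)+\Sigma^{-+}(x),$$ $L_{11}$ is given by $$L_{11}(x,\xi)=-\frac1{\lambda_4}K(x-\xi,0)\Lambda^+\bar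 Q_0+\int_0^{-\xi/\lambda_4}K(\lambda_4\nu+x,\lambda_4\nu+\xi)\Sigma^{+-}(\lambda_4\nu+\xi)\,d\nu,$$ and the observer gains are $P^+(x)=-\lambda_4M(x,0)$, $P_{11}^-(x)=-\lambda_4N_{11}(x,0)$, where $M=(m_{11},m_{21},m_{31})^T$ is the solution of the well-posed equations $$0=-\Lambda^-M_\xi(x,\xi)+\Lambda^+M_x(x,\xi)-\Sigma^{++}(x)M(x,\xi)-\Sigma^{+-}(x)\bar R_1M(L,L-(x-\xi))-\Sigma^{+-}(x)\int_0^{\frac{x-L}{\lambda_4}}\Sigma^{-+}(x-\lambda_4\nu)M(x-\lambda_4\nu,\xi-\lambda_4\nu)\,d\nu,$$ $$0=M(\xi,\xi)\Lambda^-+\Lambda^+M(\xi,\xi)-\Sigma^{+-}(\xi),$$ and $$N_{11}(x,\xi)=\bar R_1M(L,L-(x-\xi))+\int_0^{\frac{x-L}{\lambda_4}}\Sigma^{-+}(x-\lambda_4\nu)M(x-\lambda_4\nu,\xi-\lambda_4\nu)\,d\nu .$$ Then the perturbations $(\tilde\rho_1,\tilde v_1,\tilde\rho_2,\tilde v_2)$ converge to the zero equilibrium $\tilde\rho_{e,1}\equiv\tilde v_{e,1}\equiv\tilde\rho_{e,2}\equiv\tilde v_{e,2}\equiv0$ in the finite time $2t_F$, where $$t_F=\frac{L}{v_2^*}+\frac{L}{-\lambda_4},$$ i.e. they vanish on $[0,L]$ for all $t\ge 2t_F$.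
   Context: **Model parameters.** $L,W>0$ (track length, width); for $i=1,2$: $a_i,V_i,\tau_i>0$, $\gamma_i>1$, $0<\overline{AO}_i\le1$; constant equilibrium densities $\rho_1^*,\rho_2^*>0$. Area occupancy $AO(\rho_1,\rho_2)=\frac{a_1\rho_1+a_2\rho_2}{W}$; pressures $p_i(AO)=V_i(AO/\overline{AO}_i)^{\gamma_i}$; equilibrium speeds $V_{e,i}(AO)=V_i\left(1-(AO/\overline{AO}_i)^{\gamma_i}\right)$. Equilibrium velocities are $v_i^*=V_{e,i}(AO(\rho_1^*,\rho_2^* ))$. Physical variables are $\rho_i=\rho_i^*+\tilde\rho_i$ (density) and $v_i=v_i^*+\tilde v_i$ (velocity); $\hat\rho_i,\hat v_i$ denote their estimates. Put $\beta_{ij}=\partial p_i(AO(\rho_1,\rho_2))/\partial\rho_j$ evaluated at $(\rho_1^*,\rho_2^* )$ and $\alpha_i=\beta_{ii}$. **Matrices.** $$J_t=\begin{pmatrix}1&0&0&0\\ \beta_{11}&1&\beta_{12}&0\\0&0&1&0\\ \beta_{21}&0&\beta_{22}&1\end{pmatrix},\quad J_x=\begin{pmatrix}v_1^*&\rho_1^*&0&0\\ v_1^*\beta_{11}&v_1^*&v_1^*\beta_{12}&0\\0&0&v_2^*&\rho_2^*\\ v_2^*\beta_{21}&0&v_2^*\beta_{22}&v_2^*\end{pmatrix},\quad J=\begin{pmatrix}0&0&0&0\\ \frac{\beta_{11}}{\tau_1}&\frac1{\tau_1}&\frac{\beta_{12}}{\tau_1}&0\\0&0&0&0\\ \frac{\beta_{21}}{\tau_2}&0&\frac{\beta_{22}}{\tau_2}&\frac1{\tau_2}\end{pmatrix}.$$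 Set $\tilde J_x=J_t^{-1}J_x$ and $\tilde J=-J_t^{-1}J$, i.e. $$\tilde J_x=\begin{pmatrix}v_1^*&\rho_1^*&0&0\\0&v_1^*-\beta_{11}\rho_1^*&\beta_{12}(v_1^*-v_2^* )&-\beta_{12}\rho_2^*\\0&0&v_2^*&\rho_2^*\\ \beta_{21}(v_2^*-v_1^* )&-\beta_{21}\rho_1^*&0&v_2^*-\beta_{22}\rho_2^*\end{pmatrix},\quad \tilde J=-J.$$ The eigenvalues of $\tilde J_x$ (characteristic speeds) are $\lambda_1=v_1^*$, $\lambda_2=v_2^*$, $\lambda_{3}=\frac12(v_1^*+v_2^*-\alpha_1\rho_1^*-\alpha_2\rho_2^*+\Delta)$, $\lambda_{4}=\frac12(v_1^*+v_2^*-\alpha_1\rho_1^*-\alpha_2\rho_2^*-\Delta)$, with $\Delta=\sqrt{(\alpha_2\rho_2^*-\alpha_1\rho_1^*+v_1^*-v_2^* )^2+4\alpha_1\alpha_2\rho_1^*\rho_2^*}$. **Standing assumptions.** $v_1^*>v_2^*>0$ (so $\lambda_2<\lambda_3<\lambda_1$), and the congested regime: $\lambda_1,\lambda_2,\lambda_3>0$, $\lambda_4<0$. **Diagonalization.** $V=(v_{ij})_{1\le i,j\le4}$ is a constant invertible matrix with $V^{-1}\tilde J_xV=\mathrm{diag}(\lambda_1,\lambda_2,\lambda_3,\lambda_4)$; $\hat J=(\hat J_{ij})=V^{-1}\tilde JV$; $\kappa_i=v_1^*v_{1i}+\rho_1^*v_{2i}+v_2^*v_{3i}+\rho_2^*v_{4i}$,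 $i=1,\dots,4$. Set $$\hat Q_0=-\begin{pmatrix}v_{11}&v_{12}&v_{13}\\ v_{31}&v_{32}&v_{33}\\ \kappa_1&\kappa_2&\kappa_3\end{pmatrix}^{-1}\begin{pmatrix}v_{14}\\ v_{34}\\ \kappa_4\end{pmatrix},\qquad \hat R_1=-\frac1{\kappa_4}(\kappa_1,\kappa_2,\kappa_3)$$ (the inverse is assumed to exist and $\kappa_4\ne0$). Write $\theta_i=\hat J_{ii}/\lambda_i$, $i=1,\dots,4$, and $$\bar Q_0=\begin{pmatrix}0&0&1\\1&0&0\\0&1&0\end{pmatrix}^{-1}\hat Q_0,\qquad \bar R_1=\hat R_1\begin{pmatrix}0&0&e^{(\theta_1-\theta_4)L}\\ e^{(\theta_2-\theta_4)L}&0&0\\0&e^{(\theta_3-\theta_4)L}&0\end{pmatrix}.$$ **Coefficients.** $\Lambda^+=\mathrm{diag}(v_2^*,\lambda_3,v_1^* )$, $\Lambda^-=-\lambda_4>0$, $$\Sigma^{++}=\begin{pmatrix}0&\bar J_{12}&\bar J_{13}\\ \bar J_{21}&0&\bar J_{23}\\ \bar J_{31}&\bar J_{32}&0\end{pmatrix},\quad \Sigma^{+-}=(\bar J_{14},\bar J_{24},\bar J_{34})^T,\quad \Sigma^{-+}=(\bar J_{41},\bar J_{42},\bar J_{43}),$$ where, as functions of $x$: $\bar J_{12}=\hat J_{23}e^{(\theta_3-\theta_2)x}$, $\bar J_{13}=\hat J_{21}e^{(\theta_1-\theta_2)x}$, $\bar J_{14}=\hat J_{24}e^{(\theta_4-\theta_2)x}$,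 $\bar J_{21}=\hat J_{32}e^{(\theta_2-\theta_3)x}$, $\bar J_{23}=\hat J_{31}e^{(\theta_1-\theta_3)x}$, $\bar J_{24}=\hat J_{34}e^{(\theta_4-\theta_3)x}$, $\bar J_{31}=\hat J_{12}e^{(\theta_2-\theta_1)x}$, $\bar J_{32}=\hat J_{13}e^{(\theta_3-\theta_1)x}$, $\bar J_{34}=\hat J_{14}e^{(\theta_4-\theta_1)x}$, $\bar J_{41}=\hat J_{42}e^{(\theta_2-\theta_4)x}$, $\bar J_{42}=\hat J_{43}e^{(\theta_3-\theta_4)x}$, $\bar J_{43}=\hat J_{41}e^{(\theta_1-\theta_4)x}$. **Transformation.** $$T^{-1}(x)=\begin{pmatrix}0&e^{-\theta_2x}&0&0\\0&0&e^{-\theta_3x}&0\\ e^{-\theta_1x}&0&0&0\\0&0&0&e^{-\theta_4x}\end{pmatrix}V^{-1},\qquad T(x)=V\begin{pmatrix}0&0&e^{\theta_1x}&0\\ e^{\theta_2x}&0&0&0\\0&e^{\theta_3x}&0&0\\0&0&0&e^{\theta_4x}\end{pmatrix};$$ $T_u^{-1}(x)\in\mathbb R^{3\times4}$ denotes the first three rows of $T^{-1}(x)$ and $T_l^{-1}(x)\in\mathbb R^{1\times4}$ its last row. The control design coordinates are $(w_1,w_2,w_3,w_4)^T=T^{-1}(x)z$. $K$ ($1\times3$), $L_{11}$ (scalar), $M$ ($3\times1$), $N_{11}$ (scalar) are functions in $L^\infty(\mathcal T)$; the kernel equations are understood along characteristics. Since initial data are only $L^\infty$, solutions of the PDE systems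 are understood in the weak sense (along characteristics). *)

theory Defs
  imports "HOL-Analysis.Analysis"
begin

section \<open>Model parameters\<close>

text \<open>The two vehicle classes are the elements \<open>1\<close> and \<open>2\<close> of the type \<open>2\<close>.\<close>

record ar_params =
  len :: real                 \<comment> \<open>\<open>L\<close>\<close>
  width :: real               \<comment> \<open>\<open>W\<close>\<close>
  area :: "2 \<Rightarrow> real"       \<comment> \<open>\<open>a\<^sub>i\<close>\<close>
  vmax :: "2 \<Rightarrow> real"       \<comment> \<open>\<open>V\<^sub>i\<close>\<close>
  relax :: "2 \<Rightarrow> real"      \<comment> \<open>\<open>\<tau>\<^sub>i\<close>\<close>
  expo :: "2 \<Rightarrow> real"       \<comment> \<open>\<open>\<gamma>\<^sub>i\<close>\<close>
  occmax :: "2 \<Rightarrow> real"     \<comment> \<open>maximal area occupancy\<close>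
  rhoeq :: "2 \<Rightarrow> real"      \<comment> \<open>\<open>\<rho>\<^sub>i\<^sup>*\<close>\<close>

definition valid_params :: "ar_params \<Rightarrow> bool" where
  "valid_params P \<longleftrightarrow> len P > 0 \<and> width P > 0 \<and>
     (\<forall>i. area P i > 0 \<and> vmax P i > 0 \<and> relax P i > 0 \<and> expo P i > 1 \<and>
          0 < occmax P i \<and> occmax P i \<le> 1 \<and> rhoeq P i > 0)"

definition AO :: "ar_params \<Rightarrow> (2 \<Rightarrow> real) \<Rightarrow> real" where
  "AO P \<rho> = (area P 1 * \<rho> 1 + area P 2 * \<rho> 2) / width P"

definition pressure :: "ar_params \<Rightarrow> 2 \<Rightarrow> real \<Rightarrow> real" where
  "pressure P i ao = vmax P i * (ao / occmax P i) powr expo P i"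

definition eq_speed :: "ar_params \<Rightarrow> 2 \<Rightarrow> real \<Rightarrow> real" where
  "eq_speed P i ao = vmax P i * (1 - (ao / occmax P i) powr expo P i)"

definition veq :: "ar_params \<Rightarrow> 2 \<Rightarrow> real" where
  "veq P i = eq_speed P i (AO P (rhoeq P))"

definition beta :: "ar_params \<Rightarrow> 2 \<Rightarrow> 2 \<Rightarrow> real" where
  "beta P i j = deriv (\<lambda>r. pressure P i (AO P ((rhoeq P)(j := r)))) (rhoeq P j)"

definition alpha :: "ar_params \<Rightarrow> 2 \<Rightarrow> real" where
  "alpha P i = beta P i i"

section \<open>System matrices and characteristic speeds\<close>

definition Jt :: "ar_params \<Rightarrow> real^4^4" where
  "Jt P = vector
    [vector [1, 0, 0, 0],
     vector [beta P 1 1, 1, beta P 1 2, 0],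
     vector [0, 0, 1, 0],
     vector [beta P 2 1, 0, beta P 2 2, 1]]"

definition Jx :: "ar_params \<Rightarrow> real^4^4" where
  "Jx P = vector
    [vector [veq P 1, rhoeq P 1, 0, 0],
     vector [veq P 1 * beta P 1 1, veq P 1, veq P 1 * beta P 1 2, 0],
     vector [0, 0, veq P 2, rhoeq P 2],
     vector [veq P 2 * beta P 2 1, 0, veq P 2 * beta P 2 2, veq P 2]]"

definition Jsrc :: "ar_params \<Rightarrow> real^4^4" where
  "Jsrc P = vector
    [vector [0, 0, 0, 0],
     vector [beta P 1 1 / relax P 1, 1 / relax P 1, beta P 1 2 / relax P 1, 0],
     vector [0, 0, 0, 0],
     vector [beta P 2 1 / relax P 2, 0, beta P 2 2 / relax P 2, 1 / relax P 2]]"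

definition Jx_tilde :: "ar_params \<Rightarrow> real^4^4" where
  "Jx_tilde P = matrix_inv (Jt P) ** Jx P"

definition J_tilde :: "ar_params \<Rightarrow> real^4^4" where
  "J_tilde P = - (matrix_inv (Jt P) ** Jsrc P)"

definition Delta :: "ar_params \<Rightarrow> real" where
  "Delta P = sqrt ((alpha P 2 * rhoeq P 2 - alpha P 1 * rhoeq P 1 + veq P 1 - veq P 2)\<^sup>2
                   + 4 * alpha P 1 * alpha P 2 * rhoeq P 1 * rhoeq P 2)"

definition lam :: "ar_params \<Rightarrow> real^4" where
  "lam P = vector
    [veq P 1,
     veq P 2,
     (veq P 1 + veq P 2 - alpha P 1 * rhoeq P 1 - alpha P 2 * rhoeq P 2 + Delta P) / 2,
     (veq P 1 + veq P 2 - alpha P 1 * rhoeq P 1 - alpha P 2 * rhoeq P 2 - Delta P) / 2]"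

definition congested :: "ar_params \<Rightarrow> bool" where
  "congested P \<longleftrightarrow> veq P 1 > veq P 2 \<and> veq P 2 > 0 \<and>
     lam P $ 1 > 0 \<and> lam P $ 2 > 0 \<and> lam P $ 3 > 0 \<and> lam P $ 4 < 0"

definition diag_mat :: "'a::zero^'n \<Rightarrow> 'a^'n^'n" where
  "diag_mat d = (\<chi> i j. if i = j then d $ i else 0)"

definition diagonalizes :: "ar_params \<Rightarrow> real^4^4 \<Rightarrow> bool" where
  "diagonalizes P V \<longleftrightarrow> invertible V \<and> matrix_inv V ** Jx_tilde P ** V = diag_mat (lam P)"

definition J_hat :: "ar_params \<Rightarrow> real^4^4 \<Rightarrow> real^4^4" where
  "J_hat P V = matrix_inv V ** J_tilde P ** V"

definition kappa :: "ar_params \<Rightarrow> real^4^4 \<Rightarrow> 4 \<Rightarrow> real" where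
  "kappa P V i = veq P 1 * V$1$i + rhoeq P 1 * V$2$i + veq P 2 * V$3$i + rhoeq P 2 * V$4$i"

definition theta :: "ar_params \<Rightarrow> real^4^4 \<Rightarrow> 4 \<Rightarrow> real" where
  "theta P V i = J_hat P V $ i $ i / lam P $ i"

section \<open>Boundary coefficients\<close>

text \<open>Row vectors are elements of \<open>real^'n\<close>; they multiply matrices by \<open>v*\<close> and columns by \<open>\<bullet>\<close>.\<close>

definition inflow_mat :: "ar_params \<Rightarrow> real^4^4 \<Rightarrow> real^3^3" where
  "inflow_mat P V = vector
    [vector [V$1$1, V$1$2, V$1$3],
     vector [V$3$1, V$3$2, V$3$3],
     vector [kappa P V 1, kappa P V 2, kappa P V 3]]"

definition Q0_hat :: "ar_params \<Rightarrow> real^4^4 \<Rightarrow> real^3" where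
  "Q0_hat P V = - (matrix_inv (inflow_mat P V) *v vector [V$1$4, V$3$4, kappa P V 4])"

definition R1_hat :: "ar_params \<Rightarrow> real^4^4 \<Rightarrow> real^3" where
  "R1_hat P V = - (1 / kappa P V 4) *\<^sub>R vector [kappa P V 1, kappa P V 2, kappa P V 3]"

definition Q0_bar :: "ar_params \<Rightarrow> real^4^4 \<Rightarrow> real^3" where
  "Q0_bar P V =
     matrix_inv (vector [vector [0, 0, 1], vector [1, 0, 0], vector [0, 1, 0]] :: real^3^3)
       *v Q0_hat P V"

definition R1_bar :: "ar_params \<Rightarrow> real^4^4 \<Rightarrow> real^3" where
  "R1_bar P V = R1_hat P V v*
     (vector [vector [0, 0, exp ((theta P V 1 - theta P V 4) * len P)],
              vector [exp ((theta P V 2 - theta P V 4) * len P), 0, 0],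
              vector [0, exp ((theta P V 3 - theta P V 4) * len P), 0]] :: real^3^3)"

section \<open>Coefficients in the control design coordinates\<close>

definition Lam_p :: "ar_params \<Rightarrow> real^3^3" where
  "Lam_p P = diag_mat (vector [veq P 2, lam P $ 3, veq P 1])"

definition Lam_m :: "ar_params \<Rightarrow> real" where
  "Lam_m P = - lam P $ 4"

text \<open>\<open>coef P V i j x\<close> couples coordinate \<open>j\<close> into coordinate \<open>i\<close> of the original (unpermuted)
  characteristic coordinates, after the exponential rescaling of each of them. The control design
  coordinates 1, 2, 3, 4 are the characteristic coordinates 2, 3, 1, 4.\<close>

definition coef :: "ar_params \<Rightarrow> real^4^4 \<Rightarrow> 4 \<Rightarrow> 4 \<Rightarrow> real \<Rightarrow> real" where
  "coef P V i j x = J_hat P V $ i $ j * exp ((theta P V j - theta P V i) * x)"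

definition Sig_pp :: "ar_params \<Rightarrow> real^4^4 \<Rightarrow> real \<Rightarrow> real^3^3" where
  "Sig_pp P V x = vector
    [vector [0, coef P V 2 3 x, coef P V 2 1 x],
     vector [coef P V 3 2 x, 0, coef P V 3 1 x],
     vector [coef P V 1 2 x, coef P V 1 3 x, 0]]"

definition Sig_pm :: "ar_params \<Rightarrow> real^4^4 \<Rightarrow> real \<Rightarrow> real^3" where
  "Sig_pm P V x = vector [coef P V 2 4 x, coef P V 3 4 x, coef P V 1 4 x]"

definition Sig_mp :: "ar_params \<Rightarrow> real^4^4 \<Rightarrow> real \<Rightarrow> real^3" where
  "Sig_mp P V x = vector [coef P V 4 2 x, coef P V 4 3 x, coef P V 4 1 x]"

definition T_inv :: "ar_params \<Rightarrow> real^4^4 \<Rightarrow> real \<Rightarrow> real^4^4" where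
  "T_inv P V x = vector
    [vector [0, exp (- theta P V 2 * x), 0, 0],
     vector [0, 0, exp (- theta P V 3 * x), 0],
     vector [exp (- theta P V 1 * x), 0, 0, 0],
     vector [0, 0, 0, exp (- theta P V 4 * x)]] ** matrix_inv V"

definition T_mat :: "ar_params \<Rightarrow> real^4^4 \<Rightarrow> real \<Rightarrow> real^4^4" where
  "T_mat P V x = V ** vector
    [vector [0, 0, exp (theta P V 1 * x), 0],
     vector [exp (theta P V 2 * x), 0, 0, 0],
     vector [0, exp (theta P V 3 * x), 0, 0],
     vector [0, 0, 0, exp (theta P V 4 * x)]]"

definition Tu_inv :: "ar_params \<Rightarrow> real^4^4 \<Rightarrow> real \<Rightarrow> real^4^3" where
  "Tu_inv P V x = vector [T_inv P V x $ 1, T_inv P V x $ 2, T_inv P V x $ 3]"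

definition Tl_inv :: "ar_params \<Rightarrow> real^4^4 \<Rightarrow> real \<Rightarrow> real^4" where
  "Tl_inv P V x = T_inv P V x $ 4"

section \<open>Weak solutions along characteristics\<close>

definition Linf_on :: "real set \<Rightarrow> (real \<Rightarrow> 'a::{real_normed_vector, second_countable_topology}) \<Rightarrow> bool" where
  "Linf_on S f \<longleftrightarrow> f \<in> borel_measurable (lebesgue_on S) \<and>
     (\<exists>B. AE x in lebesgue_on S. norm (f x) \<le> B)"

text \<open>A function on the strip is a Borel representative, bounded on bounded time intervals, of its
  Lebesgue class. Borel (rather than Lebesgue) measurability makes the restrictions to lines,
  in particular the boundary traces, measurable. Boundedness everywhere is no restriction on the
  class: values on a null set of characteristics are irrelevant below and may be set to zero.\<close>

definition Linf_loc_strip ::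
  "real \<Rightarrow> (real \<Rightarrow> real \<Rightarrow> 'a::{real_normed_vector, second_countable_topology}) \<Rightarrow> bool" where
  "Linf_loc_strip L u \<longleftrightarrow>
     (\<lambda>(x, t). u x t) \<in> borel_measurable (restrict_space borel ({0..L} \<times> {0..})) \<and>
     (\<forall>T. \<exists>B. \<forall>x\<in>{0..L}. \<forall>t\<in>{0..T}. norm (u x t) \<le> B)"

text \<open>\<open>g\<^sub>t + c g\<^sub>x = h\<close> on the strip \<open>[0,L] \<times> [0,\<infinity>)\<close>, integrated along the characteristics
  that enter the strip at \<open>t = 0\<close>, \<open>x = 0\<close> or \<open>x = L\<close>, for almost every entry point. (From a lateral
  side at which \<open>c\<close> points outwards only the trivial \<open>s = 0\<close> remains.) The identity holds up to and
  including the exit point, which fixes the boundary trace there.\<close>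

definition char_identity ::
  "real \<Rightarrow> real \<Rightarrow> (real \<Rightarrow> real \<Rightarrow> real) \<Rightarrow> (real \<Rightarrow> real \<Rightarrow> real) \<Rightarrow> real \<Rightarrow> real \<Rightarrow> bool" where
  "char_identity L c h g x0 t0 \<longleftrightarrow>
     (\<forall>s\<ge>0. x0 + c * s \<in> {0..L} \<longrightarrow>
        g (x0 + c * s) (t0 + s) = g x0 t0 + (LINT \<sigma>:{0..s}|lborel. h (x0 + c * \<sigma>) (t0 + \<sigma>)))"

definition transport_solution ::
  "real \<Rightarrow> real \<Rightarrow> (real \<Rightarrow> real \<Rightarrow> real) \<Rightarrow> (real \<Rightarrow> real \<Rightarrow> real) \<Rightarrow> bool" where
  "transport_solution L c h g \<longleftrightarrow>
     (AE x0 in lborel. x0 \<in> {0..L} \<longrightarrow> char_identity L c h g x0 0) \<and>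
     (AE t0 in lborel. t0 > 0 \<longrightarrow> char_identity L c h g 0 t0) \<and>
     (AE t0 in lborel. t0 > 0 \<longrightarrow> char_identity L c h g L t0)"

text \<open>\<open>A u\<^sub>t + B u\<^sub>x = f\<close> with constant \<open>A\<close>, \<open>B\<close>. If \<open>l B = c (l A)\<close> for a row vector \<open>l\<close>, then
  \<open>l A u\<close> is transported with speed \<open>c\<close> and source \<open>l f\<close>. For the hyperbolic systems below these
  row vectors span the whole space.\<close>

definition system_solution ::
  "real \<Rightarrow> real^'n^'n \<Rightarrow> real^'n^'n \<Rightarrow> (real \<Rightarrow> real \<Rightarrow> real^'n) \<Rightarrow> (real \<Rightarrow> real \<Rightarrow> real^'n) \<Rightarrow> bool" where
  "system_solution L A B f u \<longleftrightarrow>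
     (\<forall>c l. l v* B = c *\<^sub>R (l v* A) \<longrightarrow>
        transport_solution L c (\<lambda>x t. l \<bullet> f x t) (\<lambda>x t. l \<bullet> (A *v u x t)))"

section \<open>The linearized two-class system\<close>

definition flux_pert :: "ar_params \<Rightarrow> real^4 \<Rightarrow> real" where
  "flux_pert P z = veq P 1 * z$1 + rhoeq P 1 * z$2 + veq P 2 * z$3 + rhoeq P 2 * z$4"

definition linearized_AR ::
  "ar_params \<Rightarrow> (real \<Rightarrow> real) \<Rightarrow> (real \<Rightarrow> real^4) \<Rightarrow> (real \<Rightarrow> real \<Rightarrow> real^4) \<Rightarrow> bool" where
  "linearized_AR P U z0 z \<longleftrightarrow>
     Linf_loc_strip (len P) z \<and>
     system_solution (len P) (Jt P) (Jx P) (\<lambda>x t. - (Jsrc P *v z x t)) z \<and>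
     (AE t in lborel. t > 0 \<longrightarrow>
        z 0 t $ 1 = 0 \<and> z 0 t $ 3 = 0 \<and>
        flux_pert P (z 0 t) = 0 \<and>
        flux_pert P (z (len P) t) = U t) \<and>
     (AE x in lborel. x \<in> {0..len P} \<longrightarrow> z x 0 = z0 x)"

section \<open>Kernel equations\<close>

definition triangle :: "real \<Rightarrow> (real \<times> real) set" where
  "triangle L = {(x, \<xi>). 0 \<le> \<xi> \<and> \<xi> \<le> x \<and> x \<le> L}"

definition Linf_triangle :: "real \<Rightarrow> (real \<Rightarrow> real \<Rightarrow> real^3) \<Rightarrow> bool" where
  "Linf_triangle L K \<longleftrightarrow>
     (\<lambda>(x, \<xi>). K x \<xi>) \<in> borel_measurable (restrict_space borel (triangle L)) \<and>
     (\<exists>B. \<forall>(x, \<xi>)\<in>triangle L. norm (K x \<xi>) \<le> B)"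

text \<open>\<open>p g\<^sub>x + q g\<^sub>\<xi> = h\<close> along every characteristic segment in the triangle. Bounded solutions of
  the kernel equations have a continuous representative, which is the one this selects; its values
  on the sides of the triangle, used in the control law and in the observer gains, are then
  well defined.\<close>

definition triangle_solution ::
  "real \<Rightarrow> real \<Rightarrow> real \<Rightarrow> (real \<Rightarrow> real \<Rightarrow> real) \<Rightarrow> (real \<Rightarrow> real \<Rightarrow> real) \<Rightarrow> bool" where
  "triangle_solution L p q h g \<longleftrightarrow>
     (\<forall>x \<xi> s. (x, \<xi>) \<in> triangle L \<longrightarrow> s \<ge> 0 \<longrightarrow> (x + p * s, \<xi> + q * s) \<in> triangle L \<longrightarrow>
        g (x + p * s) (\<xi> + q * s)
          = g x \<xi> + (LINT \<sigma>:{0..s}|lborel. h (x + p * \<sigma>) (\<xi> + q * \<sigma>)))"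

definition L11 ::
  "ar_params \<Rightarrow> real^4^4 \<Rightarrow> (real \<Rightarrow> real \<Rightarrow> real^3) \<Rightarrow> real \<Rightarrow> real \<Rightarrow> real" where
  "L11 P V K x \<xi> =
     - (1 / lam P $ 4) * ((K (x - \<xi>) 0 v* Lam_p P) \<bullet> Q0_bar P V)
     + (LINT \<nu>:{0..- \<xi> / lam P $ 4}|lborel.
          K (lam P $ 4 * \<nu> + x) (lam P $ 4 * \<nu> + \<xi>) \<bullet> Sig_pm P V (lam P $ 4 * \<nu> + \<xi>))"

text \<open>The nonlocal terms in the equation for \<open>K\<close> add up to \<open>L11(x,\<xi>) \<Sigma>\<^sup>-\<^sup>+(\<xi>)\<close>, so that it reads
  \<open>0 = \<lambda>\<^sub>4 K\<^sub>x + K\<^sub>\<xi> \<Lambda>\<^sup>+ + K \<Sigma>\<^sup>+\<^sup>+(\<xi>) + L11 \<Sigma>\<^sup>-\<^sup>+(\<xi>)\<close>. Similarly below for \<open>M\<close> and \<open>N11\<close>.\<close>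

definition control_kernel ::
  "ar_params \<Rightarrow> real^4^4 \<Rightarrow> (real \<Rightarrow> real \<Rightarrow> real^3) \<Rightarrow> bool" where
  "control_kernel P V K \<longleftrightarrow>
     Linf_triangle (len P) K \<and>
     (\<forall>j. triangle_solution (len P) (- lam P $ 4) (- Lam_p P $ j $ j)
        (\<lambda>x \<xi>. (K x \<xi> v* Sig_pp P V \<xi> + L11 P V K x \<xi> *\<^sub>R Sig_mp P V \<xi>) $ j)
        (\<lambda>x \<xi>. K x \<xi> $ j)) \<and>
     (\<forall>x\<in>{0..len P}. 0 = K x x v* Lam_p P + Lam_m P *\<^sub>R K x x + Sig_mp P V x)"

definition N11 ::
  "ar_params \<Rightarrow> real^4^4 \<Rightarrow> (real \<Rightarrow> real \<Rightarrow> real^3) \<Rightarrow> real \<Rightarrow> real \<Rightarrow> real" where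
  "N11 P V M x \<xi> =
     R1_bar P V \<bullet> M (len P) (len P - (x - \<xi>))
     + (LINT \<nu>:{0..(x - len P) / lam P $ 4}|lborel.
          Sig_mp P V (x - lam P $ 4 * \<nu>) \<bullet> M (x - lam P $ 4 * \<nu>) (\<xi> - lam P $ 4 * \<nu>))"

definition observer_kernel ::
  "ar_params \<Rightarrow> real^4^4 \<Rightarrow> (real \<Rightarrow> real \<Rightarrow> real^3) \<Rightarrow> bool" where
  "observer_kernel P V M \<longleftrightarrow>
     Linf_triangle (len P) M \<and>
     (\<forall>i. triangle_solution (len P) (Lam_p P $ i $ i) (- Lam_m P)
        (\<lambda>x \<xi>. (Sig_pp P V x *v M x \<xi> + N11 P V M x \<xi> *\<^sub>R Sig_pm P V x) $ i)
        (\<lambda>x \<xi>. M x \<xi> $ i)) \<and>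
     (\<forall>x\<in>{0..len P}. 0 = Lam_m P *\<^sub>R M x x + Lam_p P *v M x x - Sig_pm P V x)"

definition gain_p ::
  "ar_params \<Rightarrow> (real \<Rightarrow> real \<Rightarrow> real^3) \<Rightarrow> real \<Rightarrow> real^3" where
  "gain_p P M x = - lam P $ 4 *\<^sub>R M x 0"

definition gain_m ::
  "ar_params \<Rightarrow> real^4^4 \<Rightarrow> (real \<Rightarrow> real \<Rightarrow> real^3) \<Rightarrow> real \<Rightarrow> real" where
  "gain_m P V M x = - lam P $ 4 * N11 P V M x 0"

section \<open>Observer and output feedback\<close>

definition w4_meas ::
  "ar_params \<Rightarrow> real^4^4 \<Rightarrow> (real \<Rightarrow> real \<Rightarrow> real^4) \<Rightarrow> real \<Rightarrow> real" where
  "w4_meas P V z t = Tl_inv P V 0 \<bullet> z 0 t"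

definition U_bar :: "ar_params \<Rightarrow> real^4^4 \<Rightarrow> (real \<Rightarrow> real) \<Rightarrow> real \<Rightarrow> real" where
  "U_bar P V U t = exp (- (J_hat P V $ 4 $ 4 / lam P $ 4) * len P) * (1 / kappa P V 4) * U t"

definition observer ::
  "ar_params \<Rightarrow> real^4^4 \<Rightarrow> (real \<Rightarrow> real \<Rightarrow> real^3) \<Rightarrow> (real \<Rightarrow> real) \<Rightarrow> (real \<Rightarrow> real) \<Rightarrow>
   (real \<Rightarrow> real^3) \<Rightarrow> (real \<Rightarrow> real) \<Rightarrow> (real \<Rightarrow> real \<Rightarrow> real^3) \<Rightarrow> (real \<Rightarrow> real \<Rightarrow> real) \<Rightarrow> bool" where
  "observer P V M y U w0 w40 w w4 \<longleftrightarrow>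
     Linf_loc_strip (len P) w \<and> Linf_loc_strip (len P) w4 \<and>
     system_solution (len P) (mat 1) (Lam_p P)
       (\<lambda>x t. Sig_pp P V x *v w x t + w4 x t *\<^sub>R Sig_pm P V x
              - (w4 0 t - y t) *\<^sub>R gain_p P M x) w \<and>
     transport_solution (len P) (- Lam_m P)
       (\<lambda>x t. Sig_mp P V x \<bullet> w x t - gain_m P V M x * (w4 0 t - y t)) w4 \<and>
     (AE t in lborel. t > 0 \<longrightarrow>
        w 0 t = y t *\<^sub>R Q0_bar P V \<and>
        w4 (len P) t = R1_bar P V \<bullet> w (len P) t + U_bar P V U t) \<and>
     (AE x in lborel. x \<in> {0..len P} \<longrightarrow> w x 0 = w0 x \<and> w4 x 0 = w40 x)"

definition z_estimate ::
  "ar_params \<Rightarrow> real^4^4 \<Rightarrow> (real \<Rightarrow> real \<Rightarrow> real^3) \<Rightarrow> (real \<Rightarrow> real \<Rightarrow> real) \<Rightarrow> real \<Rightarrow> real \<Rightarrow> real^4" where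
  "z_estimate P V w w4 x t = T_mat P V x *v vector [w x t $ 1, w x t $ 2, w x t $ 3, w4 x t]"

definition output_feedback ::
  "ar_params \<Rightarrow> real^4^4 \<Rightarrow> (real \<Rightarrow> real \<Rightarrow> real^3) \<Rightarrow> (real \<Rightarrow> real \<Rightarrow> real^4) \<Rightarrow> real \<Rightarrow> real" where
  "output_feedback P V K zh t =
     kappa P V 4 * exp (J_hat P V $ 4 $ 4 / lam P $ 4 * len P) *
     (- (R1_bar P V \<bullet> (Tu_inv P V (len P) *v zh (len P) t))
      + (LINT \<xi>:{0..len P}|lborel. K (len P) \<xi> \<bullet> (Tu_inv P V \<xi> *v zh \<xi> t))
      + (LINT \<xi>:{0..len P}|lborel. L11 P V K (len P) \<xi> * (Tl_inv P V \<xi> \<bullet> zh \<xi> t)))"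

definition t_F :: "ar_params \<Rightarrow> real" where
  "t_F P = len P / veq P 2 + len P / (- lam P $ 4)"

end

theory Submission
  imports Defs
begin

text \<open>Everything is solved along characteristics parametrized by \<open>x\<close> instead of \<open>t\<close>, so that all
  four components, whatever the sign of their speed, start at \<open>x = 0\<close>. A homogeneous system with
  zero data at \<open>x = 0\<close> from time \<open>T\<close> on vanishes for \<open>t > T + x / v\<^sub>2\<^sup>*\<close>: zero spreads with the slowest
  positive speed.

  Observer: let \<open>g(t)\<close> be the output error at \<open>x = 0\<close> and \<open>\<mu> = - \<lambda>\<^sub>4\<close>. By the equations for \<open>M\<close> and
  \<open>N\<^sub>1\<^sub>1\<close>, the pair \<open>\<integral>\<^sub>0\<^sup>x M(x,\<xi>) g(t + \<xi>/\<mu>) d\<xi>\<close>, \<open>g(t + x/\<mu>) + \<integral>\<^sub>0\<^sup>x N\<^sub>1\<^sub>1(x,\<xi>) g(t + \<xi>/\<mu>) d\<xi>\<close> solves the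
  error system including the injection terms. Its difference to the error is homogeneous with zero
  data at \<open>x = 0\<close>, hence vanishes for \<open>t > x / v\<^sub>2\<^sup>*\<close>; the reflection condition at \<open>x = L\<close> then reads
  \<open>g(t + L/\<mu>) = 0\<close> for \<open>t > L / v\<^sub>2\<^sup>*\<close>, so the error is zero from time \<open>t\<^sub>F\<close> on.

  Controller: along a characteristic of speed \<open>-\<mu>\<close> arriving at \<open>x = 0\<close> at time \<open>\<tau>\<close>, the divergence
  theorem on the kernel triangle for \<open>K\<^sub>j w\<^sub>j\<close> and \<open>L\<^sub>1\<^sub>1 w\<^sub>4\<close> turns the kernel equations into
  \<open>w\<^sub>4(0,\<tau>) = w\<^sub>4(L,\<tau> - L/\<mu>) - \<integral>\<^sub>0\<^sup>L (K w + L\<^sub>1\<^sub>1 w\<^sub>4)(\<xi>,\<tau> - L/\<mu>) d\<xi>\<close>, which the feedback makes zero for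
  \<open>\<tau> > t\<^sub>F + L/\<mu>\<close>. Then all data at \<open>x = 0\<close> are zero, and so is the state after another \<open>L / v\<^sub>2\<^sup>*\<close>.\<close>

section \<open>Bounded Borel functions on a set\<close>

text \<open>The equations hold only on almost every characteristic, and each component has its own
  family of lines, so a bound for one component cannot be used on the lines of another until their
  exceptional sets are compared. \<open>AE_line_change\<close> does this through null sets of the
  plane. Lines and boundary traces are themselves null in the plane; hence all functions are genuine
  Borel functions, bounded everywhere, and \<open>bm_on\<close> is the invariant that keeps
  substitutions and integrals legitimate.

  No Volterra transformation is ever inverted. The pair built from \<open>M\<close> and
  \<open>N\<close> is the image, under the backstepping transformation, of a target state whose
  first components are zero and whose last one is the output error transported with speed
  \<open>-\<mu>\<close>; the uniqueness argument then takes the place of inversion. On the control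
  side, \<open>x\<close> in the kernel triangle encodes the time along the arriving characteristic.
  The kernel equations are adjoint to the plant, so the interior terms cancel and only edge terms
  survive.\<close>

definition bm_on :: "'a::topological_space set \<Rightarrow> ('a \<Rightarrow> real) \<Rightarrow> bool" where
  "bm_on S f \<longleftrightarrow> f \<in> borel_measurable (restrict_space borel S) \<and> (\<exists>B. \<forall>x\<in>S. \<bar>f x\<bar> \<le> B)"

lemma bm_onI:
  "f \<in> borel_measurable (restrict_space borel S) \<Longrightarrow> (\<And>x. x \<in> S \<Longrightarrow> \<bar>f x\<bar> \<le> B) \<Longrightarrow> bm_on S f"
  unfolding bm_on_def by blast

lemma bm_on_bound:
  assumes "bm_on S f"
  obtains B where "B \<ge> 0" "\<And>x. x \<in> S \<Longrightarrow> \<bar>f x\<bar> \<le> B"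
proof -
  obtain B where B: "\<forall>x\<in>S. \<bar>f x\<bar> \<le> B" using assms unfolding bm_on_def by blast
  show thesis by (rule that[of "max B 0"]) (use B in force)+
qed

lemma bm_on_const [intro]: "bm_on S (\<lambda>x. c)"
  by (rule bm_onI[of _ _ "\<bar>c\<bar>"]) auto

lemma bm_on_add [intro]:
  assumes "bm_on S f" "bm_on S g" shows "bm_on S (\<lambda>x. f x + g x)"
proof -
  obtain B C where "\<And>x. x \<in> S \<Longrightarrow> \<bar>f x\<bar> \<le> B" "\<And>x. x \<in> S \<Longrightarrow> \<bar>g x\<bar> \<le> C"
    using assms by (metis bm_on_bound)
  then have "\<bar>f x + g x\<bar> \<le> B + C" if "x \<in> S" for x using that abs_triangle_ineq[of "f x" "g x"] by (smt (verit))
  then show ?thesis using assms by (intro bm_onI) (auto simp: bm_on_def)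
qed

lemma bm_on_mult [intro]:
  assumes "bm_on S f" "bm_on S g" shows "bm_on S (\<lambda>x. f x * g x)"
proof -
  obtain B C where B: "B \<ge> 0" "\<And>x. x \<in> S \<Longrightarrow> \<bar>f x\<bar> \<le> B" and C: "\<And>x. x \<in> S \<Longrightarrow> \<bar>g x\<bar> \<le> C"
    using assms by (metis bm_on_bound)
  have "\<bar>f x * g x\<bar> \<le> B * C" if "x \<in> S" for x
    unfolding abs_mult using that B C by (intro mult_mono) auto
  then show ?thesis using assms by (intro bm_onI) (auto simp: bm_on_def)
qed

lemma bm_on_uminus [intro]: "bm_on S f \<Longrightarrow> bm_on S (\<lambda>x. - f x)"
  using bm_on_mult[OF bm_on_const[of S "-1"]] by simp

lemma bm_on_diff [intro]: "bm_on S f \<Longrightarrow> bm_on S g \<Longrightarrow> bm_on S (\<lambda>x. f x - g x)"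
  using bm_on_add[OF _ bm_on_uminus] by fastforce

lemma bm_on_sum [intro]: "(\<And>i. i \<in> I \<Longrightarrow> bm_on S (f i)) \<Longrightarrow> bm_on S (\<lambda>x. \<Sum>i\<in>I. f i x)"
  by (induction I rule: infinite_finite_induct) auto

lemma bm_on_compose:
  assumes f: "bm_on T f" and \<phi>: "continuous_on S \<phi>" "\<And>x. x \<in> S \<Longrightarrow> \<phi> x \<in> T"
  shows "bm_on S (\<lambda>x. f (\<phi> x))"
proof -
  obtain B where B: "\<And>x. x \<in> T \<Longrightarrow> \<bar>f x\<bar> \<le> B" using f by (metis bm_on_bound)
  have "\<phi> \<in> measurable (restrict_space borel S) (restrict_space borel T)"
    by (rule measurable_restrict_space2)
       (use \<phi> in \<open>auto simp: space_restrict_space intro: borel_measurable_continuous_on_restrict\<close>)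
  then have "(\<lambda>x. f (\<phi> x)) \<in> borel_measurable (restrict_space borel S)"
    using f unfolding bm_on_def by (auto intro: measurable_compose)
  then show ?thesis by (rule bm_onI) (use B \<phi> in auto)
qed

lemma bm_on_subset: "bm_on T f \<Longrightarrow> S \<subseteq> T \<Longrightarrow> bm_on S f"
  using bm_on_compose[of T f S "\<lambda>x. x"] by (auto intro: continuous_on_id)

lemma bm_on_continuous: "compact S \<Longrightarrow> continuous_on S f \<Longrightarrow> bm_on S f"
  using compact_imp_bounded[OF compact_continuous_image[of S f]]
  by (auto simp: bm_on_def bounded_iff intro: borel_measurable_continuous_on_restrict)

lemma bm_on_indicator_measurable:
  "bm_on S f \<Longrightarrow> S \<in> sets borel \<Longrightarrow> (\<lambda>x. indicator S x *\<^sub>R f x) \<in> borel_measurable borel"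
  by (subst borel_measurable_restrict_space_iff[symmetric]) (auto simp: bm_on_def)

lemma bm_on_set_integrable:
  fixes f :: "'a::euclidean_space \<Rightarrow> real"
  assumes f: "bm_on S f" and S: "S \<in> sets borel" "bounded S"
  shows "set_integrable lborel S f"
proof -
  obtain B where B: "\<And>x. x \<in> S \<Longrightarrow> \<bar>f x\<bar> \<le> B" using f by (metis bm_on_bound)
  have "emeasure lborel S < \<infinity>" using S emeasure_bounded_finite by auto
  then show ?thesis unfolding set_integrable_def
    by (intro integrableI_bounded_set[where A=S and B=B])
       (use bm_on_indicator_measurable[OF f S(1)] S B in \<open>auto simp: indicator_def\<close>)
qed

lemma bm_on_interval_integrable: "bm_on {a..b} f \<Longrightarrow> set_integrable lborel {a..b::real} f"
  by (rule bm_on_set_integrable) auto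

text \<open>Only the majorant has to be integrable. This is why \<open>char_uniqueness\<close> can
  do without any measurability of its sources \<open>f\<close>.\<close>

lemma abs_set_integral_le:
  fixes f :: "real \<Rightarrow> real"
  assumes g: "set_integrable lborel S g" and le: "AE x in lborel. x \<in> S \<longrightarrow> \<bar>f x\<bar> \<le> g x"
  shows "\<bar>LINT x:S|lborel. f x\<bar> \<le> (LINT x:S|lborel. g x)"
proof (cases "set_integrable lborel S f")
  case True
  have "\<bar>LINT x:S|lborel. f x\<bar> \<le> (LINT x:S|lborel. \<bar>f x\<bar>)"
    using integral_abs_bound[of lborel "\<lambda>x. indicator S x *\<^sub>R f x"]
    by (simp add: set_lebesgue_integral_def abs_mult)
  also have "\<dots> \<le> (LINT x:S|lborel. g x)"
    by (rule set_integral_mono_AE[OF set_integrable_abs[OF True] g]) (use le in auto)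
  finally show ?thesis .
next
  case False
  \<comment> \<open>A non-integrable integrand has integral 0 by convention, and the majorant is
    nonnegative almost everywhere on \<open>S\<close>.\<close>
  then have "(LINT x:S|lborel. f x) = 0"
    unfolding set_integrable_def set_lebesgue_integral_def by (rule not_integrable_integral_eq)
  moreover have "0 \<le> (LINT x:S|lborel. g x)"
    unfolding set_lebesgue_integral_def
    by (rule integral_nonneg_AE) (use le in \<open>auto simp: indicator_def elim!: eventually_mono\<close>)
  ultimately show ?thesis by simp
qed

text \<open>The variable upper limit is absorbed into the indicator of a Borel region of the product
  space; the measurability half of Fubini then applies to an integral over the whole line.\<close>

lemma bm_on_param_integral:
  fixes F :: "'a::{second_countable_topology,t2_space} \<Rightarrow> real \<Rightarrow> real" and b :: "'a \<Rightarrow> real"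
  assumes S: "S \<in> sets borel" and b: "continuous_on S b" "\<And>p. p \<in> S \<Longrightarrow> b p \<le> C"
    and F: "bm_on {(p, \<xi>). p \<in> S \<and> 0 \<le> \<xi> \<and> \<xi> \<le> b p} (\<lambda>(p, \<xi>). F p \<xi>)"
  shows "bm_on S (\<lambda>p. LINT \<xi>:{0..b p}|lborel. F p \<xi>)"
proof -
  let ?D = "{(p, \<xi>). p \<in> S \<and> 0 \<le> \<xi> \<and> \<xi> \<le> b p}"
  obtain B where B: "B \<ge> 0" "\<And>p \<xi>. p \<in> S \<Longrightarrow> 0 \<le> \<xi> \<Longrightarrow> \<xi> \<le> b p \<Longrightarrow> \<bar>F p \<xi>\<bar> \<le> B"
    using bm_on_bound[OF F] by (metis (mono_tags, lifting) case_prod_conv mem_Collect_eq)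
  \<comment> \<open>\<open>b\<close> is measurable only relative to \<open>S\<close>. Its extension
    by zero is Borel everywhere, so the region is cut out by Borel conditions.\<close>
  define b' where "b' p = indicator S p *\<^sub>R b p" for p
  have b'[measurable]: "b' \<in> borel_measurable borel"
    unfolding b'_def using borel_measurable_continuous_on_restrict[OF b(1)] S
    by (subst borel_measurable_restrict_space_iff[symmetric]) auto
  note S[measurable]
  have "?D = {q \<in> space (borel \<Otimes>\<^sub>M borel). fst q \<in> S \<and> 0 \<le> snd q \<and> snd q \<le> b' (fst q)}"
    by (auto simp: b'_def space_pair_measure)
  also have "\<dots> \<in> sets (borel \<Otimes>\<^sub>M borel)" by measurable
  finally have D: "?D \<in> sets borel" unfolding borel_prod .
  have "(\<lambda>q. indicator ?D q *\<^sub>R (case q of (p, \<xi>) \<Rightarrow> F p \<xi>)) \<in> borel_measurable (borel \<Otimes>\<^sub>M lborel)"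
    using bm_on_indicator_measurable[OF F D]
    by (subst measurable_cong_sets[OF sets_pair_measure_cong[OF refl sets_lborel] refl]) (simp add: borel_prod)
  then have "(\<lambda>(p, \<xi>). indicator ?D (p, \<xi>) * F p \<xi>) \<in> borel_measurable (borel \<Otimes>\<^sub>M lborel)"
    by (simp add: split_beta')
  then have m: "(\<lambda>p. \<integral>\<xi>. indicator ?D (p, \<xi>) * F p \<xi> \<partial>lborel) \<in> borel_measurable borel"
    by (rule lborel.borel_measurable_lebesgue_integral)
  have eq: "(\<integral>\<xi>. indicator ?D (p, \<xi>) * F p \<xi> \<partial>lborel) = (LINT \<xi>:{0..b p}|lborel. F p \<xi>)" if "p \<in> S" for p
    unfolding set_lebesgue_integral_def
    by (rule Bochner_Integration.integral_cong) (use that in \<open>auto simp: indicator_def\<close>)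
  have "(\<lambda>p. LINT \<xi>:{0..b p}|lborel. F p \<xi>) \<in> borel_measurable (restrict_space borel S)"
    by (rule measurable_cong[THEN iffD1, OF _ measurable_restrict_space1[OF m]])
       (simp add: space_restrict_space eq)
  moreover have "\<bar>LINT \<xi>:{0..b p}|lborel. F p \<xi>\<bar> \<le> B * \<bar>C\<bar>" if "p \<in> S" for p
  proof -
    have "\<bar>LINT \<xi>:{0..b p}|lborel. F p \<xi>\<bar> \<le> (LINT \<xi>:{0..b p}|lborel. B)"
      by (rule abs_set_integral_le) (use B that in \<open>auto intro!: bm_on_interval_integrable\<close>)
    also have "\<dots> = (if 0 \<le> b p then B * b p else 0)"
      by (auto simp: set_integral_const)
    also have "\<dots> \<le> B * \<bar>C\<bar>" using b(2)[OF that] B(1) by (auto intro!: mult_left_mono)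
    finally show ?thesis .
  qed
  ultimately show ?thesis by (rule bm_onI)
qed

section \<open>Interval integrals: substitution, splitting, equality up to null sets\<close>

lemma LINT_interval_affine:
  fixes f :: "real \<Rightarrow> real"
  assumes "c > 0"
  shows "(LINT x:{t + c * a..t + c * b}|lborel. f x) = c * (LINT x:{a..b}|lborel. f (t + c * x))"
  unfolding set_lebesgue_integral_def
  by (subst lborel_integral_real_affine[of c _ t])
     (use assms in \<open>auto simp: indicator_def intro!: arg_cong2[where f="(*)"] Bochner_Integration.integral_cong\<close>)

lemma LINT_interval_reflect:
  fixes f :: "real \<Rightarrow> real"
  assumes "c > 0"
  shows "(LINT x:{t - c * b..t - c * a}|lborel. f x) = c * (LINT x:{a..b}|lborel. f (t - c * x))"
  unfolding set_lebesgue_integral_def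
  by (subst lborel_integral_real_affine[of "-c" _ t])
     (use assms in \<open>auto simp: indicator_def intro!: arg_cong2[where f="(*)"] Bochner_Integration.integral_cong\<close>)

lemma LINT_interval_split:
  fixes f :: "real \<Rightarrow> real"
  assumes "bm_on {a..c} f" "a \<le> b" "b \<le> c"
  shows "(LINT x:{a..c}|lborel. f x) = (LINT x:{a..b}|lborel. f x) + (LINT x:{b..c}|lborel. f x)"
proof -
  have "(LINT x:{a..b} \<union> {b..c}|lborel. f x) = (LINT x:{a..b}|lborel. f x) + (LINT x:{b..c}|lborel. f x)"
  proof (rule set_integral_Un_AE)
    show "AE x in lborel. \<not> (x \<in> {a..b} \<and> x \<in> {b..c})"
      using AE_lborel_singleton[of b] by (auto elim!: eventually_mono)
  qed (use assms in \<open>auto intro!: bm_on_interval_integrable elim: bm_on_subset\<close>)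
  moreover have "{a..b} \<union> {b..c} = {a..c}" using assms by auto
  ultimately show ?thesis by simp
qed

lemma LINT_interval_empty [simp]: "b \<le> a \<Longrightarrow> (LINT x:{a..b::real}|lborel. f x :: real) = 0"
proof (cases "a = b")
  case True
  then show ?thesis by (simp add: set_integral_at_point)
next
  case False
  moreover assume "b \<le> a"
  ultimately have "{a..b} = {}" by auto
  then show ?thesis by (simp add: set_lebesgue_integral_def)
qed

lemma LINT_cong_AE:
  fixes f g :: "real \<Rightarrow> real"
  assumes "AE x in lborel. x \<in> S \<longrightarrow> f x = g x"
    and "set_integrable lborel S f" "set_integrable lborel S g"
  shows "(LINT x:S|lborel. f x) = (LINT x:S|lborel. g x)"
  unfolding set_lebesgue_integral_def
  by (rule integral_cong_AE)
     (use assms in \<open>auto simp: indicator_def set_integrable_def elim!: eventually_mono\<close>)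

lemma LINT_eq_0:
  fixes f :: "real \<Rightarrow> real"
  assumes "AE x in lborel. x \<in> S \<longrightarrow> f x = 0"
  shows "(LINT x:S|lborel. f x) = 0"
proof -
  have "\<bar>LINT x:S|lborel. f x\<bar> \<le> (LINT x:S|lborel. 0)"
    by (rule abs_set_integral_le) (use assms in \<open>auto simp: set_integrable_def elim!: eventually_mono\<close>)
  then show ?thesis by simp
qed

text \<open>Nonconstant affine maps pull null sets back to null sets. This permits relabelling a
  family of characteristics by entry point, by the time at \<open>x = 0\<close>, or by a point of
  the kernel triangle.\<close>

lemma AE_affine:
  fixes c :: real
  assumes "c \<noteq> 0" "AE x in lborel. P x"
  shows "AE x in lborel. P (t + c * x)"
proof -
  obtain N where N: "N \<in> null_sets lborel" "{x. \<not> P x} \<subseteq> N"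
    using assms(2) by (auto simp: eventually_ae_filter)
  have "AE x in lborel. x \<notin> N" by (rule AE_not_in[OF N(1)])
  then have "AE x in lborel. t + c * x \<notin> N"
    by (rule AE_borel_affine[OF assms(1), rotated]) (use N(1) in \<open>auto simp: null_sets_def\<close>)
  then show ?thesis by (rule eventually_mono) (use N(2) in auto)
qed

lemma LINT_bm_add:
  fixes f g :: "real \<Rightarrow> real"
  shows "bm_on {a..b} f \<Longrightarrow> bm_on {a..b} g \<Longrightarrow>
    (LINT x:{a..b}|lborel. f x + g x) = (LINT x:{a..b}|lborel. f x) + (LINT x:{a..b}|lborel. g x)"
  by (intro set_integral_add bm_on_interval_integrable)

lemma LINT_bm_diff:
  fixes f g :: "real \<Rightarrow> real"
  shows "bm_on {a..b} f \<Longrightarrow> bm_on {a..b} g \<Longrightarrow>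
    (LINT x:{a..b}|lborel. f x - g x) = (LINT x:{a..b}|lborel. f x) - (LINT x:{a..b}|lborel. g x)"
  by (intro set_integral_diff bm_on_interval_integrable)

lemma LINT_bm_sum:
  fixes f :: "'i \<Rightarrow> real \<Rightarrow> real"
  shows "(\<And>i. i \<in> I \<Longrightarrow> bm_on {a..b} (f i)) \<Longrightarrow>
    (LINT x:{a..b}|lborel. \<Sum>i\<in>I. f i x) = (\<Sum>i\<in>I. LINT x:{a..b}|lborel. f i x)"
  by (induction I rule: infinite_finite_induct) (auto simp: LINT_bm_add bm_on_sum)

lemma bm_on_compose_Pair:
  assumes "bm_on T (\<lambda>(x, y). f x y)" "continuous_on S a" "continuous_on S b"
    and "\<And>p. p \<in> S \<Longrightarrow> (a p, b p) \<in> T"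
  shows "bm_on S (\<lambda>p. f (a p) (b p))"
  using bm_on_compose[OF assms(1), of S "\<lambda>p. (a p, b p)"] assms by (simp add: continuous_on_Pair)

lemma bm_on_fst:
  "bm_on T f \<Longrightarrow> (\<And>x y. (x, y) \<in> S \<Longrightarrow> x \<in> T) \<Longrightarrow> bm_on S (\<lambda>(x, y). f x)"
  using bm_on_compose[of T f S fst] by (auto simp: split_beta' continuous_on_fst)

lemma bm_on_snd:
  "bm_on T f \<Longrightarrow> (\<And>x y. (x, y) \<in> S \<Longrightarrow> y \<in> T) \<Longrightarrow> bm_on S (\<lambda>(x, y). f y)"
  using bm_on_compose[of T f S snd] by (auto simp: split_beta' continuous_on_snd)

section \<open>Fubini for bounded Borel functions, and the triangle\<close>

lemma Fubini_bm:
  fixes f :: "real \<Rightarrow> real \<Rightarrow> real"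
  assumes f: "bm_on D (\<lambda>(x, y). f x y)" and D: "D \<in> sets borel" "bounded D"
    and D1: "\<And>x y. (x, y) \<in> D \<longleftrightarrow> x \<in> {0..X} \<and> y \<in> {l x..u x}"
    and D2: "\<And>x y. (x, y) \<in> D \<longleftrightarrow> y \<in> {0..Y} \<and> x \<in> {l' y..u' y}"
  shows "(LINT x:{0..X}|lborel. LINT y:{l x..u x}|lborel. f x y)
       = (LINT y:{0..Y}|lborel. LINT x:{l' y..u' y}|lborel. f x y)"
proof -
  have int: "integrable (lborel \<Otimes>\<^sub>M lborel) (\<lambda>(x, y). indicator D (x, y) * f x y)"
    using bm_on_set_integrable[OF f D] unfolding set_integrable_def lborel_prod
    by (simp add: split_beta')
  have "(LINT x:{0..X}|lborel. LINT y:{l x..u x}|lborel. f x y) = (\<integral>x. \<integral>y. indicator D (x, y) * f x y \<partial>lborel \<partial>lborel)"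
    unfolding set_lebesgue_integral_def integral_scaleR_right[symmetric]
    by (intro Bochner_Integration.integral_cong) (auto simp: indicator_def D1)
  also have "\<dots> = (\<integral>y. \<integral>x. indicator D (x, y) * f x y \<partial>lborel \<partial>lborel)"
    by (rule lborel_pair.Fubini_integral[OF int, symmetric])
  also have "\<dots> = (LINT y:{0..Y}|lborel. LINT x:{l' y..u' y}|lborel. f x y)"
    unfolding set_lebesgue_integral_def integral_scaleR_right[symmetric]
    by (intro Bochner_Integration.integral_cong) (auto simp: indicator_def D2)
  finally show ?thesis .
qed

lemma closed_triangle: "closed (triangle X)"
  unfolding triangle_def split_beta'
  by (intro closed_Collect_conj closed_Collect_le continuous_intros)

lemma bounded_triangle: "bounded (triangle X)"
proof (rule bounded_subset)
  show "triangle X \<subseteq> cbox (0, 0) (X, X)" by (auto simp: triangle_def cbox_Pair_eq)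
qed simp

lemma triangle_swap:
  assumes "bm_on (triangle X) (\<lambda>(x, \<xi>). \<psi> x \<xi>)"
  shows "(LINT x:{0..X}|lborel. LINT \<xi>:{0..x}|lborel. \<psi> x \<xi>)
       = (LINT \<xi>:{0..X}|lborel. LINT x:{\<xi>..X}|lborel. \<psi> x \<xi>)"
  by (rule Fubini_bm[OF assms borel_closed[OF closed_triangle] bounded_triangle])
     (auto simp: triangle_def)

lemma bm_on_triangle_integral:
  assumes "bm_on (triangle X) (\<lambda>(x, \<xi>). \<psi> x \<xi>)"
  shows "bm_on {0..X} (\<lambda>x. LINT \<xi>:{0..x}|lborel. \<psi> x \<xi>)"
  by (rule bm_on_param_integral[where C=X])
     (auto intro!: continuous_intros bm_on_subset[OF assms] simp: triangle_def)

lemma bm_on_indefinite_integral: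
  fixes f :: "real \<Rightarrow> real"
  assumes "bm_on {0..X} f"
  shows "bm_on {0..X} (\<lambda>x. LINT \<xi>:{0..x}|lborel. f \<xi>)"
  by (rule bm_on_triangle_integral)
     (rule bm_on_snd[OF assms], auto simp: triangle_def)

text \<open>Fubini on the square, cut along its diagonal.\<close>

lemma LINT_product_rule:
  fixes a b u v :: "real \<Rightarrow> real"
  assumes a: "bm_on {0..S} a" and b: "bm_on {0..S} b" and S: "0 \<le> S"
    and u: "\<And>s. 0 \<le> s \<Longrightarrow> s \<le> S \<Longrightarrow> u s = u 0 + (LINT \<sigma>:{0..s}|lborel. a \<sigma>)"
    and v: "\<And>s. 0 \<le> s \<Longrightarrow> s \<le> S \<Longrightarrow> v s = v 0 + (LINT \<sigma>:{0..s}|lborel. b \<sigma>)"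
  shows "u S * v S = u 0 * v 0 + (LINT \<sigma>:{0..S}|lborel. a \<sigma> * v \<sigma> + u \<sigma> * b \<sigma>)"
proof -
  define A where "A s = (LINT \<sigma>:{0..s}|lborel. a \<sigma>)" for s
  define B where "B s = (LINT \<sigma>:{0..s}|lborel. b \<sigma>)" for s
  have mA: "bm_on {0..S} A" and mB: "bm_on {0..S} B"
    unfolding A_def B_def using a b by (auto intro: bm_on_indefinite_integral)
  have tri: "bm_on (triangle S) (\<lambda>(s, \<sigma>). a s * b \<sigma>)"
    using bm_on_mult[OF bm_on_fst[OF a, of "triangle S"] bm_on_snd[OF b, of "triangle S"]]
    by (auto simp: triangle_def split_beta')
  have "(LINT s:{0..S}|lborel. a s * B s) = (LINT \<sigma>:{0..S}|lborel. LINT s:{\<sigma>..S}|lborel. a s * b \<sigma>)"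
    unfolding B_def using triangle_swap[OF tri] by simp
  also have "\<dots> = (LINT \<sigma>:{0..S}|lborel. (A S - A \<sigma>) * b \<sigma>)"
  proof (rule set_lebesgue_integral_cong)
    show "\<forall>\<sigma>. \<sigma> \<in> {0..S} \<longrightarrow> (LINT s:{\<sigma>..S}|lborel. a s * b \<sigma>) = (A S - A \<sigma>) * b \<sigma>"
      using LINT_interval_split[OF a] unfolding A_def by auto
  qed simp
  also have "\<dots> = A S * B S - (LINT \<sigma>:{0..S}|lborel. A \<sigma> * b \<sigma>)"
    unfolding left_diff_distrib B_def
    by (simp add: LINT_bm_diff bm_on_mult bm_on_const mA b)
  finally have parts: "A S * B S = (LINT s:{0..S}|lborel. a s * B s) + (LINT \<sigma>:{0..S}|lborel. A \<sigma> * b \<sigma>)"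
    by simp
  have "(LINT \<sigma>:{0..S}|lborel. a \<sigma> * v \<sigma> + u \<sigma> * b \<sigma>)
      = (LINT \<sigma>:{0..S}|lborel. (v 0 * a \<sigma> + a \<sigma> * B \<sigma>) + (u 0 * b \<sigma> + A \<sigma> * b \<sigma>))"
  proof (rule set_lebesgue_integral_cong)
    show "\<forall>\<sigma>. \<sigma> \<in> {0..S} \<longrightarrow>
      a \<sigma> * v \<sigma> + u \<sigma> * b \<sigma> = (v 0 * a \<sigma> + a \<sigma> * B \<sigma>) + (u 0 * b \<sigma> + A \<sigma> * b \<sigma>)"
    proof (intro allI impI)
      fix \<sigma> assume "\<sigma> \<in> {0..S}"
      then have "u \<sigma> = u 0 + A \<sigma>" "v \<sigma> = v 0 + B \<sigma>" using u[of \<sigma>] v[of \<sigma>] by (auto simp: A_def B_def)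
      then show "a \<sigma> * v \<sigma> + u \<sigma> * b \<sigma> = (v 0 * a \<sigma> + a \<sigma> * B \<sigma>) + (u 0 * b \<sigma> + A \<sigma> * b \<sigma>)"
        by (simp add: algebra_simps)
    qed
  qed simp
  also have "\<dots> = v 0 * A S + (LINT s:{0..S}|lborel. a s * B s) + (u 0 * B S + (LINT \<sigma>:{0..S}|lborel. A \<sigma> * b \<sigma>))"
    unfolding A_def[of S] B_def[of S]
    by (simp add: LINT_bm_add bm_on_add bm_on_mult bm_on_const a b mA mB)
  also have "\<dots> = v 0 * A S + u 0 * B S + A S * B S" using parts by simp
  finally show ?thesis using u[of S] v[of S] S by (simp add: A_def B_def algebra_simps)
qed

section \<open>Uniqueness for the evolution in space\<close>

text \<open>The shear \<open>(x, \<tau>) \<mapsto> (x, \<tau> + q * x)\<close> preserves null sets,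
  so by Fubini "almost every point of almost every line" means almost every point of the plane. The
  right-hand side does not mention \<open>q\<close>: applied twice, the lemma carries a statement
  from the lines of one component to those of another.\<close>

lemma AE_line_change:
  fixes q :: real
  assumes P: "Measurable.pred (borel \<Otimes>\<^sub>M borel) (\<lambda>p. P (fst p) (snd p))"
  shows "(AE \<tau> in lborel. AE x in lborel. P x (\<tau> + q * x)) \<longleftrightarrow> (AE x in lborel. AE t in lborel. P x t)"
proof -
  have P': "Measurable.pred (borel \<Otimes>\<^sub>M borel) (\<lambda>p. P (snd p) (fst p + q * snd p))"
    by (rule measurable_compose[OF _ P, of "\<lambda>p. (snd p, fst p + q * snd p)", simplified]) measurable
  have "(AE \<tau> in lborel. AE x in lborel. P x (\<tau> + q * x)) \<longleftrightarrow> (AE x in lborel. AE \<tau> in lborel. P x (\<tau> + q * x))"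
    by (rule lborel_pair.AE_commute) (use P' in \<open>simp add: pred_def space_pair_measure\<close>)
  also have "(\<lambda>x. AE \<tau> in lborel. P x (\<tau> + q * x)) = (\<lambda>x. AE t in lborel. P x t)"
  proof
    fix x
    show "(AE \<tau> in lborel. P x (\<tau> + q * x)) = (AE t in lborel. P x t)"
    proof
      assume "AE \<tau> in lborel. P x (\<tau> + q * x)"
      then have "AE t in lborel. P x ((- q * x + 1 * t) + q * x)" by (rule AE_affine[rotated]) simp
      then show "AE t in lborel. P x t" by simp
    next
      assume "AE t in lborel. P x t"
      then have "AE \<tau> in lborel. P x (q * x + 1 * \<tau>)" by (rule AE_affine[rotated]) simp
      then show "AE \<tau> in lborel. P x (\<tau> + q * x)" by (simp add: add.commute)
    qed
  qed
  finally show ?thesis .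
qed

lemma LINT_exp:
  fixes C :: real
  assumes "C > 0" "0 \<le> x"
  shows "(LINT y:{0..x}|lborel. exp (C * y)) = (exp (C * x) - 1) / C"
proof -
  have "(\<integral>y. indicator {0..x} y *\<^sub>R exp (C * y) \<partial>lborel) = exp (C * x) / C - exp (C * 0) / C"
    by (rule integral_FTC_Icc)
       (use assms in \<open>auto intro!: derivative_eq_intros continuous_intros
          simp: has_real_derivative_iff_has_vector_derivative[symmetric]\<close>)
  then show ?thesis by (simp add: set_lebesgue_integral_def diff_divide_distrib)
qed

text \<open>All components enter through \<open>x = 0\<close>, so \<open>x\<close> plays the role of time: a weighted bound
  \<open>b * exp (C * x)\<close> on the domain of dependence improves itself to \<open>b / 2 * exp (C * x)\<close>.\<close>

lemma char_uniqueness: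
  fixes u f :: "'i::finite \<Rightarrow> real \<Rightarrow> real \<Rightarrow> real" and q :: "'i \<Rightarrow> real"
  assumes T0: "0 \<le> T0" and q: "0 \<le> k" "0 \<le> r" "\<And>i. - k \<le> q i" "\<And>i. q i \<le> r"
    and u: "\<And>i T. bm_on ({0..L} \<times> {0..T}) (\<lambda>(x, t). u i x t)"
    and A: "0 \<le> A" "\<And>i x t b. x \<in> {0..L} \<Longrightarrow> (\<And>j. \<bar>u j x t\<bar> \<le> b) \<Longrightarrow> \<bar>f i x t\<bar> \<le> A * b"
    and eq: "\<And>i. AE \<tau> in lborel. \<forall>x\<in>{0..L}. T0 + r * x < \<tau> + q i * x \<longrightarrow>
               u i x (\<tau> + q i * x) = q i * (LINT y:{0..x}|lborel. f i y (\<tau> + q i * y))"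
  shows "AE \<tau> in lborel. \<forall>x\<in>{0..L}. T0 + r * x < \<tau> + q i * x \<longrightarrow> u i x (\<tau> + q i * x) = 0"
proof -
  \<comment> \<open>A region closed under following any line to smaller \<open>x\<close>: its lower
    edge has slope \<open>r\<close>, at least every \<open>q i\<close>, and its upper edge has slope
    \<open>-k\<close>, at most every \<open>q i\<close>. The cutoff \<open>Tm\<close> makes it
    bounded, so that \<open>u\<close> has a first bound there.\<close>
  define R where "R Tm x t \<longleftrightarrow> x \<in> {0..L} \<and> T0 + r * x < t \<and> t < Tm - k * x" for Tm x t
  \<comment> \<open>Integrating the weight gains \<open>1 / C\<close> and
    \<open>\<bar>q i\<bar> \<le> k + r\<close>, so the bound is multiplied by
    \<open>(k + r) * A / C\<close>, which is at most 1/2. The summand 1 keeps \<open>C\<close>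
    positive when the other term is zero.\<close>
  define C where "C = 2 * (k + r) * A + 1"
  have C: "C > 0" unfolding C_def using q(1,2) A(1) by (simp add: add_nonneg_pos)
  have vanish: "AE \<tau> in lborel. \<forall>x. R Tm x (\<tau> + q i * x) \<longrightarrow> u i x (\<tau> + q i * x) = 0" for Tm i
  proof -
    define bd where "bd b \<longleftrightarrow> (\<forall>i. AE \<tau> in lborel. \<forall>x. R Tm x (\<tau> + q i * x) \<longrightarrow>
      \<bar>u i x (\<tau> + q i * x)\<bar> \<le> b * exp (C * x))" for b
    have R_strip: "x \<in> {0..L} \<and> t \<in> {0..Tm}" if "R Tm x t" for x t
      using that T0 mult_nonneg_nonneg[OF q(1), of x] mult_nonneg_nonneg[OF q(2), of x] by (auto simp: R_def)
    obtain B' where B': "\<And>i x t. x \<in> {0..L} \<Longrightarrow> t \<in> {0..Tm} \<Longrightarrow> \<bar>u i x t\<bar> \<le> B' i" "\<And>i. B' i \<ge> 0"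
    proof -
      have "\<exists>B\<ge>0. \<forall>x\<in>{0..L}. \<forall>t\<in>{0..Tm}. \<bar>u i x t\<bar> \<le> B" for i
        using bm_on_bound[OF u[of Tm i]] by (metis (mono_tags, lifting) SigmaI case_prod_conv)
      then show ?thesis using that by metis
    qed
    define B where "B = (\<Sum>i\<in>UNIV. B' i)"
    have B: "\<bar>u i x t\<bar> \<le> B" if "x \<in> {0..L}" "t \<in> {0..Tm}" for i x t
      using B'(1)[OF that, of i] member_le_sum[of i UNIV B'] B'(2) unfolding B_def by force
    have "B \<ge> 0" unfolding B_def using B'(2) by (simp add: sum_nonneg)
    have base: "bd B"
      unfolding bd_def
    proof (intro allI AE_I2 impI)
      fix i \<tau> x assume "R Tm x (\<tau> + q i * x)"
      from R_strip[OF this] have "\<bar>u i x (\<tau> + q i * x)\<bar> \<le> B" "x \<ge> 0" using B by auto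
      moreover from this have "B * 1 \<le> B * exp (C * x)" using \<open>B \<ge> 0\<close> C by (intro mult_left_mono) auto
      ultimately show "\<bar>u i x (\<tau> + q i * x)\<bar> \<le> B * exp (C * x)" by simp
    qed
    have step: "bd (b / 2)" if "b \<ge> 0" "bd b" for b
      unfolding bd_def
    proof
      fix i
      have "AE \<tau> in lborel. AE x in lborel. R Tm x (\<tau> + q i * x) \<longrightarrow> \<bar>u j x (\<tau> + q i * x)\<bar> \<le> b * exp (C * x)" for j
      proof -
        \<comment> \<open>\<open>AE_line_change\<close> wants a predicate that is Borel on the whole
          plane, whereas \<open>u j\<close> is controlled on the strip only. The extension by zero
          agrees with it wherever \<open>R\<close> holds.\<close>
        define w where "w p = indicator ({0..L} \<times> {0..Tm}) p *\<^sub>R (case p of (x, t) \<Rightarrow> u j x t)" for p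
        have [measurable]: "w \<in> borel_measurable (borel \<Otimes>\<^sub>M borel)"
          unfolding borel_prod w_def
          by (rule bm_on_indicator_measurable[OF u]) (auto intro!: borel_closed closed_Times)
        have wu: "w (x, t) = u j x t" if "R Tm x t" for x t
          using R_strip[OF that] by (auto simp: w_def)
        have "Measurable.pred (borel \<Otimes>\<^sub>M borel)
            (\<lambda>p. R Tm (fst p) (snd p) \<longrightarrow> \<bar>w (fst p, snd p)\<bar> \<le> b * exp (C * fst p))"
          unfolding R_def by measurable
        then have P: "Measurable.pred (borel \<Otimes>\<^sub>M borel)
            (\<lambda>p. R Tm (fst p) (snd p) \<longrightarrow> \<bar>u j (fst p) (snd p)\<bar> \<le> b * exp (C * fst p))"
          by (rule measurable_cong[THEN iffD1, rotated]) (auto simp: wu[symmetric])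
        have "AE \<tau> in lborel. AE x in lborel. R Tm x (\<tau> + q j * x) \<longrightarrow> \<bar>u j x (\<tau> + q j * x)\<bar> \<le> b * exp (C * x)"
          using \<open>bd b\<close> unfolding bd_def by (auto elim!: allE[of _ j] eventually_mono)
        then show ?thesis unfolding AE_line_change[OF P] .
      qed
      then have "AE \<tau> in lborel. \<forall>j. AE x in lborel. R Tm x (\<tau> + q i * x) \<longrightarrow> \<bar>u j x (\<tau> + q i * x)\<bar> \<le> b * exp (C * x)"
        by (intro AE_all_countable[THEN iffD2] allI)
      then show "AE \<tau> in lborel. \<forall>x. R Tm x (\<tau> + q i * x) \<longrightarrow> \<bar>u i x (\<tau> + q i * x)\<bar> \<le> b / 2 * exp (C * x)"
        using eq[of i]
      proof eventually_elim
        case (elim \<tau>)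
        then have ae: "AE y in lborel. \<forall>j. R Tm y (\<tau> + q i * y) \<longrightarrow> \<bar>u j y (\<tau> + q i * y)\<bar> \<le> b * exp (C * y)"
          by (intro AE_all_countable[THEN iffD2] allI) blast
        show ?case
        proof (intro allI impI)
          fix x assume R: "R Tm x (\<tau> + q i * x)"
          then have x: "0 \<le> x" "x \<le> L" by (auto simp: R_def)
          have R': "R Tm y (\<tau> + q i * y)" if "y \<in> {0..x}" for y
          proof -
            have "(r - q i) * y \<le> (r - q i) * x" "(k + q i) * y \<le> (k + q i) * x"
              using that q(3)[of i] q(4)[of i] by (auto intro!: mult_left_mono)
            then show ?thesis using R that unfolding R_def by (auto simp: algebra_simps)
          qed
          have "\<bar>LINT y:{0..x}|lborel. f i y (\<tau> + q i * y)\<bar> \<le> (LINT y:{0..x}|lborel. A * b * exp (C * y))"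
          proof (rule abs_set_integral_le)
            show "AE y in lborel. y \<in> {0..x} \<longrightarrow> \<bar>f i y (\<tau> + q i * y)\<bar> \<le> A * b * exp (C * y)"
              using ae
            proof eventually_elim
              case (elim y)
              show ?case
              proof
                assume y: "y \<in> {0..x}"
                show "\<bar>f i y (\<tau> + q i * y)\<bar> \<le> A * b * exp (C * y)"
                  using A(2)[of y "\<tau> + q i * y" "b * exp (C * y)" i] elim R'[OF y] y x by (auto simp: mult.assoc)
              qed
            qed
          qed (auto intro!: bm_on_interval_integrable bm_on_continuous continuous_intros)
          also have "\<dots> = A * b * ((exp (C * x) - 1) / C)"
            using LINT_exp[OF C x(1)] by simp
          finally have "\<bar>q i\<bar> * \<bar>LINT y:{0..x}|lborel. f i y (\<tau> + q i * y)\<bar> \<le> (k + r) * (A * b * ((exp (C * x) - 1) / C))"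
            using q(1,2) q(3)[of i] q(4)[of i] by (intro mult_mono) auto
          also have "\<dots> \<le> (k + r) * (A * b * (exp (C * x) / C))"
            using q(1,2) A(1) that C by (intro mult_left_mono divide_right_mono) auto
          also have "\<dots> = ((k + r) * A / C) * (b * exp (C * x))" by simp
          also have "\<dots> \<le> (1 / 2) * (b * exp (C * x))"
            using C that by (intro mult_right_mono) (auto simp: C_def field_simps)
          finally have "\<bar>q i * (LINT y:{0..x}|lborel. f i y (\<tau> + q i * y))\<bar> \<le> b / 2 * exp (C * x)"
            by (simp add: abs_mult)
          then show "\<bar>u i x (\<tau> + q i * x)\<bar> \<le> b / 2 * exp (C * x)"
            using elim(2) x R by (auto simp: R_def)
        qed
      qed
    qed
    have "bd (B / 2 ^ n)" for n
      by (induction n) (use base step[of "B / 2 ^ _"] \<open>B \<ge> 0\<close> in \<open>auto simp: field_simps\<close>)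
    then have "AE \<tau> in lborel. \<forall>n x. R Tm x (\<tau> + q i * x) \<longrightarrow> \<bar>u i x (\<tau> + q i * x)\<bar> \<le> B / 2 ^ n * exp (C * x)"
      by (intro AE_all_countable[THEN iffD2] allI) (auto simp: bd_def)
    then show ?thesis
    proof eventually_elim
      case (elim \<tau>)
      show ?case
      proof (intro allI impI)
        fix x assume "R Tm x (\<tau> + q i * x)"
        then have "\<bar>u i x (\<tau> + q i * x)\<bar> \<le> B / 2 ^ n * exp (C * x)" for n
          using elim by blast
        then have "\<bar>u i x (\<tau> + q i * x)\<bar> \<le> B * exp (C * x) * (1 / 2) ^ n" for n
          by (simp add: power_one_over)
        moreover have "(\<lambda>n. B * exp (C * x) * (1 / 2) ^ n) \<longlonglongrightarrow> B * exp (C * x) * 0"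
          by (intro tendsto_intros LIMSEQ_power_zero) auto
        ultimately have "\<bar>u i x (\<tau> + q i * x)\<bar> \<le> B * exp (C * x) * 0"
          by (intro tendsto_lowerbound[of _ _ sequentially]) auto
        then show "u i x (\<tau> + q i * x) = 0" by simp
      qed
    qed
  qed
  \<comment> \<open>Integer cutoffs exhaust all times, and countably many exceptional sets are still
    null together.\<close>
  have "AE \<tau> in lborel. \<forall>n x. R (real n) x (\<tau> + q i * x) \<longrightarrow> u i x (\<tau> + q i * x) = 0"
    by (intro AE_all_countable[THEN iffD2] allI vanish)
  then show ?thesis
  proof eventually_elim
    case (elim \<tau>)
    show ?case
    proof (intro ballI impI)
      fix x assume "x \<in> {0..L}" "T0 + r * x < \<tau> + q i * x"
      moreover obtain n where "\<tau> + q i * x + k * x < real n" using reals_Archimedean2 by blast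
      ultimately have "R (real n) x (\<tau> + q i * x)" by (auto simp: R_def)
      then show "u i x (\<tau> + q i * x) = 0" using elim by blast
    qed
  qed
qed

abbreviation bm2 :: "(real \<times> real) set \<Rightarrow> (real \<Rightarrow> real \<Rightarrow> real) \<Rightarrow> bool" where
  "bm2 S u \<equiv> bm_on S (\<lambda>(x, y). u x y)"

lemma bm2_const [intro]: "bm2 S (\<lambda>x y. c)"
  and bm2_add [intro]: "bm2 S u \<Longrightarrow> bm2 S v \<Longrightarrow> bm2 S (\<lambda>x y. u x y + v x y)"
  and bm2_diff [intro]: "bm2 S u \<Longrightarrow> bm2 S v \<Longrightarrow> bm2 S (\<lambda>x y. u x y - v x y)"
  and bm2_mult [intro]: "bm2 S u \<Longrightarrow> bm2 S v \<Longrightarrow> bm2 S (\<lambda>x y. u x y * v x y)"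
  and bm2_sum [intro]: "(\<And>i. i \<in> I \<Longrightarrow> bm2 S (w i)) \<Longrightarrow> bm2 S (\<lambda>x y. \<Sum>i\<in>I. w i x y)"
  by (auto simp: split_beta')

lemma bm2_compose:
  assumes "bm2 T f" "continuous_on S (\<lambda>(x, y). a x y)" "continuous_on S (\<lambda>(x, y). b x y)"
    and "\<And>x y. (x, y) \<in> S \<Longrightarrow> (a x y, b x y) \<in> T"
  shows "bm2 S (\<lambda>x y. f (a x y) (b x y))"
  using bm_on_compose_Pair[OF assms(1-3)] assms(4) by (auto simp: split_beta')

section \<open>The divergence theorem on the triangle along characteristics\<close>

text \<open>\<open>p \<phi>\<^sub>x - k \<phi>\<^sub>\<xi> = \<psi>\<close>: characteristics start on the diagonal and leave through
  \<open>\<xi> = 0\<close> or \<open>x = X\<close>; they are indexed by their starting point \<open>(y, y)\<close>.\<close>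

lemma divergence_diagonal:
  assumes p: "p > 0" and k: "k > 0" and X: "X \<ge> 0"
    and \<phi>: "bm2 (triangle X) \<phi>" and \<psi>: "bm2 (triangle X) \<psi>"
    and id: "AE y in lborel. y \<in> {0..X} \<longrightarrow> (\<forall>s\<ge>0. y + p * s \<le> X \<longrightarrow> k * s \<le> y \<longrightarrow>
      \<phi> (y + p * s) (y - k * s) = \<phi> y y + (LINT \<sigma>:{0..s}|lborel. \<psi> (y + p * \<sigma>) (y - k * \<sigma>)))"
  shows "(LINT x:{0..X}|lborel. LINT \<xi>:{0..x}|lborel. \<psi> x \<xi>)
    = p * (LINT \<xi>:{0..X}|lborel. \<phi> X \<xi>) + k * (LINT x:{0..X}|lborel. \<phi> x 0)
      - (p + k) * (LINT x:{0..X}|lborel. \<phi> x x)"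
proof -
  \<comment> \<open>Over \<open>x\<close>, the characteristic from \<open>(y, y)\<close> has height
    \<open>y * c - k / p * x\<close>. So \<open>c\<close> is the Jacobian of the change from
    \<open>\<xi>\<close> to \<open>y\<close>, and \<open>y = a * x\<close> labels the line that
    reaches \<open>\<xi> = 0\<close> exactly at \<open>x\<close>.\<close>
  define c where "c = (p + k) / p"
  define a where "a = k / (p + k)"
  have c: "c > 0" and a: "0 < a" "a < 1" using p k by (auto simp: c_def a_def)
  have ca: "c * a = k / p" "c = 1 + k / p" using p k by (auto simp: c_def a_def divide_simps)
  have cx: "c * (a * x) = k / p * x" "c * x = x + k / p * x" for x
    unfolding mult.assoc[symmetric] ca(1) by (simp_all add: ca(2) distrib_right)
  \<comment> \<open>The parameter at the exit point: whichever of the sides \<open>x = X\<close> and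
    \<open>\<xi> = 0\<close> is met first.\<close>
  define sx where "sx y = min ((X - y) / p) (y / k)" for y
  define D where "D = {(x, y). 0 \<le> x \<and> x \<le> X \<and> a * x \<le> y \<and> y \<le> x}"
  have "closed D" unfolding D_def split_beta'
    by (intro closed_Collect_conj closed_Collect_le continuous_intros)
  moreover have "D \<subseteq> cbox (0, 0) (X, X)"
  proof (rule subrelI)
    fix x y assume "(x, y) \<in> D"
    moreover from this have "0 \<le> y" using a order_trans[OF mult_nonneg_nonneg[of a x], of y] by (simp add: D_def)
    ultimately show "(x, y) \<in> cbox (0, 0) (X, X)" by (auto simp: D_def cbox_Pair_eq)
  qed
  ultimately have D: "D \<in> sets borel" "bounded D"
    by (auto intro: borel_closed bounded_subset[OF bounded_cbox])
  have mD: "bm2 D (\<lambda>x y. \<psi> x (y * c - k / p * x))"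
  proof (rule bm2_compose[OF \<psi>])
    fix x y assume "(x, y) \<in> D"
    then have *: "a * x \<le> y" "y \<le> x" "0 \<le> x" "x \<le> X" by (auto simp: D_def)
    have "c * (a * x) \<le> c * y" "c * y \<le> c * x" using c * by (auto intro!: mult_left_mono)
    then show "(x, y * c - k / p * x) \<in> triangle X"
      using * cx by (auto simp: triangle_def mult.commute[of y])
  qed (use p in \<open>auto intro!: continuous_intros simp: split_beta'\<close>)
  have exit: "y + p * sx y \<le> X" "k * sx y \<le> y" "0 \<le> sx y" if "y \<in> {0..X}" for y
  proof -
    have "sx y \<le> (X - y) / p" "sx y \<le> y / k" by (auto simp: sx_def)
    then show "y + p * sx y \<le> X" "k * sx y \<le> y" using p k by (auto simp: field_simps)
    show "0 \<le> sx y" using that p k by (auto simp: sx_def)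
  qed
  have mexit: "bm_on {0..X} (\<lambda>y. \<phi> (y + p * sx y) (y - k * sx y))"
  proof (rule bm_on_compose_Pair[OF \<phi>])
    fix y assume y: "y \<in> {0..X}"
    have "0 \<le> p * sx y" "0 \<le> k * sx y" using exit[OF y] p k by auto
    then show "(y + p * sx y, y - k * sx y) \<in> triangle X"
      using exit[OF y] y by (auto simp: triangle_def)
  qed (use p k in \<open>auto simp: sx_def intro!: continuous_intros\<close>)
  have mdiag: "bm_on {0..X} (\<lambda>y. \<phi> y y)"
    by (rule bm_on_compose_Pair[OF \<phi>]) (auto simp: triangle_def intro!: continuous_intros)
  have "(LINT x:{0..X}|lborel. LINT \<xi>:{0..x}|lborel. \<psi> x \<xi>)
      = (LINT x:{0..X}|lborel. c * (LINT y:{a * x..x}|lborel. \<psi> x (y * c - k / p * x)))"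
  proof (rule set_lebesgue_integral_cong)
    show "\<forall>x. x \<in> {0..X} \<longrightarrow> (LINT \<xi>:{0..x}|lborel. \<psi> x \<xi>)
        = c * (LINT y:{a * x..x}|lborel. \<psi> x (y * c - k / p * x))"
    proof (intro allI impI)
      fix x
      have "- (k / p * x) + c * (a * x) = 0" "- (k / p * x) + c * x = x"
        by (simp add: cx(1)) (simp add: cx(2))
      then show "(LINT \<xi>:{0..x}|lborel. \<psi> x \<xi>) = c * (LINT y:{a * x..x}|lborel. \<psi> x (y * c - k / p * x))"
        using LINT_interval_affine[OF c, of "- (k / p * x)" "a * x" x "\<psi> x"] by (simp add: mult.commute)
    qed
  qed simp
  also have "\<dots> = c * (LINT x:{0..X}|lborel. LINT y:{a * x..x}|lborel. \<psi> x (y * c - k / p * x))" by simp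
  also have "(LINT x:{0..X}|lborel. LINT y:{a * x..x}|lborel. \<psi> x (y * c - k / p * x))
      = (LINT y:{0..X}|lborel. LINT x:{y..min X (y / a)}|lborel. \<psi> x (y * c - k / p * x))"
  proof (rule Fubini_bm[OF mD D])
    fix x y
    show "(x, y) \<in> D \<longleftrightarrow> y \<in> {0..X} \<and> x \<in> {y..min X (y / a)}"
    proof
      assume "(x, y) \<in> D"
      moreover from this have "0 \<le> y" using a order_trans[OF mult_nonneg_nonneg[of a x], of y] by (simp add: D_def)
      ultimately show "y \<in> {0..X} \<and> x \<in> {y..min X (y / a)}" using a by (auto simp: D_def field_simps)
    next
      assume "y \<in> {0..X} \<and> x \<in> {y..min X (y / a)}"
      then show "(x, y) \<in> D" using a by (auto simp: D_def field_simps)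
    qed
  qed (auto simp: D_def)
  also have "\<dots> = (LINT y:{0..X}|lborel. p * (\<phi> (y + p * sx y) (y - k * sx y) - \<phi> y y))"
  proof -
    have inner: "(LINT x:{y..min X (y / a)}|lborel. \<psi> x (y * c - k / p * x))
        = p * (LINT \<sigma>:{0..sx y}|lborel. \<psi> (y + p * \<sigma>) (y - k * \<sigma>))" if "y \<in> {0..X}" for y
    proof -
      have "y + p * sx y = min X (y / a)"
        using p k by (auto simp: sx_def a_def min_def field_simps)
      moreover have "y * c - k / p * (y + p * \<sigma>) = y - k * \<sigma>" for \<sigma>
        using p by (simp add: ca(2) field_simps)
      ultimately show ?thesis
        using LINT_interval_affine[OF p, of y 0 "sx y" "\<lambda>x. \<psi> x (y * c - k / p * x)"] by simp
    qed
    have "(LINT y:{0..X}|lborel. LINT x:{y..min X (y / a)}|lborel. \<psi> x (y * c - k / p * x))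
        = (LINT y:{0..X}|lborel. p * (LINT \<sigma>:{0..sx y}|lborel. \<psi> (y + p * \<sigma>) (y - k * \<sigma>)))"
      by (rule set_lebesgue_integral_cong) (use inner in auto)
    also have "\<dots> = (LINT y:{0..X}|lborel. p * (\<phi> (y + p * sx y) (y - k * sx y) - \<phi> y y))"
    proof (rule LINT_cong_AE)
      show "AE y in lborel. y \<in> {0..X} \<longrightarrow> p * (LINT \<sigma>:{0..sx y}|lborel. \<psi> (y + p * \<sigma>) (y - k * \<sigma>))
          = p * (\<phi> (y + p * sx y) (y - k * sx y) - \<phi> y y)"
        using id by eventually_elim (use exit in auto)
      have "bm_on {0..X} (\<lambda>y. LINT \<sigma>:{0..sx y}|lborel. \<psi> (y + p * \<sigma>) (y - k * \<sigma>))"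
      proof (rule bm_on_param_integral[where C="X / p"])
        show "bm2 {(y, \<sigma>). y \<in> {0..X} \<and> 0 \<le> \<sigma> \<and> \<sigma> \<le> sx y} (\<lambda>y \<sigma>. \<psi> (y + p * \<sigma>) (y - k * \<sigma>))"
        proof (rule bm2_compose[OF \<psi>])
          fix y \<sigma> assume "(y, \<sigma>) \<in> {(y, \<sigma>). y \<in> {0..X} \<and> 0 \<le> \<sigma> \<and> \<sigma> \<le> sx y}"
          then have *: "y \<in> {0..X}" "0 \<le> \<sigma>" "\<sigma> \<le> sx y" by auto
          then have "0 \<le> p * \<sigma>" "0 \<le> k * \<sigma>" "p * \<sigma> \<le> p * sx y" "k * \<sigma> \<le> k * sx y"
            using p k by (auto intro: mult_left_mono)
          then show "(y + p * \<sigma>, y - k * \<sigma>) \<in> triangle X"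
            using exit[OF *(1)] * by (auto simp: triangle_def)
        qed (auto intro!: continuous_intros simp: split_beta')
        show "sx y \<le> X / p" if "y \<in> {0..X}" for y
        proof -
          have "(X - y) / p \<le> X / p" using that p by (intro divide_right_mono) auto
          then show ?thesis by (auto simp: sx_def)
        qed
      qed (use p k in \<open>auto simp: sx_def intro!: continuous_intros\<close>)
      then show "set_integrable lborel {0..X} (\<lambda>y. p * (LINT \<sigma>:{0..sx y}|lborel. \<psi> (y + p * \<sigma>) (y - k * \<sigma>)))"
        by (intro bm_on_interval_integrable bm_on_mult bm_on_const)
      show "set_integrable lborel {0..X} (\<lambda>y. p * (\<phi> (y + p * sx y) (y - k * sx y) - \<phi> y y))"
        by (intro bm_on_interval_integrable bm_on_mult bm_on_const bm_on_diff mexit mdiag)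
    qed
    finally show ?thesis .
  qed
  also have "\<dots> = p * ((LINT y:{0..X}|lborel. \<phi> (y + p * sx y) (y - k * sx y)) - (LINT y:{0..X}|lborel. \<phi> y y))"
    by (simp add: LINT_bm_diff mexit mdiag)
  also have "(LINT y:{0..X}|lborel. \<phi> (y + p * sx y) (y - k * sx y))
      = a * (LINT x:{0..X}|lborel. \<phi> x 0) + 1 / c * (LINT \<xi>:{0..X}|lborel. \<phi> X \<xi>)"
  proof -
    \<comment> \<open>Lines with \<open>y \<le> a * X\<close> leave through the bottom at
      \<open>(y / a, 0)\<close>, the others through the right side. Stretching the two ranges of
      \<open>y\<close> to full sides yields the factors \<open>a\<close> and
      \<open>1 / c\<close>.\<close>
    have aX: "0 \<le> a * X" "a * X \<le> X" using a X by (auto simp: mult_left_le_one_le)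
    have e1: "\<phi> (y + p * sx y) (y - k * sx y) = \<phi> (y / a) 0" if "y \<in> {0..a * X}" for y
    proof -
      have "y / k \<le> (X - y) / p" using that p k by (auto simp: a_def field_simps)
      then have "sx y = y / k" by (simp add: sx_def)
      moreover have "y + p * (y / k) = y / a" using p k by (auto simp: a_def field_simps)
      ultimately show ?thesis using k by simp
    qed
    have e2: "\<phi> (y + p * sx y) (y - k * sx y) = \<phi> X (- (k / p * X) + c * y)" if "y \<in> {a * X..X}" for y
    proof -
      have "(X - y) / p \<le> y / k" using that p k by (auto simp: a_def field_simps)
      then have "sx y = (X - y) / p" by (simp add: sx_def)
      moreover have "y - k * ((X - y) / p) = - (k / p * X) + c * y" using p k by (auto simp: ca(2) field_simps)
      ultimately show ?thesis using p by simp
    qed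
    have "(LINT y:{0..X}|lborel. \<phi> (y + p * sx y) (y - k * sx y))
      = (LINT y:{0..a * X}|lborel. \<phi> (y + p * sx y) (y - k * sx y))
        + (LINT y:{a * X..X}|lborel. \<phi> (y + p * sx y) (y - k * sx y))"
    by (rule LINT_interval_split[OF mexit aX])
    also have "(LINT y:{0..a * X}|lborel. \<phi> (y + p * sx y) (y - k * sx y)) = (LINT y:{0..a * X}|lborel. \<phi> (y / a) 0)"
      by (rule set_lebesgue_integral_cong) (use e1 in auto)
    also have "\<dots> = a * (LINT x:{0..X}|lborel. \<phi> x 0)"
      using LINT_interval_affine[OF a(1), of 0 0 X "\<lambda>y. \<phi> (y / a) 0"] a by simp
    also have "(LINT y:{a * X..X}|lborel. \<phi> (y + p * sx y) (y - k * sx y))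
        = (LINT y:{a * X..X}|lborel. \<phi> X (- (k / p * X) + c * y))"
      by (rule set_lebesgue_integral_cong) (use e2 in auto)
    also have "\<dots> = 1 / c * (LINT \<xi>:{0..X}|lborel. \<phi> X \<xi>)"
    proof -
      have "- (k / p * X) + c * (a * X) = 0" "- (k / p * X) + c * X = X"
        by (simp add: cx(1)) (simp add: cx(2))
      then show ?thesis using LINT_interval_affine[OF c, of "- (k / p * X)" "a * X" X "\<phi> X"] c by simp
    qed
    finally show ?thesis .
  qed
  also have "c * (p * (a * (LINT x:{0..X}|lborel. \<phi> x 0) + 1 / c * (LINT \<xi>:{0..X}|lborel. \<phi> X \<xi>)
        - (LINT y:{0..X}|lborel. \<phi> y y)))
      = (p * (c * a)) * (LINT x:{0..X}|lborel. \<phi> x 0) + p * (LINT \<xi>:{0..X}|lborel. \<phi> X \<xi>)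
        - (c * p) * (LINT y:{0..X}|lborel. \<phi> y y)"
    using c by (simp add: algebra_simps)
  also have "p * (c * a) = k" using ca p by simp
  also have "c * p = p + k" using p by (simp add: c_def)
  finally show ?thesis by simp
qed

text \<open>\<open>p \<phi>\<^sub>x + p \<phi>\<^sub>\<xi> = \<psi>\<close>: characteristics run parallel to the diagonal, from \<open>(y, 0)\<close> to
  \<open>(X, X - y)\<close>.\<close>

lemma divergence_parallel:
  assumes p: "p > 0" and X: "X \<ge> 0"
    and \<phi>: "bm2 (triangle X) \<phi>" and \<psi>: "bm2 (triangle X) \<psi>"
    and id: "AE y in lborel. y \<in> {0..X} \<longrightarrow> (\<forall>s\<ge>0. y + p * s \<le> X \<longrightarrow>
      \<phi> (y + p * s) (p * s) = \<phi> y 0 + (LINT \<sigma>:{0..s}|lborel. \<psi> (y + p * \<sigma>) (p * \<sigma>)))"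
  shows "(LINT x:{0..X}|lborel. LINT \<xi>:{0..x}|lborel. \<psi> x \<xi>)
    = p * (LINT \<xi>:{0..X}|lborel. \<phi> X \<xi>) - p * (LINT x:{0..X}|lborel. \<phi> x 0)"
proof -
  \<comment> \<open>The label of a characteristic is \<open>y = x - \<xi>\<close>; for fixed
    \<open>x\<close> this is a reflection, with Jacobian 1, that maps the triangle to
    itself.\<close>
  have m: "bm2 (triangle X) (\<lambda>x y. \<psi> x (x - y))"
    by (rule bm2_compose[OF \<psi>]) (auto intro!: continuous_intros simp: split_beta' triangle_def)
  have "(LINT x:{0..X}|lborel. LINT \<xi>:{0..x}|lborel. \<psi> x \<xi>)
      = (LINT x:{0..X}|lborel. LINT y:{0..x}|lborel. \<psi> x (x - y))"
    by (rule set_lebesgue_integral_cong)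
       (use LINT_interval_reflect[of 1 x x 0 "\<psi> x" for x] in auto)
  also have "\<dots> = (LINT y:{0..X}|lborel. LINT x:{y..X}|lborel. \<psi> x (x - y))"
    by (rule triangle_swap[OF m])
  also have "\<dots> = (LINT y:{0..X}|lborel. p * (LINT \<sigma>:{0..(X - y) / p}|lborel. \<psi> (y + p * \<sigma>) (p * \<sigma>)))"
    by (rule set_lebesgue_integral_cong)
       (use LINT_interval_affine[OF p, of y 0 "(X - y) / p" "\<lambda>x. \<psi> x (x - y)" for y] p in auto)
  also have "\<dots> = (LINT y:{0..X}|lborel. p * (\<phi> X (X - y) - \<phi> y 0))"
  proof (rule LINT_cong_AE)
    show "AE y in lborel. y \<in> {0..X} \<longrightarrow> p * (LINT \<sigma>:{0..(X - y) / p}|lborel. \<psi> (y + p * \<sigma>) (p * \<sigma>))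
          = p * (\<phi> X (X - y) - \<phi> y 0)"
      using id
    proof eventually_elim
      case (elim y)
      show ?case
      proof
        assume y: "y \<in> {0..X}"
        have "p * ((X - y) / p) = X - y" using p by simp
        then show "p * (LINT \<sigma>:{0..(X - y) / p}|lborel. \<psi> (y + p * \<sigma>) (p * \<sigma>)) = p * (\<phi> X (X - y) - \<phi> y 0)"
          using elim y p by (auto dest!: spec[of _ "(X - y) / p"])
      qed
    qed
    have "bm_on {0..X} (\<lambda>y. LINT \<sigma>:{0..(X - y) / p}|lborel. \<psi> (y + p * \<sigma>) (p * \<sigma>))"
    proof (rule bm_on_param_integral[where C="X / p"])
      show "bm2 {(y, \<sigma>). y \<in> {0..X} \<and> 0 \<le> \<sigma> \<and> \<sigma> \<le> (X - y) / p} (\<lambda>y \<sigma>. \<psi> (y + p * \<sigma>) (p * \<sigma>))"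
        by (rule bm2_compose[OF \<psi>])
           (use p in \<open>auto intro!: continuous_intros simp: split_beta' triangle_def field_simps\<close>)
    qed (use p in \<open>auto intro!: continuous_intros divide_right_mono\<close>)
    then show "set_integrable lborel {0..X} (\<lambda>y. p * (LINT \<sigma>:{0..(X - y) / p}|lborel. \<psi> (y + p * \<sigma>) (p * \<sigma>)))"
      by (intro bm_on_interval_integrable bm_on_mult bm_on_const)
    have "bm_on {0..X} (\<lambda>y. \<phi> X (X - y))" "bm_on {0..X} (\<lambda>y. \<phi> y 0)"
      by (rule bm_on_compose_Pair[OF \<phi>]; auto simp: triangle_def intro!: continuous_intros)+
    then show "set_integrable lborel {0..X} (\<lambda>y. p * (\<phi> X (X - y) - \<phi> y 0))"
      by (intro bm_on_interval_integrable bm_on_mult bm_on_const bm_on_diff)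
  qed
  also have "\<dots> = p * ((LINT y:{0..X}|lborel. \<phi> X (X - y)) - (LINT y:{0..X}|lborel. \<phi> y 0))"
  proof -
    have "bm_on {0..X} (\<lambda>y. \<phi> X (X - y))" "bm_on {0..X} (\<lambda>y. \<phi> y 0)"
      by (rule bm_on_compose_Pair[OF \<phi>]; auto simp: triangle_def intro!: continuous_intros)+
    then show ?thesis by (simp add: LINT_bm_diff)
  qed
  also have "(LINT y:{0..X}|lborel. \<phi> X (X - y)) = (LINT \<xi>:{0..X}|lborel. \<phi> X \<xi>)"
    using LINT_interval_reflect[of 1 X X 0 "\<phi> X"] by simp
  finally show ?thesis by (simp add: algebra_simps)
qed

section \<open>Solutions along characteristics, parametrized by \<open>x\<close>\<close>

text \<open>\<open>q\<close> is the slowness, the inverse of the speed; \<open>\<tau>\<close> is the (possibly negative) time at which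
  the characteristic passes through \<open>x = 0\<close>.\<close>

definition char_sol :: "real \<Rightarrow> real \<Rightarrow> (real \<Rightarrow> real \<Rightarrow> real) \<Rightarrow> (real \<Rightarrow> real \<Rightarrow> real) \<Rightarrow> bool" where
  "char_sol L q h g \<longleftrightarrow> (AE \<tau> in lborel. \<forall>a b. 0 \<le> a \<longrightarrow> a \<le> b \<longrightarrow> b \<le> L \<longrightarrow>
     0 \<le> \<tau> + q * a \<longrightarrow> 0 \<le> \<tau> + q * b \<longrightarrow>
     g b (\<tau> + q * b) = g a (\<tau> + q * a) + q * (LINT x:{a..b}|lborel. h x (\<tau> + q * x)))"

lemma line_nonneg:
  fixes q :: real
  assumes "0 \<le> \<tau> + q * a" "0 \<le> \<tau> + q * b" "a \<le> x" "x \<le> b"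
  shows "0 \<le> \<tau> + q * x" "\<tau> + q * x \<le> max (\<tau> + q * a) (\<tau> + q * b)"
proof -
  have "q * a \<le> q * x \<and> q * x \<le> q * b \<or> q * b \<le> q * x \<and> q * x \<le> q * a"
    using assms(3,4) by (cases "q \<ge> 0") (auto intro: mult_left_mono mult_left_mono_neg)
  then show "0 \<le> \<tau> + q * x" "\<tau> + q * x \<le> max (\<tau> + q * a) (\<tau> + q * b)" using assms by auto
qed

lemma bm_on_line:
  assumes "\<And>T. bm2 ({0..L} \<times> {0..T}) h" "0 \<le> a" "b \<le> L" "0 \<le> \<tau> + q * a" "0 \<le> \<tau> + q * b"
  shows "bm_on {a..b} (\<lambda>x. h x (\<tau> + q * x))"
  by (rule bm_on_compose_Pair[OF assms(1)[of "max (\<tau> + q * a) (\<tau> + q * b)"]])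
     (use assms line_nonneg[OF assms(4,5)] in \<open>auto intro!: continuous_intros\<close>)

text \<open>Both \<open>a\<close> and \<open>b\<close> lie downstream of the entry point, so the
  identities from the entry point to each can be subtracted. For \<open>c < 0\<close> the point
  \<open>b\<close> is reached first, which reverses the roles of the two integrals.\<close>

lemma char_identity_slowness:
  assumes c: "c \<noteq> 0" and id: "char_identity L c h g x0 t0" and t0: "0 \<le> t0" and x0: "x0 \<in> {0..L}"
    and h: "\<And>T. bm2 ({0..L} \<times> {0..T}) h"
    and ab: "0 \<le> a" "a \<le> b" "b \<le> L" "0 < c \<and> x0 \<le> a \<or> c < 0 \<and> b \<le> x0"
  shows "g b (t0 - x0 / c + 1 / c * b)
       = g a (t0 - x0 / c + 1 / c * a) + 1 / c * (LINT x:{a..b}|lborel. h x (t0 - x0 / c + 1 / c * x))"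
proof -
  define H where "H x = h x (t0 - x0 / c + 1 / c * x)" for x
  have H: "H (x0 + c * \<sigma>) = h (x0 + c * \<sigma>) (t0 + \<sigma>)" for \<sigma>
    using c by (simp add: H_def add_divide_distrib)
  have t: "t0 - x0 / c + 1 / c * x = t0 + (x - x0) / c" for x
    by (simp add: diff_divide_distrib)
  have cx: "x0 + c * ((x - x0) / c) = x" for x using c by simp
  have id': "g x (t0 - x0 / c + 1 / c * x) = g x0 t0 + (LINT \<sigma>:{0..(x - x0) / c}|lborel. H (x0 + c * \<sigma>))"
    if "0 \<le> (x - x0) / c" "x \<in> {0..L}" for x
    using id[unfolded char_identity_def, rule_format, OF that(1)] that(2) unfolding cx t H by blast
  show ?thesis
  proof (cases "c > 0")
    case True
    have g: "g x (t0 - x0 / c + 1 / c * x) = g x0 t0 + 1 / c * (LINT y:{x0..x}|lborel. H y)"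
      if "x0 \<le> x" "x \<le> L" for x
    proof -
      have "(LINT y:{x0..x}|lborel. H y) = c * (LINT \<sigma>:{0..(x - x0) / c}|lborel. H (x0 + c * \<sigma>))"
        using LINT_interval_affine[OF True, of x0 0 "(x - x0) / c" H] unfolding cx by simp
      then show ?thesis using id'[of x] that x0 True by simp
    qed
    have "(LINT y:{x0..b}|lborel. H y) = (LINT y:{x0..a}|lborel. H y) + (LINT y:{a..b}|lborel. H y)"
    proof (rule LINT_interval_split)
      show "bm_on {x0..b} H" unfolding H_def
      proof (rule bm_on_line[OF h])
        show "0 \<le> t0 - x0 / c + 1 / c * b" unfolding t using t0 ab True by (intro add_nonneg_nonneg) auto
      qed (use True x0 ab t0 in auto)
    qed (use ab True in auto)
    then show ?thesis using g[of a] g[of b] ab True unfolding H_def[symmetric] by (simp add: add_divide_distrib)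
  next
    case False
    then have k: "- c > 0" using c by simp
    have g: "g x (t0 - x0 / c + 1 / c * x) = g x0 t0 - 1 / c * (LINT y:{x..x0}|lborel. H y)"
      if "x \<le> x0" "0 \<le> x" for x
    proof -
      have "x0 - - c * ((x - x0) / c) = x" using cx[of x] by simp
      then have "(LINT y:{x..x0}|lborel. H y) = - c * (LINT \<sigma>:{0..(x - x0) / c}|lborel. H (x0 + c * \<sigma>))"
        using LINT_interval_reflect[OF k, of x0 "(x - x0) / c" 0 H] by simp
      moreover have "0 \<le> (x - x0) / c" using that k by (intro divide_nonpos_nonpos) auto
      ultimately show ?thesis using id'[of x] that x0 c by simp
    qed
    have "(LINT y:{a..x0}|lborel. H y) = (LINT y:{a..b}|lborel. H y) + (LINT y:{b..x0}|lborel. H y)"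
    proof (rule LINT_interval_split)
      show "bm_on {a..x0} H" unfolding H_def
      proof (rule bm_on_line[OF h])
        have "0 \<le> (a - x0) / c" using k ab by (intro divide_nonpos_nonpos) auto
        then show "0 \<le> t0 - x0 / c + 1 / c * a" unfolding t using t0 by simp
      qed (use x0 ab t0 k in auto)
    qed (use ab k in auto)
    then show ?thesis using g[of a] g[of b] ab k unfolding H_def[symmetric] by (simp add: add_divide_distrib)
  qed
qed

text \<open>The line with label \<open>\<tau>\<close> enters at \<open>x = 0\<close>, at
  \<open>x = L\<close> at time \<open>\<tau> + L / c\<close>, or at \<open>t = 0\<close> in the
  point \<open>- (c * \<tau>)\<close>. Each entry parameter is affine in \<open>\<tau>\<close>, so
  the three null sets of entry points become one null set of labels.\<close>

lemma transport_imp_char_sol: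
  assumes c: "c \<noteq> 0" and L: "0 \<le> L" and tr: "transport_solution L c h g"
    and h: "\<And>T. bm2 ({0..L} \<times> {0..T}) h"
  shows "char_sol L (1 / c) h g"
proof -
  have A0: "AE \<tau> in lborel. - (c * \<tau>) \<in> {0..L} \<longrightarrow> char_identity L c h g (- (c * \<tau>)) 0"
    using AE_affine[of "- c" "\<lambda>x0. x0 \<in> {0..L} \<longrightarrow> char_identity L c h g x0 0" 0] c tr
    unfolding transport_solution_def by simp
  have Al: "AE \<tau> in lborel. \<tau> > 0 \<longrightarrow> char_identity L c h g 0 \<tau>"
    using tr unfolding transport_solution_def by simp
  have Ar: "AE \<tau> in lborel. \<tau> + L / c > 0 \<longrightarrow> char_identity L c h g L (\<tau> + L / c)"
    using AE_affine[of 1 "\<lambda>t0. t0 > 0 \<longrightarrow> char_identity L c h g L t0" "L / c"] tr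
    unfolding transport_solution_def by (simp add: add.commute)
  show ?thesis
    unfolding char_sol_def using A0 Al Ar
  proof eventually_elim
    case (elim \<tau>)
    show ?case
    proof (intro allI impI)
      fix a b assume ab: "0 \<le> a" "a \<le> b" "b \<le> L" "0 \<le> \<tau> + 1 / c * a" "0 \<le> \<tau> + 1 / c * b"
      have conv: "x0 \<in> {0..L} \<Longrightarrow> 0 \<le> t0 \<Longrightarrow> t0 - x0 / c = \<tau> \<Longrightarrow> char_identity L c h g x0 t0 \<Longrightarrow>
          0 < c \<and> x0 \<le> a \<or> c < 0 \<and> b \<le> x0 \<Longrightarrow>
          g b (\<tau> + 1 / c * b) = g a (\<tau> + 1 / c * a) + 1 / c * (LINT x:{a..b}|lborel. h x (\<tau> + 1 / c * x))"
        for x0 t0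
        using char_identity_slowness[OF c _ _ _ h ab(1-3), of g x0 t0] by auto
      show "g b (\<tau> + 1 / c * b) = g a (\<tau> + 1 / c * a) + 1 / c * (LINT x:{a..b}|lborel. h x (\<tau> + 1 / c * x))"
      proof (cases "c > 0")
        case True
        show ?thesis
        proof (cases "\<tau> > 0")
          case True
          then show ?thesis using conv[of 0 \<tau>] elim \<open>c > 0\<close> ab L by auto
        next
          case False
          have "- (c * \<tau>) \<le> a" using ab(4) \<open>c > 0\<close> by (simp add: field_simps)
          moreover have "0 \<le> - (c * \<tau>)" using False \<open>c > 0\<close> by (simp add: mult_le_0_iff)
          ultimately show ?thesis using conv[of "- (c * \<tau>)" 0] elim \<open>c > 0\<close> ab L by auto
        qed
      next
        case False
        then have c0: "c < 0" using c by simp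
        show ?thesis
        proof (cases "\<tau> + L / c > 0")
          case True
          then show ?thesis using conv[of L "\<tau> + L / c"] elim c0 ab L by auto
        next
          case False
          have "b \<le> - (c * \<tau>)" using ab(5) c0 by (simp add: field_simps)
          moreover have "- (c * \<tau>) \<le> L" using False c0 by (simp add: field_simps)
          ultimately show ?thesis using conv[of "- (c * \<tau>)" 0] elim c0 ab L by auto
        qed
      qed
    qed
  qed
qed

lemma char_sol_cong:
  assumes "char_sol L q h g"
    and "\<And>x t. x \<in> {0..L} \<Longrightarrow> 0 \<le> t \<Longrightarrow> h x t = h' x t" "\<And>x t. x \<in> {0..L} \<Longrightarrow> 0 \<le> t \<Longrightarrow> g x t = g' x t"
  shows "char_sol L q h' g'"
  using assms(1) unfolding char_sol_def
proof eventually_elim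
  case (elim \<tau>)
  show ?case
  proof (intro allI impI)
    fix a b assume ab: "0 \<le> a" "a \<le> b" "b \<le> L" "0 \<le> \<tau> + q * a" "0 \<le> \<tau> + q * b"
    have "(LINT x:{a..b}|lborel. h x (\<tau> + q * x)) = (LINT x:{a..b}|lborel. h' x (\<tau> + q * x))"
      by (rule set_lebesgue_integral_cong) (use ab line_nonneg[OF ab(4,5)] assms(2) in auto)
    then show "g' b (\<tau> + q * b) = g' a (\<tau> + q * a) + q * (LINT x:{a..b}|lborel. h' x (\<tau> + q * x))"
      using elim[rule_format, OF ab] ab assms(3)[of a] assms(3)[of b] by auto
  qed
qed

lemma char_sol_diff:
  assumes "char_sol L q h1 g1" "char_sol L q h2 g2"
    and "\<And>T. bm2 ({0..L} \<times> {0..T}) h1" "\<And>T. bm2 ({0..L} \<times> {0..T}) h2"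
  shows "char_sol L q (\<lambda>x t. h1 x t - h2 x t) (\<lambda>x t. g1 x t - g2 x t)"
  using assms(1,2) unfolding char_sol_def
proof eventually_elim
  case (elim \<tau>)
  show ?case
  proof (intro allI impI)
    fix a b assume ab: "0 \<le> a" "a \<le> b" "b \<le> L" "0 \<le> \<tau> + q * a" "0 \<le> \<tau> + q * b"
    have "(LINT x:{a..b}|lborel. h1 x (\<tau> + q * x) - h2 x (\<tau> + q * x))
        = (LINT x:{a..b}|lborel. h1 x (\<tau> + q * x)) - (LINT x:{a..b}|lborel. h2 x (\<tau> + q * x))"
      by (rule LINT_bm_diff) (use ab assms(3,4) in \<open>auto intro!: bm_on_line\<close>)
    then show "g1 b (\<tau> + q * b) - g2 b (\<tau> + q * b) = g1 a (\<tau> + q * a) - g2 a (\<tau> + q * a)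
        + q * (LINT x:{a..b}|lborel. h1 x (\<tau> + q * x) - h2 x (\<tau> + q * x))"
      using elim(1)[rule_format, OF ab] elim(2)[rule_format, OF ab] by (simp add: right_diff_distrib)
  qed
qed

text \<open>The product rule along the line. With \<open>q = 1 / lam\<close> and
  \<open>\<theta>\<close> equal to a diagonal source coefficient divided by \<open>lam\<close>, the
  subtracted term is exactly the self-coupling, which thereby disappears.\<close>

lemma char_sol_rescale:
  assumes q: "q \<noteq> 0" and sol: "char_sol L q h g"
    and h: "\<And>T. bm2 ({0..L} \<times> {0..T}) h"
  shows "char_sol L q (\<lambda>x t. exp (- \<theta> * x) * (h x t - \<theta> / q * g x t)) (\<lambda>x t. exp (- \<theta> * x) * g x t)"
  using sol unfolding char_sol_def
proof eventually_elim
  case (elim \<tau>)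
  show ?case
  proof (intro allI impI)
    fix a b assume ab: "0 \<le> a" "a \<le> b" "b \<le> L" "0 \<le> \<tau> + q * a" "0 \<le> \<tau> + q * b"
    define E where "E s = exp (- \<theta> * (a + s))" for s
    define G where "G s = g (a + s) (\<tau> + q * (a + s))" for s
    define Hs where "Hs s = q * h (a + s) (\<tau> + q * (a + s))" for s
    have "bm_on {a..b} (\<lambda>x. h x (\<tau> + q * x))" by (rule bm_on_line[OF h]) (use ab in auto)
    then have mH: "bm_on {0..b - a} Hs"
      unfolding Hs_def
      by (intro bm_on_mult bm_on_const bm_on_compose[of "{a..b}" "\<lambda>x. h x (\<tau> + q * x)" _ "\<lambda>s. a + s"])
         (auto intro!: continuous_intros)
    have "E (b - a) * G (b - a) = E 0 * G 0 + (LINT s:{0..b - a}|lborel. (- \<theta> * E s) * G s + E s * Hs s)"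
    proof (rule LINT_product_rule[OF _ mH])
      show "bm_on {0..b - a} (\<lambda>s. - \<theta> * E s)"
        unfolding E_def by (intro bm_on_continuous continuous_intros) auto
      show "E s = E 0 + (LINT \<sigma>:{0..s}|lborel. - \<theta> * E \<sigma>)" if "0 \<le> s" "s \<le> b - a" for s
      proof -
        have "(\<integral>\<sigma>. indicator {0..s} \<sigma> *\<^sub>R (- \<theta> * E \<sigma>) \<partial>lborel) = E s - E 0"
          by (rule integral_FTC_Icc)
             (use that in \<open>auto simp: E_def has_real_derivative_iff_has_vector_derivative[symmetric]
                intro!: derivative_eq_intros continuous_intros\<close>)
        then show ?thesis by (simp add: set_lebesgue_integral_def)
      qed
      show "G s = G 0 + (LINT \<sigma>:{0..s}|lborel. Hs \<sigma>)" if "0 \<le> s" "s \<le> b - a" for s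
      proof -
        have "(LINT x:{a..a + s}|lborel. h x (\<tau> + q * x)) = (LINT \<sigma>:{0..s}|lborel. h (a + \<sigma>) (\<tau> + q * (a + \<sigma>)))"
          using LINT_interval_affine[of 1 a 0 s "\<lambda>x. h x (\<tau> + q * x)"] by simp
        moreover have "0 \<le> \<tau> + q * (a + s)"
          by (rule line_nonneg[OF ab(4,5)]) (use that in auto)
        ultimately show ?thesis
          using elim[rule_format, of a "a + s"] ab that by (simp add: G_def Hs_def)
      qed
    qed (use ab in auto)
    moreover have "(LINT s:{0..b - a}|lborel. (- \<theta> * E s) * G s + E s * Hs s)
        = q * (LINT x:{a..b}|lborel. exp (- \<theta> * x) * (h x (\<tau> + q * x) - \<theta> / q * g x (\<tau> + q * x)))"
    proof -
      have "(LINT x:{a..b}|lborel. exp (- \<theta> * x) * (h x (\<tau> + q * x) - \<theta> / q * g x (\<tau> + q * x)))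
        = (LINT s:{0..b - a}|lborel. E s * (h (a + s) (\<tau> + q * (a + s)) - \<theta> / q * G s))"
        using LINT_interval_affine[of 1 a 0 "b - a"
          "\<lambda>x. exp (- \<theta> * x) * (h x (\<tau> + q * x) - \<theta> / q * g x (\<tau> + q * x))"]
        by (simp add: E_def G_def)
      moreover have "(- \<theta> * E s) * G s + E s * Hs s
          = q * (E s * (h (a + s) (\<tau> + q * (a + s)) - \<theta> / q * G s))" for s
        using q by (simp add: Hs_def field_simps)
      ultimately show ?thesis by simp
    qed
    ultimately show "exp (- \<theta> * b) * g b (\<tau> + q * b) = exp (- \<theta> * a) * g a (\<tau> + q * a)
        + q * (LINT x:{a..b}|lborel. exp (- \<theta> * x) * (h x (\<tau> + q * x) - \<theta> / q * g x (\<tau> + q * x)))"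
      by (simp add: E_def G_def)
  qed
qed

lemma char_AE_at_x:
  assumes "AE \<tau> in lborel. \<forall>x\<in>{0..L}. P x (\<tau> + q * x)" "x \<in> {0..L}"
  shows "AE t in lborel. P x (t::real)"
proof -
  have "AE t in lborel. \<forall>x\<in>{0..L}. P x ((- (q * x0) + 1 * t) + q * x)" for x0
    by (rule AE_affine[OF _ assms(1)]) simp
  from this[of x] show ?thesis by eventually_elim (use assms(2) in \<open>auto dest!: bspec[of _ _ x]\<close>)
qed

text \<open>A horizontal line meets a family with \<open>q \<noteq> 0\<close> transversally, with
  label \<open>t - q * x\<close>. A null set of labels is therefore a null set of positions at every
  single time, not merely at almost every time.\<close>

lemma char_AE_at_t:
  fixes q :: real
  assumes "AE \<tau> in lborel. \<forall>x\<in>{0..L}. P x (\<tau> + q * x)" "q \<noteq> 0"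
  shows "AE x in lborel. x \<in> {0..L} \<longrightarrow> P x t"
proof -
  have "AE x in lborel. \<forall>x'\<in>{0..L}. P x' ((t + - q * x) + q * x')"
    by (rule AE_affine[OF _ assms(1)]) (use assms in simp)
  then show ?thesis
  proof eventually_elim
    case (elim x)
    show ?case using bspec[OF elim, of x] by simp
  qed
qed

section \<open>Systems with several positive and one negative speed\<close>

text \<open>Common frame for plant and observer error: \<open>A\<close>, \<open>B\<close>,
  \<open>C\<close> play the roles of \<open>Sig_pp\<close>, \<open>Sig_pm\<close>,
  \<open>Sig_mp\<close>, and \<open>v\<close> bounds the positive speeds from below. There is no
  self-coupling of the last component, since the exponential rescaling removes it.\<close>

locale hyperbolic_coeffs =
  fixes L \<mu> v :: real and lam :: "'n::finite \<Rightarrow> real"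
    and A :: "real \<Rightarrow> 'n \<Rightarrow> 'n \<Rightarrow> real" and B C :: "real \<Rightarrow> 'n \<Rightarrow> real"
  assumes L: "0 < L" and mu: "0 < \<mu>" and v: "0 < v" and lam: "\<And>i. v \<le> lam i"
    and A: "\<And>i j. bm_on {0..L} (\<lambda>x. A x i j)"
    and B: "\<And>i. bm_on {0..L} (\<lambda>x. B x i)"
    and C: "\<And>i. bm_on {0..L} (\<lambda>x. C x i)"
begin

lemma lam_pos: "0 < lam i"
  using v lam[of i] by linarith

lemma inv_lam_le: "1 / lam i \<le> 1 / v"
  using v lam[of i] by (simp add: frac_le)

text \<open>The front \<open>t = T0 + x / v\<close> is the slowest one: a faster line passing above
  it at \<open>x\<close> must have left \<open>x = 0\<close> after \<open>T0\<close>.\<close>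

lemma entry_time_pos:
  assumes "0 \<le> x" "0 \<le> T0" "T0 + 1 / v * x < \<tau> + 1 / lam i * x"
  shows "T0 < \<tau>"
  using mult_right_mono[OF inv_lam_le[of i] assms(1)] assms(2,3) by simp

lemma coeff_bound:
  "\<exists>K\<ge>0. (\<forall>x\<in>{0..L}. \<forall>i j. \<bar>A x i j\<bar> \<le> K) \<and> (\<forall>x\<in>{0..L}. \<forall>i. \<bar>B x i\<bar> \<le> K) \<and>
     (\<forall>x\<in>{0..L}. \<forall>i. \<bar>C x i\<bar> \<le> K)"
proof -
  have "\<exists>b. \<forall>x\<in>{0..L}. \<bar>A x i j\<bar> \<le> b" "\<exists>b. \<forall>x\<in>{0..L}. \<bar>B x i\<bar> \<le> b"
    "\<exists>b. \<forall>x\<in>{0..L}. \<bar>C x i\<bar> \<le> b" for i j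
    using A[of i j] B[of i] C[of i] unfolding bm_on_def by auto
  then obtain a b c where a: "\<And>i j. \<forall>x\<in>{0..L}. \<bar>A x i j\<bar> \<le> a i j"
    and b: "\<And>i. \<forall>x\<in>{0..L}. \<bar>B x i\<bar> \<le> b i" and c: "\<And>i. \<forall>x\<in>{0..L}. \<bar>C x i\<bar> \<le> c i"
    by metis
  define K where "K = (\<Sum>i\<in>UNIV. \<Sum>j\<in>UNIV. \<bar>a i j\<bar>) + (\<Sum>i\<in>UNIV. \<bar>b i\<bar>) + (\<Sum>i\<in>UNIV. \<bar>c i\<bar>)"
  have 1: "\<bar>a i j\<bar> \<le> (\<Sum>i\<in>UNIV. \<Sum>j\<in>UNIV. \<bar>a i j\<bar>)" for i j
  proof -
    have "\<bar>a i j\<bar> \<le> (\<Sum>j\<in>UNIV. \<bar>a i j\<bar>)" by (rule member_le_sum) auto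
    also have "\<dots> \<le> (\<Sum>i\<in>UNIV. \<Sum>j\<in>UNIV. \<bar>a i j\<bar>)"
      by (rule member_le_sum[of i UNIV "\<lambda>i. \<Sum>j\<in>UNIV. \<bar>a i j\<bar>"]) (auto intro: sum_nonneg)
    finally show ?thesis .
  qed
  have 2: "\<bar>b i\<bar> \<le> (\<Sum>i\<in>UNIV. \<bar>b i\<bar>)" "\<bar>c i\<bar> \<le> (\<Sum>i\<in>UNIV. \<bar>c i\<bar>)" for i
    by (rule member_le_sum; simp)+
  have 3: "0 \<le> (\<Sum>i\<in>UNIV. \<Sum>j\<in>UNIV. \<bar>a i j\<bar>)" "0 \<le> (\<Sum>i\<in>UNIV. \<bar>b i\<bar>)" "0 \<le> (\<Sum>i\<in>UNIV. \<bar>c i\<bar>)"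
    by (auto intro!: sum_nonneg)
  show ?thesis
  proof (intro exI[of _ K] conjI ballI allI)
    show "0 \<le> K" using 3 by (simp add: K_def)
    fix x assume x: "x \<in> {0..L}"
    show "\<bar>A x i j\<bar> \<le> K" for i j using bspec[OF a[of i j] x] 1[of i j] 3 unfolding K_def by linarith
    show "\<bar>B x i\<bar> \<le> K" for i using bspec[OF b[of i] x] 2(1)[of i] 3 unfolding K_def by linarith
    show "\<bar>C x i\<bar> \<le> K" for i using bspec[OF c[of i] x] 2(2)[of i] 3 unfolding K_def by linarith
  qed
qed

definition src :: "('n \<Rightarrow> real \<Rightarrow> real \<Rightarrow> real) \<Rightarrow> (real \<Rightarrow> real \<Rightarrow> real) \<Rightarrow> 'n \<Rightarrow> real \<Rightarrow> real \<Rightarrow> real" where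
  "src w w' i x t = (\<Sum>j\<in>UNIV. A x i j * w j x t) + B x i * w' x t"

definition src' :: "('n \<Rightarrow> real \<Rightarrow> real \<Rightarrow> real) \<Rightarrow> real \<Rightarrow> real \<Rightarrow> real" where
  "src' w x t = (\<Sum>j\<in>UNIV. C x j * w j x t)"

definition strip_bm :: "(real \<Rightarrow> real \<Rightarrow> real) \<Rightarrow> bool" where
  "strip_bm u \<longleftrightarrow> (\<forall>T. bm2 ({0..L} \<times> {0..T}) u)"

lemma strip_bm_add: "strip_bm u \<Longrightarrow> strip_bm w \<Longrightarrow> strip_bm (\<lambda>x t. u x t + w x t)"
  and strip_bm_diff: "strip_bm u \<Longrightarrow> strip_bm w \<Longrightarrow> strip_bm (\<lambda>x t. u x t - w x t)"
  and strip_bm_mult: "strip_bm u \<Longrightarrow> strip_bm w \<Longrightarrow> strip_bm (\<lambda>x t. u x t * w x t)"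
  unfolding strip_bm_def by auto

lemma strip_bm_sum: "(\<And>i. i \<in> I \<Longrightarrow> strip_bm (U i)) \<Longrightarrow> strip_bm (\<lambda>x t. \<Sum>i\<in>I. U i x t)"
  unfolding strip_bm_def by auto

lemma strip_bm_fst: "bm_on {0..L} f \<Longrightarrow> strip_bm (\<lambda>x t. f x)"
  unfolding strip_bm_def by (auto intro: bm_on_fst)

lemma strip_bm_snd: "(\<And>T. bm_on {0..T} f) \<Longrightarrow> strip_bm (\<lambda>x t. f t)"
  unfolding strip_bm_def by (auto intro: bm_on_snd)

lemma strip_bm_src:
  assumes "\<And>j. strip_bm (w j)" "strip_bm w'" shows "strip_bm (src w w' i)"
  unfolding src_def[abs_def]
  by (rule strip_bm_add strip_bm_sum strip_bm_mult strip_bm_fst A B assms)+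

lemma strip_bm_src':
  assumes "\<And>j. strip_bm (w j)" shows "strip_bm (src' w)"
  unfolding src'_def[abs_def]
  by (rule strip_bm_sum strip_bm_mult strip_bm_fst C assms)+

lemma strip_bm_line:
  "strip_bm u \<Longrightarrow> 0 \<le> a \<Longrightarrow> b \<le> L \<Longrightarrow> 0 \<le> \<tau> + q * a \<Longrightarrow> 0 \<le> \<tau> + q * b \<Longrightarrow>
   bm_on {a..b} (\<lambda>x. u x (\<tau> + q * x))"
  unfolding strip_bm_def by (rule bm_on_line) auto

lemma strip_bm_trace:
  assumes "strip_bm u" "x \<in> {0..L}" shows "bm_on {0..T} (u x)"
  by (rule bm_on_compose_Pair[OF assms(1)[unfolded strip_bm_def, rule_format, of T]])
     (use assms(2) in \<open>auto intro!: continuous_intros\<close>)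

lemma strip_bm_at_time:
  assumes "strip_bm u" "0 \<le> t" shows "bm_on {0..L} (\<lambda>x. u x t)"
  by (rule bm_on_compose_Pair[OF assms(1)[unfolded strip_bm_def, rule_format, of t]])
     (use assms(2) in \<open>auto intro!: continuous_intros\<close>)

text \<open>The hypotheses are the integrated equations with the boundary term at
  \<open>x = 0\<close> already dropped. The negative speed does no harm, because every line is
  followed from \<open>x = 0\<close> regardless of its direction in time.\<close>

lemma vanish_from_zero_inflow:
  assumes T0: "0 \<le> T0" and w: "\<And>j. strip_bm (w j)" and w': "strip_bm w'"
    and eq: "\<And>i. AE \<tau> in lborel. \<forall>x\<in>{0..L}. T0 + 1 / v * x < \<tau> + 1 / lam i * x \<longrightarrow>
      w i x (\<tau> + 1 / lam i * x) = 1 / lam i * (LINT y:{0..x}|lborel. src w w' i y (\<tau> + 1 / lam i * y))"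
    and eq': "AE \<tau> in lborel. \<forall>x\<in>{0..L}. T0 + 1 / v * x < \<tau> + - (1 / \<mu>) * x \<longrightarrow>
      w' x (\<tau> + - (1 / \<mu>) * x) = - (1 / \<mu>) * (LINT y:{0..x}|lborel. src' w y (\<tau> + - (1 / \<mu>) * y))"
  shows "AE \<tau> in lborel. \<forall>x\<in>{0..L}. T0 + 1 / v * x < \<tau> + 1 / lam i * x \<longrightarrow> w i x (\<tau> + 1 / lam i * x) = 0"
    and "AE \<tau> in lborel. \<forall>x\<in>{0..L}. T0 + 1 / v * x < \<tau> + - (1 / \<mu>) * x \<longrightarrow> w' x (\<tau> + - (1 / \<mu>) * x) = 0"
proof -
  \<comment> \<open>The index type is \<open>'n option\<close>: \<open>None\<close> stands for the
    component of negative speed, so that one application of uniqueness treats all components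
    together.\<close>
  define q where "q i = (case i of Some i \<Rightarrow> 1 / lam i | None \<Rightarrow> - (1 / \<mu>))" for i
  define u where "u i = (case i of Some i \<Rightarrow> w i | None \<Rightarrow> w')" for i
  define f where "f i = (case i of Some i \<Rightarrow> src w w' i | None \<Rightarrow> src' w)" for i
  obtain K where K: "0 \<le> K"
    and "(\<forall>x\<in>{0..L}. \<forall>i j. \<bar>A x i j\<bar> \<le> K) \<and> (\<forall>x\<in>{0..L}. \<forall>i. \<bar>B x i\<bar> \<le> K) \<and>
      (\<forall>x\<in>{0..L}. \<forall>i. \<bar>C x i\<bar> \<le> K)"
    using coeff_bound by (rule exE) (erule conjE, rule that)
  then have bounds: "\<And>x i j. x \<in> {0..L} \<Longrightarrow> \<bar>A x i j\<bar> \<le> K" "\<And>x i. x \<in> {0..L} \<Longrightarrow> \<bar>B x i\<bar> \<le> K"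
      "\<And>x i. x \<in> {0..L} \<Longrightarrow> \<bar>C x i\<bar> \<le> K"
    by blast+
  \<comment> \<open>Each source is a sum of at most \<open>CARD('n) + 1\<close> products of a
    coefficient and a component.\<close>
  define K' where "K' = (real CARD('n) + 1) * K"
  have main: "AE \<tau> in lborel. \<forall>x\<in>{0..L}. T0 + 1 / v * x < \<tau> + q i * x \<longrightarrow> u i x (\<tau> + q i * x) = 0" for i
  proof (rule char_uniqueness[where u=u and q=q and r="1 / v" and f=f and A=K' and k="1 / \<mu>"])
    fix i
    have "- (1 / \<mu>) \<le> 1 / lam j" for j
      by (rule order_trans[of _ 0]) (use lam_pos[of j] mu in auto)
    then show "- (1 / \<mu>) \<le> q i" by (auto simp: q_def split: option.split)
    have "- (1 / \<mu>) \<le> 1 / v" by (rule order_trans[of _ 0]) (use mu v in auto)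
    then show "q i \<le> 1 / v" using inv_lam_le by (auto simp: q_def split: option.split)
    show "bm2 ({0..L} \<times> {0..T}) (u i)" for T
      using w w' by (auto simp: u_def strip_bm_def split: option.split)
    show "AE \<tau> in lborel. \<forall>x\<in>{0..L}. T0 + 1 / v * x < \<tau> + q i * x \<longrightarrow>
       u i x (\<tau> + q i * x) = q i * (LINT y:{0..x}|lborel. f i y (\<tau> + q i * y))"
    proof (cases i)
      case None
      show ?thesis unfolding None u_def q_def f_def option.case by (rule eq')
    next
      case (Some j)
      show ?thesis unfolding Some u_def q_def f_def option.case by (rule eq)
    qed
    show "\<bar>f i x t\<bar> \<le> K' * b" if x: "x \<in> {0..L}" and "\<And>j. \<bar>u j x t\<bar> \<le> b" for x t b
    proof -
      have wb: "\<bar>w j x t\<bar> \<le> b" "\<bar>w' x t\<bar> \<le> b" for j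
        using that(2)[of "Some j"] that(2)[of None] by (simp_all add: u_def)
      have prod: "\<bar>c * y\<bar> \<le> K * b" if "\<bar>c\<bar> \<le> K" "\<bar>y\<bar> \<le> b" for c y
        unfolding abs_mult using that K by (intro mult_mono) auto
      have sum: "\<bar>\<Sum>j\<in>UNIV. a j * w j x t\<bar> \<le> real CARD('n) * (K * b)" if "\<And>j. \<bar>a j\<bar> \<le> K" for a
        using sum_norm_bound[of UNIV "\<lambda>j. a j * w j x t" "K * b"] prod[OF that wb(1)] by simp
      have K': "K' * b = real CARD('n) * (K * b) + K * b" by (simp add: K'_def algebra_simps)
      show ?thesis
      proof (cases i)
        case None
        have "0 \<le> K * b" using K wb(2) by (intro mult_nonneg_nonneg) auto
        then show ?thesis using sum[of "C x", OF bounds(3)[OF x]] unfolding None f_def option.case src'_def K' by linarith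
      next
        case (Some j)
        show ?thesis
          using sum[of "A x j", OF bounds(1)[OF x]] prod[OF bounds(2)[OF x] wb(2), of j]
            abs_triangle_ineq[of "\<Sum>k\<in>UNIV. A x j k * w k x t" "B x j * w' x t"]
          unfolding Some f_def option.case src_def K' by linarith
      qed
    qed
  qed (use T0 mu v K in \<open>auto simp: K'_def\<close>)
  show "AE \<tau> in lborel. \<forall>x\<in>{0..L}. T0 + 1 / v * x < \<tau> + 1 / lam i * x \<longrightarrow> w i x (\<tau> + 1 / lam i * x) = 0"
    using main[of "Some i"] by (simp add: q_def u_def)
  show "AE \<tau> in lborel. \<forall>x\<in>{0..L}. T0 + 1 / v * x < \<tau> + - (1 / \<mu>) * x \<longrightarrow> w' x (\<tau> + - (1 / \<mu>) * x) = 0"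
    using main[of None] by (simp add: q_def u_def)
qed

text \<open>Slowness is positive, so a line that leaves \<open>x = 0\<close> at a positive time
  stays in \<open>t > 0\<close> across the whole interval; initial data play no part.\<close>

lemma char_sol_from_inflow:
  assumes sol: "char_sol L (1 / lam i) h g" and in0: "AE t in lborel. 0 < t \<longrightarrow> g 0 t = b t"
  shows "AE \<tau> in lborel. 0 < \<tau> \<longrightarrow> (\<forall>x\<in>{0..L}. g x (\<tau> + 1 / lam i * x)
      = b \<tau> + 1 / lam i * (LINT y:{0..x}|lborel. h y (\<tau> + 1 / lam i * y)))"
  using sol[unfolded char_sol_def] in0
proof eventually_elim
  case (elim \<tau>)
  show ?case
  proof (intro impI ballI)
    fix x assume "0 < \<tau>" "x \<in> {0..L}"
    then show "g x (\<tau> + 1 / lam i * x)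
        = b \<tau> + 1 / lam i * (LINT y:{0..x}|lborel. h y (\<tau> + 1 / lam i * y))"
      using elim(1)[rule_format, of 0 x] elim(2) lam_pos[of i] by simp
  qed
qed

end

lemma LINT_neg: "(LINT x:S|lborel. - f x) = - (LINT x:S|lborel. f x :: real)"
  by (simp add: set_lebesgue_integral_def)

lemma bm2_row: "bm2 (triangle X) k \<Longrightarrow> x \<in> {0..X} \<Longrightarrow> bm_on {0..x} (k x)"
  and bm2_diag: "bm2 (triangle X) k \<Longrightarrow> bm_on {0..X} (\<lambda>x. k x x)"
  and bm2_bottom: "bm2 (triangle X) k \<Longrightarrow> bm_on {0..X} (\<lambda>x. k x 0)"
  by (rule bm_on_compose_Pair, assumption, auto intro!: continuous_intros simp: triangle_def)+

context hyperbolic_coeffs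
begin

lemma bm2_triangle_src:
  assumes "\<And>j. bm2 (triangle L) (k j)"
  shows "bm2 (triangle L) k' \<Longrightarrow> bm2 (triangle L) (src k k' i)" "bm2 (triangle L) (src' k)"
proof -
  have c: "bm2 (triangle L) (\<lambda>x \<xi>. f x)" if "bm_on {0..L} f" for f
    by (rule bm_on_fst[OF that]) (auto simp: triangle_def)
  show "bm2 (triangle L) (src k k' i)" if "bm2 (triangle L) k'"
    unfolding src_def[abs_def] by (intro bm2_add bm2_sum bm2_mult c A B assms that)
  show "bm2 (triangle L) (src' k)"
    unfolding src'_def[abs_def] by (intro bm2_sum bm2_mult c C assms)
qed

end

section \<open>The observer error\<close>

text \<open>\<open>e\<close> is estimate minus state, which fixes the sign of the injection terms;
  \<open>\<mu> * M i x 0\<close> and \<open>\<mu> * N x 0\<close> are the observer gains. The kernel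
  equations enter in integrated form, and \<open>N_L\<close> mirrors the reflection condition
  \<open>e'_L\<close>.\<close>

locale observer_error = hyperbolic_coeffs +
  fixes M :: "'a \<Rightarrow> real \<Rightarrow> real \<Rightarrow> real" and N :: "real \<Rightarrow> real \<Rightarrow> real" and R :: "'a \<Rightarrow> real"
    and e :: "'a \<Rightarrow> real \<Rightarrow> real \<Rightarrow> real" and e' :: "real \<Rightarrow> real \<Rightarrow> real"
  assumes M: "\<And>i. bm2 (triangle L) (M i)" and N: "bm2 (triangle L) N"
    and M_char: "\<And>i x \<xi> s. (x, \<xi>) \<in> triangle L \<Longrightarrow> 0 \<le> s \<Longrightarrow> (x + lam i * s, \<xi> - \<mu> * s) \<in> triangle L \<Longrightarrow>
      M i (x + lam i * s) (\<xi> - \<mu> * s) = M i x \<xi> + (LINT \<sigma>:{0..s}|lborel. src M N i (x + lam i * \<sigma>) (\<xi> - \<mu> * \<sigma>))"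
    and M_diag: "\<And>i x. x \<in> {0..L} \<Longrightarrow> (lam i + \<mu>) * M i x x = B x i"
    and N_char: "\<And>y s. 0 \<le> y \<Longrightarrow> 0 \<le> s \<Longrightarrow> y + \<mu> * s \<le> L \<Longrightarrow>
      N (y + \<mu> * s) (\<mu> * s) = N y 0 - (LINT \<sigma>:{0..s}|lborel. src' M (y + \<mu> * \<sigma>) (\<mu> * \<sigma>))"
    and N_L: "\<And>\<xi>. \<xi> \<in> {0..L} \<Longrightarrow> N L \<xi> = (\<Sum>j\<in>UNIV. R j * M j L \<xi>)"
    and e: "\<And>i. strip_bm (e i)" and e': "strip_bm e'"
    and e_sol: "\<And>i. char_sol L (1 / lam i) (\<lambda>x t. src e e' i x t - \<mu> * M i x 0 * e' 0 t) (e i)"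
    and e'_sol: "char_sol L (- (1 / \<mu>)) (\<lambda>x t. src' e x t - \<mu> * N x 0 * e' 0 t) e'"
    and e_0: "\<And>i. AE t in lborel. 0 < t \<longrightarrow> e i 0 t = 0"
    and e'_L: "AE t in lborel. 0 < t \<longrightarrow> e' L t = (\<Sum>j\<in>UNIV. R j * e j L t)"
begin

text \<open>The part of the error that is driven by the output error \<open>e' 0\<close>, which in the backstepping
  coordinates is transported with speed \<open>-\<mu>\<close>. Subtracting it leaves a homogeneous system with
  zero data at \<open>x = 0\<close>.\<close>

definition h :: "(real \<Rightarrow> real \<Rightarrow> real) \<Rightarrow> real \<Rightarrow> real \<Rightarrow> real" where
  "h k x t = (LINT \<xi>:{0..x}|lborel. k x \<xi> * e' 0 (t + \<xi> / \<mu>))"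

definition \<epsilon> :: "'a \<Rightarrow> real \<Rightarrow> real \<Rightarrow> real" where
  "\<epsilon> i x t = e i x t - h (M i) x t"

definition \<epsilon>' :: "real \<Rightarrow> real \<Rightarrow> real" where
  "\<epsilon>' x t = e' x t - e' 0 (t + x / \<mu>) - h N x t"

lemma output_bm: "bm_on {0..T} (e' 0)"
  using strip_bm_trace[OF e', of 0] L by simp

lemma output_shift_bm: "0 \<le> t \<Longrightarrow> bm_on {0..x} (\<lambda>\<xi>. e' 0 (t + \<xi> / \<mu>))"
  by (rule bm_on_compose[OF output_bm[of "t + x / \<mu>"]])
     (use mu in \<open>auto intro!: continuous_intros divide_right_mono\<close>)

lemma bm2_output:
  assumes "0 \<le> \<tau>" "0 \<le> \<tau> + q * X"
  shows "bm2 (triangle X) (\<lambda>x \<xi>. e' 0 (\<tau> + q * x + \<xi> / \<mu>))"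
  unfolding split_beta'
proof (rule bm_on_compose[OF output_bm[of "max (\<tau> + q * 0) (\<tau> + q * X) + X / \<mu>"]])
  fix p assume p: "p \<in> triangle X"
  then have "0 \<le> fst p" "fst p \<le> X" by (auto simp: triangle_def split_beta')
  moreover have "0 \<le> \<tau> + q * 0" using assms by simp
  ultimately have "0 \<le> \<tau> + q * fst p" "\<tau> + q * fst p \<le> max (\<tau> + q * 0) (\<tau> + q * X)"
    using assms line_nonneg by blast+
  moreover have "snd p / \<mu> \<le> X / \<mu>" "0 \<le> snd p / \<mu>"
    using p mu by (auto simp: triangle_def split_beta' intro: divide_right_mono)
  ultimately show "\<tau> + q * fst p + snd p / \<mu> \<in> {0..max (\<tau> + q * 0) (\<tau> + q * X) + X / \<mu>}" by auto
qed (use mu in \<open>auto intro!: continuous_intros\<close>)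

lemma h_bm:
  assumes k: "bm2 (triangle L) k" shows "strip_bm (h k)"
  unfolding strip_bm_def
proof
  fix T
  have "bm_on ({0..L} \<times> {0..T}) (\<lambda>p. LINT \<xi>:{0..fst p}|lborel. k (fst p) \<xi> * e' 0 (snd p + \<xi> / \<mu>))"
  proof (rule bm_on_param_integral[where C=L])
    let ?D = "{(p, \<xi>). p \<in> {0..L} \<times> {0..T} \<and> 0 \<le> \<xi> \<and> \<xi> \<le> fst p}"
    have "bm_on ?D (\<lambda>z. k (fst (fst z)) (snd z))"
      by (rule bm_on_compose_Pair[OF k]) (auto intro!: continuous_intros simp: triangle_def)
    moreover have "bm_on ?D (\<lambda>z. e' 0 (snd (fst z) + snd z / \<mu>))"
      by (rule bm_on_compose[OF output_bm[of "T + L / \<mu>"]])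
         (use mu in \<open>auto intro!: continuous_intros add_mono divide_right_mono\<close>)
    ultimately have "bm_on ?D (\<lambda>z. k (fst (fst z)) (snd z) * e' 0 (snd (fst z) + snd z / \<mu>))"
      by (rule bm_on_mult)
    then show "bm_on ?D (\<lambda>(p, \<xi>). k (fst p) \<xi> * e' 0 (snd p + \<xi> / \<mu>))" by (simp add: split_beta')
  qed (auto intro!: continuous_intros borel_closed closed_Times)
  then show "bm2 ({0..L} \<times> {0..T}) (h k)" by (simp add: h_def split_beta')
qed

lemma shift_bm: "strip_bm (\<lambda>x t. e' 0 (t + x / \<mu>))"
  unfolding strip_bm_def split_beta'
proof
  fix T
  show "bm_on ({0..L} \<times> {0..T}) (\<lambda>p. e' 0 (snd p + fst p / \<mu>))"
    by (rule bm_on_compose[OF output_bm[of "T + L / \<mu>"]])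
       (use mu in \<open>auto intro!: continuous_intros add_mono divide_right_mono\<close>)
qed

lemma \<epsilon>_bm: "strip_bm (\<epsilon> i)" and \<epsilon>'_bm: "strip_bm \<epsilon>'"
  unfolding \<epsilon>_def[abs_def] \<epsilon>'_def[abs_def] by (rule strip_bm_diff e e' h_bm M N shift_bm)+

text \<open>The coefficients depend on \<open>x\<close> alone while \<open>h\<close> integrates over
  \<open>\<xi>\<close>, so the two operations commute by linearity.\<close>

lemma h_src:
  assumes "x \<in> {0..L}" "0 \<le> t"
  shows "h (src M N i) x t = src (\<lambda>j. h (M j)) (h N) i x t" and "h (src' M) x t = src' (\<lambda>j. h (M j)) x t"
proof -
  have m: "bm_on {0..x} (\<lambda>\<xi>. k x \<xi> * e' 0 (t + \<xi> / \<mu>))" if "bm2 (triangle L) k" for k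
    by (intro bm_on_mult output_shift_bm bm2_row[OF that] assms)
  have "h (src M N i) x t = (LINT \<xi>:{0..x}|lborel.
      (\<Sum>j\<in>UNIV. A x i j * (M j x \<xi> * e' 0 (t + \<xi> / \<mu>))) + B x i * (N x \<xi> * e' 0 (t + \<xi> / \<mu>)))"
    unfolding h_def src_def by (simp add: sum_distrib_right distrib_right mult.assoc)
  also have "\<dots> = src (\<lambda>j. h (M j)) (h N) i x t"
    by (simp add: LINT_bm_add LINT_bm_sum bm_on_sum bm_on_mult bm_on_const m M N h_def src_def)
  finally show "h (src M N i) x t = src (\<lambda>j. h (M j)) (h N) i x t" .
  have "h (src' M) x t = (LINT \<xi>:{0..x}|lborel. (\<Sum>j\<in>UNIV. C x j * (M j x \<xi> * e' 0 (t + \<xi> / \<mu>))))"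
    unfolding h_def src'_def by (simp add: sum_distrib_right mult.assoc)
  also have "\<dots> = src' (\<lambda>j. h (M j)) x t"
    by (simp add: LINT_bm_sum bm_on_mult bm_on_const m M h_def src'_def)
  finally show "h (src' M) x t = src' (\<lambda>j. h (M j)) x t" .
qed

text \<open>Divergence theorem for \<open>M i * G\<close>, where \<open>G\<close> is constant in the
  direction \<open>(lam i, -\<mu>)\<close> of the kernel characteristics. The right side of the
  triangle yields \<open>h (M i)\<close>, the bottom yields the injection term, and the diagonal,
  through \<open>M_diag\<close>, yields the coupling to the shifted output error.\<close>

lemma h_transport:
  assumes \<tau>: "0 < \<tau>" and x: "x \<in> {0..L}"
  shows "lam i * h (M i) x (\<tau> + 1 / lam i * x) = (LINT y:{0..x}|lborel.
    src (\<lambda>j. h (M j)) (h N) i y (\<tau> + 1 / lam i * y) + B y i * e' 0 (\<tau> + 1 / lam i * y + y / \<mu>)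
      - \<mu> * M i y 0 * e' 0 (\<tau> + 1 / lam i * y))"
proof -
  note l = lam_pos[of i]
  define G where "G y \<xi> = e' 0 (\<tau> + 1 / lam i * y + \<xi> / \<mu>)" for y \<xi>
  have G: "bm2 (triangle x) G"
    using bm2_output[of \<tau> "1 / lam i" x] \<tau> x l unfolding G_def by simp
  have sub: "triangle x \<subseteq> triangle L" using x by (auto simp: triangle_def)
  have tm: "0 \<le> \<tau> + 1 / lam i * y" if "0 \<le> y" for y using that \<tau> l by simp
  define S where "S y = src (\<lambda>j. h (M j)) (h N) i y (\<tau> + 1 / lam i * y)" for y
  have S: "bm_on {0..x} S" unfolding S_def
    by (rule strip_bm_line) (use x tm[of 0] tm[of x] in \<open>auto intro: strip_bm_src h_bm M N\<close>)
  have M0: "bm_on {0..x} (\<lambda>y. M i y 0 * G y 0)" and Md: "bm_on {0..x} (\<lambda>y. M i y y * G y y)"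
    by (intro bm_on_mult bm2_bottom bm2_diag bm_on_subset[OF M sub] G)+
  have Gchar: "G (y + lam i * s) (y - \<mu> * s) = G y y" for y s
    using l mu by (simp add: G_def field_simps)
  have "(LINT y:{0..x}|lborel. LINT \<xi>:{0..y}|lborel. src M N i y \<xi> * G y \<xi>)
      = lam i * (LINT \<xi>:{0..x}|lborel. M i x \<xi> * G x \<xi>) + \<mu> * (LINT y:{0..x}|lborel. M i y 0 * G y 0)
        - (lam i + \<mu>) * (LINT y:{0..x}|lborel. M i y y * G y y)"
  proof (rule divergence_diagonal[OF l mu])
    show "bm2 (triangle x) (\<lambda>y \<xi>. M i y \<xi> * G y \<xi>)"
      by (intro bm2_mult bm_on_subset[OF M sub] G)
    show "bm2 (triangle x) (\<lambda>y \<xi>. src M N i y \<xi> * G y \<xi>)"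
      by (intro bm2_mult bm_on_subset[OF bm2_triangle_src(1) sub] G M N)
    show "AE y in lborel. y \<in> {0..x} \<longrightarrow> (\<forall>s\<ge>0. y + lam i * s \<le> x \<longrightarrow> \<mu> * s \<le> y \<longrightarrow>
        M i (y + lam i * s) (y - \<mu> * s) * G (y + lam i * s) (y - \<mu> * s) = M i y y * G y y
          + (LINT \<sigma>:{0..s}|lborel. src M N i (y + lam i * \<sigma>) (y - \<mu> * \<sigma>) * G (y + lam i * \<sigma>) (y - \<mu> * \<sigma>)))"
    proof (intro AE_I2 impI allI)
      fix y s :: real assume *: "y \<in> {0..x}" "0 \<le> s" "y + lam i * s \<le> x" "\<mu> * s \<le> y"
      have "0 \<le> lam i * s" "0 \<le> \<mu> * s" using * l mu by auto
      then have "M i (y + lam i * s) (y - \<mu> * s)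
          = M i y y + (LINT \<sigma>:{0..s}|lborel. src M N i (y + lam i * \<sigma>) (y - \<mu> * \<sigma>))"
        using * x by (intro M_char) (auto simp: triangle_def)
      then show "M i (y + lam i * s) (y - \<mu> * s) * G (y + lam i * s) (y - \<mu> * s) = M i y y * G y y
          + (LINT \<sigma>:{0..s}|lborel. src M N i (y + lam i * \<sigma>) (y - \<mu> * \<sigma>) * G (y + lam i * \<sigma>) (y - \<mu> * \<sigma>))"
        unfolding Gchar by (simp add: distrib_right)
    qed
  qed (use x in auto)
  moreover have "(LINT y:{0..x}|lborel. LINT \<xi>:{0..y}|lborel. src M N i y \<xi> * G y \<xi>) = (LINT y:{0..x}|lborel. S y)"
  proof (rule set_lebesgue_integral_cong)
    show "\<forall>y. y \<in> {0..x} \<longrightarrow> (LINT \<xi>:{0..y}|lborel. src M N i y \<xi> * G y \<xi>) = S y"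
      using h_src(1)[of _ "\<tau> + 1 / lam i * _"] x tm unfolding S_def G_def h_def by auto
  qed simp
  moreover have "(lam i + \<mu>) * (LINT y:{0..x}|lborel. M i y y * G y y) = (LINT y:{0..x}|lborel. B y i * G y y)"
    unfolding set_integral_mult_right[symmetric]
    by (rule set_lebesgue_integral_cong) (use M_diag x in \<open>auto simp: mult.assoc[symmetric]\<close>)
  ultimately have "lam i * (LINT \<xi>:{0..x}|lborel. M i x \<xi> * G x \<xi>)
      = (LINT y:{0..x}|lborel. S y) + (LINT y:{0..x}|lborel. B y i * G y y) - \<mu> * (LINT y:{0..x}|lborel. M i y 0 * G y 0)"
    by simp
  also have "\<dots> = (LINT y:{0..x}|lborel. S y + B y i * G y y - \<mu> * (M i y 0 * G y 0))"
  proof -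
    have "bm_on {0..x} (\<lambda>y. B y i * G y y)"
      using x by (intro bm_on_mult bm2_diag G bm_on_subset[OF B]) auto
    then show ?thesis using S M0 by (simp add: LINT_bm_diff LINT_bm_add bm_on_add bm_on_mult bm_on_const)
  qed
  finally show ?thesis by (simp add: S_def G_def h_def mult.assoc)
qed

text \<open>The same with lines parallel to the diagonal, along which \<open>G\<close> is constant.
  No diagonal term arises; the bottom again produces the injection.\<close>

lemma h_transport':
  assumes x: "x \<in> {0..L}" and \<tau>: "0 \<le> \<tau> + - (1 / \<mu>) * x"
  shows "\<mu> * h N x (\<tau> + - (1 / \<mu>) * x) = (LINT y:{0..x}|lborel.
    \<mu> * N y 0 * e' 0 (\<tau> + - (1 / \<mu>) * y) - src' (\<lambda>j. h (M j)) y (\<tau> + - (1 / \<mu>) * y))"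
proof -
  define G where "G y \<xi> = e' 0 (\<tau> + - (1 / \<mu>) * y + \<xi> / \<mu>)" for y \<xi>
  have xm: "0 \<le> 1 / \<mu> * x" using x mu by simp
  have G: "bm2 (triangle x) G"
    using bm2_output[of \<tau> "- (1 / \<mu>)" x] \<tau> xm unfolding G_def by simp
  have sub: "triangle x \<subseteq> triangle L" using x by (auto simp: triangle_def)
  have tm: "0 \<le> \<tau> + - (1 / \<mu>) * y" if "y \<le> x" for y
    using mult_left_mono[OF that, of "1 / \<mu>"] mu \<tau> by simp
  define S where "S y = src' (\<lambda>j. h (M j)) y (\<tau> + - (1 / \<mu>) * y)" for y
  have S: "bm_on {0..x} S" unfolding S_def
    by (rule strip_bm_line) (use x tm[of 0] tm[of x] in \<open>auto intro: strip_bm_src' h_bm M\<close>)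
  have N0: "bm_on {0..x} (\<lambda>y. N y 0 * G y 0)"
    by (intro bm_on_mult bm2_bottom bm_on_subset[OF N sub] G)
  have Gchar: "G (y + \<mu> * s) (\<mu> * s) = G y 0" for y s
    using mu by (simp add: G_def field_simps)
  have "(LINT y:{0..x}|lborel. LINT \<xi>:{0..y}|lborel. - (src' M y \<xi> * G y \<xi>))
      = \<mu> * (LINT \<xi>:{0..x}|lborel. N x \<xi> * G x \<xi>) - \<mu> * (LINT y:{0..x}|lborel. N y 0 * G y 0)"
  proof (rule divergence_parallel[OF mu])
    show "bm2 (triangle x) (\<lambda>y \<xi>. N y \<xi> * G y \<xi>)"
      by (intro bm2_mult bm_on_subset[OF N sub] G)
    have "bm2 (triangle x) (\<lambda>y \<xi>. src' M y \<xi> * G y \<xi>)"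
      by (intro bm2_mult bm_on_subset[OF bm2_triangle_src(2) sub] G M N)
    then show "bm2 (triangle x) (\<lambda>y \<xi>. - (src' M y \<xi> * G y \<xi>))"
      using bm_on_uminus by (fastforce simp: split_beta')
    show "AE y in lborel. y \<in> {0..x} \<longrightarrow> (\<forall>s\<ge>0. y + \<mu> * s \<le> x \<longrightarrow>
        N (y + \<mu> * s) (\<mu> * s) * G (y + \<mu> * s) (\<mu> * s) = N y 0 * G y 0
          + (LINT \<sigma>:{0..s}|lborel. - (src' M (y + \<mu> * \<sigma>) (\<mu> * \<sigma>) * G (y + \<mu> * \<sigma>) (\<mu> * \<sigma>))))"
    proof (intro AE_I2 impI allI)
      fix y s :: real assume *: "y \<in> {0..x}" "0 \<le> s" "y + \<mu> * s \<le> x"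
      then have "N (y + \<mu> * s) (\<mu> * s) = N y 0 - (LINT \<sigma>:{0..s}|lborel. src' M (y + \<mu> * \<sigma>) (\<mu> * \<sigma>))"
        using x by (intro N_char) auto
      then show "N (y + \<mu> * s) (\<mu> * s) * G (y + \<mu> * s) (\<mu> * s) = N y 0 * G y 0
          + (LINT \<sigma>:{0..s}|lborel. - (src' M (y + \<mu> * \<sigma>) (\<mu> * \<sigma>) * G (y + \<mu> * \<sigma>) (\<mu> * \<sigma>)))"
        unfolding Gchar by (simp add: left_diff_distrib LINT_neg)
    qed
  qed (use x in auto)
  moreover have "(LINT y:{0..x}|lborel. LINT \<xi>:{0..y}|lborel. - (src' M y \<xi> * G y \<xi>)) = - (LINT y:{0..x}|lborel. S y)"
  proof -
    have "(LINT \<xi>:{0..y}|lborel. - (src' M y \<xi> * G y \<xi>)) = - S y" if "y \<in> {0..x}" for y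
      using h_src(2)[of y "\<tau> + - (1 / \<mu>) * y"] x tm[of y] that unfolding S_def G_def h_def
      by (simp add: LINT_neg)
    then have "(LINT y:{0..x}|lborel. LINT \<xi>:{0..y}|lborel. - (src' M y \<xi> * G y \<xi>)) = (LINT y:{0..x}|lborel. - S y)"
      by (intro set_lebesgue_integral_cong) auto
    then show ?thesis by (simp add: LINT_neg)
  qed
  ultimately have "\<mu> * (LINT \<xi>:{0..x}|lborel. N x \<xi> * G x \<xi>)
      = \<mu> * (LINT y:{0..x}|lborel. N y 0 * G y 0) - (LINT y:{0..x}|lborel. S y)"
    by simp
  also have "\<dots> = (LINT y:{0..x}|lborel. \<mu> * (N y 0 * G y 0) - S y)"
    using S N0 by (simp add: LINT_bm_diff bm_on_mult bm_on_const)
  finally show ?thesis by (simp add: S_def G_def h_def mult.assoc)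
qed

lemma \<epsilon>_eq:
  "AE \<tau> in lborel. \<forall>x\<in>{0..L}. 0 + 1 / v * x < \<tau> + 1 / lam i * x \<longrightarrow>
     \<epsilon> i x (\<tau> + 1 / lam i * x) = 1 / lam i * (LINT y:{0..x}|lborel. src \<epsilon> \<epsilon>' i y (\<tau> + 1 / lam i * y))"
  using char_sol_from_inflow[OF e_sol[of i] e_0[of i]]
proof eventually_elim
  case (elim \<tau>)
  show ?case
  proof (intro ballI impI)
    fix x assume x: "x \<in> {0..L}" and "0 + 1 / v * x < \<tau> + 1 / lam i * x"
    \<comment> \<open>Above the slowest front the line enters through \<open>x = 0\<close>, where
      the error is zero.\<close>
    then have \<tau>: "0 < \<tau>" using entry_time_pos[of x 0 \<tau> i] by auto
    note l = lam_pos[of i]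
    have tm: "0 \<le> \<tau> + 1 / lam i * y" if "0 \<le> y" for y using that \<tau> l by simp
    let ?t = "\<lambda>y. \<tau> + 1 / lam i * y"
    define E where "E y = src e e' i y (?t y) - \<mu> * M i y 0 * e' 0 (?t y)" for y
    define H where "H y = src (\<lambda>j. h (M j)) (h N) i y (?t y) + B y i * e' 0 (?t y + y / \<mu>)
      - \<mu> * M i y 0 * e' 0 (?t y)" for y
    have M0: "bm_on {0..L} (\<lambda>y. \<mu> * M i y 0)"
      by (intro bm_on_mult bm_on_const bm2_bottom M)
    have "strip_bm (\<lambda>y t. src e e' i y t - \<mu> * M i y 0 * e' 0 t)"
      by (rule strip_bm_diff strip_bm_src e e' strip_bm_mult strip_bm_fst[OF M0] strip_bm_snd output_bm)+
    from strip_bm_line[OF this, of 0 x \<tau> "1 / lam i"] have mE: "bm_on {0..x} E"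
      using x tm[of 0] tm[of x] by (simp add: E_def[abs_def])
    have "strip_bm (\<lambda>y t. src (\<lambda>j. h (M j)) (h N) i y t + B y i * e' 0 (t + y / \<mu>) - \<mu> * M i y 0 * e' 0 t)"
      by (rule strip_bm_diff strip_bm_add strip_bm_src h_bm M N strip_bm_mult strip_bm_fst[OF M0]
            strip_bm_fst[OF B] shift_bm strip_bm_snd output_bm)+
    from strip_bm_line[OF this, of 0 x \<tau> "1 / lam i"] have mH: "bm_on {0..x} H"
      using x tm[of 0] tm[of x] by (simp add: H_def[abs_def])
    have "e i x (?t x) = 1 / lam i * (LINT y:{0..x}|lborel. E y)"
      using elim[rule_format, OF \<tau> x] by (simp add: E_def)
    moreover have "h (M i) x (?t x) = 1 / lam i * (LINT y:{0..x}|lborel. H y)"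
      using h_transport[OF \<tau> x, of i] l by (simp add: H_def field_simps)
    ultimately have "\<epsilon> i x (?t x) = 1 / lam i * (LINT y:{0..x}|lborel. E y - H y)"
      by (simp add: \<epsilon>_def LINT_bm_diff mE mH right_diff_distrib)
    \<comment> \<open>The injection terms occur in both sources and cancel; the shifted output error
      in \<open>H\<close> is the part of \<open>\<epsilon>'\<close> not contained in
      \<open>h N\<close>.\<close>
    moreover have "E y - H y = src \<epsilon> \<epsilon>' i y (?t y)" for y
      by (simp add: E_def H_def src_def \<epsilon>_def \<epsilon>'_def right_diff_distrib sum_subtractf)
    ultimately show "\<epsilon> i x (?t x) = 1 / lam i * (LINT y:{0..x}|lborel. src \<epsilon> \<epsilon>' i y (?t y))" by simp
  qed
qed

lemma \<epsilon>'_eq: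
  "AE \<tau> in lborel. \<forall>x\<in>{0..L}. 0 + 1 / v * x < \<tau> + - (1 / \<mu>) * x \<longrightarrow>
     \<epsilon>' x (\<tau> + - (1 / \<mu>) * x) = - (1 / \<mu>) * (LINT y:{0..x}|lborel. src' \<epsilon> y (\<tau> + - (1 / \<mu>) * y))"
  using e'_sol[unfolded char_sol_def]
proof eventually_elim
  case (elim \<tau>)
  show ?case
  proof (intro ballI impI)
    fix x assume x: "x \<in> {0..L}" and *: "0 + 1 / v * x < \<tau> + - (1 / \<mu>) * x"
    let ?t = "\<lambda>y. \<tau> + - (1 / \<mu>) * y"
    have "0 \<le> 1 / v * x" using x v by simp
    then have tx: "0 \<le> ?t x" using * by linarith
    have "0 \<le> 1 / \<mu> * x" using x mu by simp
    then have t0: "0 \<le> ?t 0" using tx by simp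
    define E where "E y = src' e y (?t y) - \<mu> * N y 0 * e' 0 (?t y)" for y
    define H where "H y = \<mu> * N y 0 * e' 0 (?t y) - src' (\<lambda>j. h (M j)) y (?t y)" for y
    have N0: "bm_on {0..L} (\<lambda>y. \<mu> * N y 0)"
      by (intro bm_on_mult bm_on_const bm2_bottom N)
    have "strip_bm (\<lambda>y t. src' e y t - \<mu> * N y 0 * e' 0 t)"
      by (rule strip_bm_diff strip_bm_src' e strip_bm_mult strip_bm_fst[OF N0] strip_bm_snd output_bm)+
    from strip_bm_line[OF this, of 0 x \<tau> "- (1 / \<mu>)"] have mE: "bm_on {0..x} E"
      using x t0 tx by (simp add: E_def[abs_def])
    have "strip_bm (\<lambda>y t. \<mu> * N y 0 * e' 0 t - src' (\<lambda>j. h (M j)) y t)"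
      by (rule strip_bm_diff strip_bm_src' h_bm M strip_bm_mult strip_bm_fst[OF N0] strip_bm_snd output_bm)+
    from strip_bm_line[OF this, of 0 x \<tau> "- (1 / \<mu>)"] have mH: "bm_on {0..x} H"
      using x t0 tx by (simp add: H_def[abs_def])
    have "e' x (?t x) = e' 0 \<tau> + - (1 / \<mu>) * (LINT y:{0..x}|lborel. E y)"
      using elim[rule_format, of 0 x] x t0 tx by (simp add: E_def)
    moreover have "h N x (?t x) = 1 / \<mu> * (LINT y:{0..x}|lborel. H y)"
      using h_transport'[OF x tx] mu by (simp add: H_def field_simps)
    \<comment> \<open>The transported part of \<open>\<epsilon>'\<close> is constant on this line
      and equals the value of \<open>e'\<close> at \<open>x = 0\<close>, so the boundary term drops
      out.\<close>
    moreover have "?t x + x / \<mu> = \<tau>" by simp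
    ultimately have "\<epsilon>' x (?t x) = - (1 / \<mu>) * (LINT y:{0..x}|lborel. E y + H y)"
      by (simp add: \<epsilon>'_def LINT_bm_add mE mH distrib_left)
    moreover have "E y + H y = src' \<epsilon> y (?t y)" for y
      by (simp add: E_def H_def src'_def \<epsilon>_def right_diff_distrib sum_subtractf)
    ultimately show "\<epsilon>' x (?t x) = - (1 / \<mu>) * (LINT y:{0..x}|lborel. src' \<epsilon> y (?t y))" by simp
  qed
qed

lemmas \<epsilon>_vanish = vanish_from_zero_inflow[OF order_refl \<epsilon>_bm \<epsilon>'_bm \<epsilon>_eq \<epsilon>'_eq]

text \<open>At \<open>x = L\<close> both differences are zero once the slowest front has arrived.
  Inserting this into the reflection condition, \<open>N_L\<close> makes \<open>h N\<close> cancel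
  against the reflected \<open>h (M j)\<close>, and only the output error \<open>L / \<mu>\<close>
  later remains.\<close>

lemma output_vanish: "AE t in lborel. L / v + L / \<mu> < t \<longrightarrow> e' 0 t = 0"
proof -
  have "AE t in lborel. \<forall>i. 0 + 1 / v * L < t \<longrightarrow> \<epsilon> i L t = 0"
    using char_AE_at_x[OF \<epsilon>_vanish(1)] L by (intro AE_all_countable[THEN iffD2] allI) auto
  moreover have "AE t in lborel. 0 + 1 / v * L < t \<longrightarrow> \<epsilon>' L t = 0"
    using char_AE_at_x[OF \<epsilon>_vanish(2)] L by auto
  ultimately have "AE t in lborel. L / v < t \<longrightarrow> e' 0 (t + L / \<mu>) = 0"
    using e'_L
  proof eventually_elim
    case (elim t)
    show ?case
    proof
      assume t: "L / v < t"
      have t0: "0 < t" using t L v by (meson divide_pos_pos less_trans)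
      have m: "bm_on {0..L} (\<lambda>\<xi>. M j L \<xi> * e' 0 (t + \<xi> / \<mu>))" for j
        using t0 L by (intro bm_on_mult output_shift_bm bm2_row[OF M]) auto
      have "h N L t = (LINT \<xi>:{0..L}|lborel. \<Sum>j\<in>UNIV. R j * (M j L \<xi> * e' 0 (t + \<xi> / \<mu>)))"
        unfolding h_def
        by (rule set_lebesgue_integral_cong) (auto simp: N_L sum_distrib_right mult.assoc)
      also have "\<dots> = (\<Sum>j\<in>UNIV. R j * h (M j) L t)"
        by (simp add: LINT_bm_sum bm_on_mult bm_on_const m h_def)
      finally have "h N L t = (\<Sum>j\<in>UNIV. R j * h (M j) L t)" .
      moreover have "e j L t = h (M j) L t" for j using elim(1) t by (simp add: \<epsilon>_def)
      ultimately show "e' 0 (t + L / \<mu>) = 0" using elim(2,3) t t0 by (simp add: \<epsilon>'_def)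
    qed
  qed
  then have "AE t in lborel. L / v < - (L / \<mu>) + 1 * t \<longrightarrow> e' 0 (- (L / \<mu>) + 1 * t + L / \<mu>) = 0"
    by (rule AE_affine[rotated]) simp
  then show ?thesis by (simp add: algebra_simps)
qed

lemma h_vanish:
  assumes "L / v + L / \<mu> \<le> t" shows "h k x t = 0"
proof -
  have "AE \<xi> in lborel. L / v + L / \<mu> < t + 1 / \<mu> * \<xi> \<longrightarrow> e' 0 (t + 1 / \<mu> * \<xi>) = 0"
    by (rule AE_affine[OF _ output_vanish]) (use mu in simp)
  \<comment> \<open>For \<open>\<xi> > 0\<close> the argument exceeds \<open>t\<close> strictly;
    this admits the closed bound on \<open>t\<close> although the output is known to vanish only
    after an open one.\<close>
  moreover have "AE \<xi> in lborel. \<xi> \<noteq> (0::real)" by (rule AE_lborel_singleton)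
  ultimately have "AE \<xi> in lborel. \<xi> \<in> {0..x} \<longrightarrow> k x \<xi> * e' 0 (t + \<xi> / \<mu>) = 0"
  proof eventually_elim
    case (elim \<xi>)
    show ?case
    proof
      assume "\<xi> \<in> {0..x}"
      then have "0 < 1 / \<mu> * \<xi>" using elim(2) mu by simp
      then show "k x \<xi> * e' 0 (t + \<xi> / \<mu>) = 0" using elim(1) assms by simp
    qed
  qed
  then show ?thesis unfolding h_def by (rule LINT_eq_0)
qed

theorem error_vanishes:
  "AE \<tau> in lborel. \<forall>x\<in>{0..L}. L / v + L / \<mu> \<le> \<tau> + 1 / lam i * x \<longrightarrow> e i x (\<tau> + 1 / lam i * x) = 0"
  "AE \<tau> in lborel. \<forall>x\<in>{0..L}. L / v + L / \<mu> \<le> \<tau> + - (1 / \<mu>) * x \<longrightarrow> e' x (\<tau> + - (1 / \<mu>) * x) = 0"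
proof -
  have region: "0 + 1 / v * x < t" if "x \<in> {0..L}" "L / v + L / \<mu> \<le> t" for x t
  proof -
    have "x / v \<le> L / v" using that v by (auto intro: divide_right_mono)
    moreover have "0 < L / \<mu>" using L mu by simp
    ultimately show ?thesis using that by simp
  qed
  show "AE \<tau> in lborel. \<forall>x\<in>{0..L}. L / v + L / \<mu> \<le> \<tau> + 1 / lam i * x \<longrightarrow> e i x (\<tau> + 1 / lam i * x) = 0"
    using \<epsilon>_vanish(1)[of i]
  proof eventually_elim
    case (elim \<tau>)
    show ?case
    proof (intro ballI impI)
      fix x assume x: "x \<in> {0..L}" and t: "L / v + L / \<mu> \<le> \<tau> + 1 / lam i * x"
      then have "\<epsilon> i x (\<tau> + 1 / lam i * x) = 0" using elim region[OF x t] by blast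
      then show "e i x (\<tau> + 1 / lam i * x) = 0" unfolding \<epsilon>_def h_vanish[OF t] by simp
    qed
  qed
  \<comment> \<open>At \<open>x = 0\<close> the closed bound on the time gives no strict one on
    \<open>\<tau>\<close>; a single label is discarded instead.\<close>
  have "AE \<tau> in lborel. \<tau> \<noteq> L / v + L / \<mu>" by (rule AE_lborel_singleton)
  then show "AE \<tau> in lborel. \<forall>x\<in>{0..L}. L / v + L / \<mu> \<le> \<tau> + - (1 / \<mu>) * x \<longrightarrow> e' x (\<tau> + - (1 / \<mu>) * x) = 0"
    using \<epsilon>_vanish(2) output_vanish
  proof eventually_elim
    case (elim \<tau>)
    show ?case
    proof (intro ballI impI)
      fix x assume x: "x \<in> {0..L}" and t: "L / v + L / \<mu> \<le> \<tau> + - (1 / \<mu>) * x"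
      have e: "\<epsilon>' x (\<tau> + - (1 / \<mu>) * x) = 0" using elim(2) x region[OF x t] by blast
      have "0 \<le> 1 / \<mu> * x" using x mu by simp
      then have "L / v + L / \<mu> < \<tau>" using t elim(1) by simp
      then have "e' 0 (\<tau> + - (1 / \<mu>) * x + x / \<mu>) = 0" using elim(3) by simp
      then show "e' x (\<tau> + - (1 / \<mu>) * x) = 0" using e unfolding \<epsilon>'_def h_vanish[OF t] by simp
    qed
  qed
qed

end

lemma nested_LINT_sum:
  fixes \<psi> :: "'i::finite \<Rightarrow> real \<Rightarrow> real \<Rightarrow> real"
  assumes "\<And>i. bm2 (triangle X) (\<psi> i)" "bm2 (triangle X) \<psi>'"
  shows "(\<Sum>i\<in>UNIV. LINT x:{0..X}|lborel. LINT \<xi>:{0..x}|lborel. \<psi> i x \<xi>)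
      + (LINT x:{0..X}|lborel. LINT \<xi>:{0..x}|lborel. \<psi>' x \<xi>)
    = (LINT x:{0..X}|lborel. LINT \<xi>:{0..x}|lborel. (\<Sum>i\<in>UNIV. \<psi> i x \<xi>) + \<psi>' x \<xi>)"
proof -
  have m: "bm_on {0..X} (\<lambda>x. LINT \<xi>:{0..x}|lborel. k x \<xi>)" if "bm2 (triangle X) k" for k
    by (rule bm_on_triangle_integral[OF that])
  have "(\<Sum>i\<in>UNIV. LINT x:{0..X}|lborel. LINT \<xi>:{0..x}|lborel. \<psi> i x \<xi>)
      + (LINT x:{0..X}|lborel. LINT \<xi>:{0..x}|lborel. \<psi>' x \<xi>)
    = (LINT x:{0..X}|lborel. (\<Sum>i\<in>UNIV. LINT \<xi>:{0..x}|lborel. \<psi> i x \<xi>) + (LINT \<xi>:{0..x}|lborel. \<psi>' x \<xi>))"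
    by (simp add: LINT_bm_add LINT_bm_sum bm_on_sum m assms)
  also have "\<dots> = (LINT x:{0..X}|lborel. LINT \<xi>:{0..x}|lborel. (\<Sum>i\<in>UNIV. \<psi> i x \<xi>) + \<psi>' x \<xi>)"
  proof (rule set_lebesgue_integral_cong)
    show "\<forall>x. x \<in> {0..X} \<longrightarrow> (\<Sum>i\<in>UNIV. LINT \<xi>:{0..x}|lborel. \<psi> i x \<xi>) + (LINT \<xi>:{0..x}|lborel. \<psi>' x \<xi>)
        = (LINT \<xi>:{0..x}|lborel. (\<Sum>i\<in>UNIV. \<psi> i x \<xi>) + \<psi>' x \<xi>)"
    proof (intro allI impI)
      fix x assume x: "x \<in> {0..X}"
      show "(\<Sum>i\<in>UNIV. LINT \<xi>:{0..x}|lborel. \<psi> i x \<xi>) + (LINT \<xi>:{0..x}|lborel. \<psi>' x \<xi>)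
        = (LINT \<xi>:{0..x}|lborel. (\<Sum>i\<in>UNIV. \<psi> i x \<xi>) + \<psi>' x \<xi>)"
        by (simp add: LINT_bm_add LINT_bm_sum bm_on_sum bm2_row[OF _ x] assms)
    qed
  qed simp
  finally show ?thesis .
qed

section \<open>The state feedback\<close>

text \<open>\<open>w\<close> and \<open>w'\<close> are the true state: the locale presupposes that
  after \<open>T0\<close> the estimates in the feedback have become exact and the reflection at
  \<open>x = L\<close> is cancelled. The conditions \<open>K_diag\<close> and \<open>K'_0\<close>
  are tuned to the diagonal and to the bottom of the triangle.\<close>

locale controlled_system = hyperbolic_coeffs +
  fixes K :: "'a \<Rightarrow> real \<Rightarrow> real \<Rightarrow> real" and K' :: "real \<Rightarrow> real \<Rightarrow> real" and Q :: "'a \<Rightarrow> real"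
    and w :: "'a \<Rightarrow> real \<Rightarrow> real \<Rightarrow> real" and w' :: "real \<Rightarrow> real \<Rightarrow> real" and T0 :: real
  assumes K: "\<And>i. bm2 (triangle L) (K i)" and K': "bm2 (triangle L) K'"
    and K_char: "\<And>j x \<xi> s. (x, \<xi>) \<in> triangle L \<Longrightarrow> 0 \<le> s \<Longrightarrow> (x + \<mu> * s, \<xi> - lam j * s) \<in> triangle L \<Longrightarrow>
      K j (x + \<mu> * s) (\<xi> - lam j * s) = K j x \<xi> + (LINT \<sigma>:{0..s}|lborel.
        (\<Sum>i\<in>UNIV. K i (x + \<mu> * \<sigma>) (\<xi> - lam j * \<sigma>) * A (\<xi> - lam j * \<sigma>) i j)
        + K' (x + \<mu> * \<sigma>) (\<xi> - lam j * \<sigma>) * C (\<xi> - lam j * \<sigma>) j)"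
    and K_diag: "\<And>i x. x \<in> {0..L} \<Longrightarrow> (\<mu> + lam i) * K i x x = - C x i"
    and K'_char: "\<And>y s. 0 \<le> y \<Longrightarrow> 0 \<le> s \<Longrightarrow> y + \<mu> * s \<le> L \<Longrightarrow>
      K' (y + \<mu> * s) (\<mu> * s) = K' y 0 + (LINT \<sigma>:{0..s}|lborel. \<Sum>i\<in>UNIV. K i (y + \<mu> * \<sigma>) (\<mu> * \<sigma>) * B (\<mu> * \<sigma>) i)"
    and K'_0: "\<And>x. x \<in> {0..L} \<Longrightarrow> \<mu> * K' x 0 = (\<Sum>i\<in>UNIV. lam i * K i x 0 * Q i)"
    and w: "\<And>i. strip_bm (w i)" and w': "strip_bm w'"
    and w_sol: "\<And>i. char_sol L (1 / lam i) (src w w' i) (w i)"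
    and w'_sol: "char_sol L (- (1 / \<mu>)) (src' w) w'"
    and w_0: "\<And>i. AE t in lborel. 0 < t \<longrightarrow> w i 0 t = Q i * w' 0 t"
    and w'_L: "AE t in lborel. T0 < t \<longrightarrow> w' L t =
      (\<Sum>i\<in>UNIV. LINT \<xi>:{0..L}|lborel. K i L \<xi> * w i \<xi> t) + (LINT \<xi>:{0..L}|lborel. K' L \<xi> * w' \<xi> t)"
    and T0: "0 \<le> T0"
begin

text \<open>Sources of the kernels along their characteristics. The coefficients are taken at
  \<open>\<xi>\<close> and multiply from the right, transposed relative to \<open>src\<close> and
  \<open>src'\<close>; this makes the kernel system adjoint to the plant.\<close>

definition kA :: "'a \<Rightarrow> real \<Rightarrow> real \<Rightarrow> real" where
  "kA j x \<xi> = (\<Sum>i\<in>UNIV. K i x \<xi> * A \<xi> i j) + K' x \<xi> * C \<xi> j"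

definition kB :: "real \<Rightarrow> real \<Rightarrow> real" where
  "kB x \<xi> = (\<Sum>i\<in>UNIV. K i x \<xi> * B \<xi> i)"

lemma kA_bm: "bm2 (triangle L) (kA j)" and kB_bm: "bm2 (triangle L) kB"
proof -
  have c: "bm2 (triangle L) (\<lambda>x \<xi>. f \<xi>)" if "bm_on {0..L} f" for f
    by (rule bm_on_snd[OF that]) (auto simp: triangle_def)
  show "bm2 (triangle L) (kA j)" unfolding kA_def[abs_def]
    by (intro bm2_add bm2_sum bm2_mult c A C K K')
  show "bm2 (triangle L) kB" unfolding kB_def[abs_def]
    by (intro bm2_sum bm2_mult c B K)
qed

text \<open>\<open>\<tau>\<close> is the time at which a characteristic of speed \<open>-\<mu>\<close>, after crossing the whole interval,
  reaches \<open>x = 0\<close>; \<open>tt x\<close> is the time at which it passes \<open>x\<close>.\<close>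

context
  fixes \<tau> :: real
  assumes \<tau>: "T0 < \<tau> - L / \<mu>"
begin

definition tt :: "real \<Rightarrow> real" where
  "tt x = \<tau> + - (1 / \<mu>) * x"

lemma tt_range: "0 \<le> x \<Longrightarrow> x \<le> L \<Longrightarrow> T0 < tt x \<and> 0 \<le> tt x \<and> tt x \<le> \<tau>"
  using \<tau> T0 mu divide_right_mono[of x L \<mu>] by (auto simp: tt_def)

lemma tt_bm:
  assumes "strip_bm u" shows "bm2 (triangle L) (\<lambda>x \<xi>. u \<xi> (tt x))"
  by (rule bm2_compose[OF assms[unfolded strip_bm_def, rule_format, of \<tau>]])
     (use tt_range mu in \<open>auto simp: triangle_def tt_def split_beta' intro!: continuous_intros\<close>)

text \<open>In the direction \<open>(\<mu>, - lam j)\<close> the position \<open>\<xi>\<close> moves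
  left with speed \<open>lam j\<close> while \<open>tt x\<close> runs backwards in time, so the
  kernel characteristic lies over a characteristic of \<open>w j\<close>, and the product rule
  applies to \<open>K j * w j\<close>. The diagonal carries the arriving characteristic, the right
  side the state at time \<open>tt L\<close>, and the bottom the inflow trace.\<close>

lemma divergence_K:
  "(LINT x:{0..L}|lborel. LINT \<xi>:{0..x}|lborel. kA j x \<xi> * w j \<xi> (tt x) - K j x \<xi> * src w w' j \<xi> (tt x))
   = \<mu> * (LINT \<xi>:{0..L}|lborel. K j L \<xi> * w j \<xi> (tt L)) + lam j * (LINT x:{0..L}|lborel. K j x 0 * w j 0 (tt x))
     - (\<mu> + lam j) * (LINT x:{0..L}|lborel. K j x x * w j x (tt x))"
proof (rule divergence_diagonal[OF mu lam_pos])
  note l = lam_pos[of j]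
  show "bm2 (triangle L) (\<lambda>x \<xi>. K j x \<xi> * w j \<xi> (tt x))"
    by (intro bm2_mult K tt_bm w)
  show "bm2 (triangle L) (\<lambda>x \<xi>. kA j x \<xi> * w j \<xi> (tt x) - K j x \<xi> * src w w' j \<xi> (tt x))"
    by (intro bm2_diff bm2_mult kA_bm K tt_bm strip_bm_src w w')
  \<comment> \<open>The line of \<open>w j\<close> over the kernel characteristic from
    \<open>(y, y)\<close> passes \<open>x = 0\<close> at time \<open>\<tau> - c * y\<close>. Since
    \<open>c \<noteq> 0\<close>, almost every \<open>\<tau>\<close>-label means almost every
    \<open>y\<close>.\<close>
  define c where "c = 1 / \<mu> + 1 / lam j"
  have "0 < c" using mu l by (simp add: c_def add_pos_pos)
  then have "- c \<noteq> 0" by simp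
  from AE_affine[OF this w_sol[unfolded char_sol_def, of j], of \<tau>]
  show "AE y in lborel. y \<in> {0..L} \<longrightarrow> (\<forall>s\<ge>0. y + \<mu> * s \<le> L \<longrightarrow> lam j * s \<le> y \<longrightarrow>
      K j (y + \<mu> * s) (y - lam j * s) * w j (y - lam j * s) (tt (y + \<mu> * s)) = K j y y * w j y (tt y)
      + (LINT \<sigma>:{0..s}|lborel. kA j (y + \<mu> * \<sigma>) (y - lam j * \<sigma>) * w j (y - lam j * \<sigma>) (tt (y + \<mu> * \<sigma>))
          - K j (y + \<mu> * \<sigma>) (y - lam j * \<sigma>) * src w w' j (y - lam j * \<sigma>) (tt (y + \<mu> * \<sigma>))))"
  proof eventually_elim
    case (elim y)
    show ?case
    proof (intro impI allI)
      fix S assume y: "y \<in> {0..L}" and S: "0 \<le> S" "y + \<mu> * S \<le> L" "lam j * S \<le> y"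
      have inside: "(y + \<mu> * s, y - lam j * s) \<in> triangle L" if "0 \<le> s" "s \<le> S" for s
      proof -
        have "0 \<le> \<mu> * s" "\<mu> * s \<le> \<mu> * S" "0 \<le> lam j * s" "lam j * s \<le> lam j * S"
          using that mu l by (auto intro: mult_left_mono)
        then show ?thesis using y S unfolding triangle_def by auto
      qed
      have line: "tt (y + \<mu> * s) = (\<tau> + - c * y) + 1 / lam j * (y - lam j * s)" for s
        using mu l by (simp add: tt_def c_def field_simps)
      have comp: "bm_on {0..S} (\<lambda>s. k (y + \<mu> * s) (y - lam j * s))" if "bm2 (triangle L) k" for k
        by (rule bm_on_compose_Pair[OF that]) (auto intro!: inside continuous_intros)
      have "K j (y + \<mu> * S) (y - lam j * S) * w j (y - lam j * S) (tt (y + \<mu> * S))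
          = K j (y + \<mu> * 0) (y - lam j * 0) * w j (y - lam j * 0) (tt (y + \<mu> * 0))
          + (LINT \<sigma>:{0..S}|lborel. kA j (y + \<mu> * \<sigma>) (y - lam j * \<sigma>) * w j (y - lam j * \<sigma>) (tt (y + \<mu> * \<sigma>))
          + K j (y + \<mu> * \<sigma>) (y - lam j * \<sigma>) * - src w w' j (y - lam j * \<sigma>) (tt (y + \<mu> * \<sigma>)))"
      proof (rule LINT_product_rule[where u="\<lambda>s. K j (y + \<mu> * s) (y - lam j * s)"
            and v="\<lambda>s. w j (y - lam j * s) (tt (y + \<mu> * s))"])
        show "bm_on {0..S} (\<lambda>\<sigma>. kA j (y + \<mu> * \<sigma>) (y - lam j * \<sigma>))" by (rule comp[OF kA_bm])
        show "bm_on {0..S} (\<lambda>\<sigma>. - src w w' j (y - lam j * \<sigma>) (tt (y + \<mu> * \<sigma>)))"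
          by (intro bm_on_uminus comp[OF tt_bm] strip_bm_src w w')
        fix s assume s: "0 \<le> s" "s \<le> S"
        show "K j (y + \<mu> * s) (y - lam j * s) = K j (y + \<mu> * 0) (y - lam j * 0)
            + (LINT \<sigma>:{0..s}|lborel. kA j (y + \<mu> * \<sigma>) (y - lam j * \<sigma>))"
          using K_char[of y y s j] inside[OF s] inside[of 0] s S by (simp add: kA_def)
        have ys: "0 \<le> y - lam j * s" "y - lam j * s \<le> y" "y \<le> L" "y + \<mu> * s \<le> L" "0 \<le> y + \<mu> * s"
          using inside[OF s] y l mu s by (auto simp: triangle_def)
        have "w j y (tt (y + \<mu> * 0)) = w j (y - lam j * s) (tt (y + \<mu> * s))
            + 1 / lam j * (LINT x:{y - lam j * s..y}|lborel. src w w' j x ((\<tau> + - c * y) + 1 / lam j * x))"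
          using elim[rule_format, OF ys(1-3)] tt_range[of y] tt_range[of "y + \<mu> * s"] ys y
            line[of s] line[of 0] by simp
        also have "(LINT x:{y - lam j * s..y}|lborel. src w w' j x ((\<tau> + - c * y) + 1 / lam j * x))
            = lam j * (LINT \<sigma>:{0..s}|lborel. src w w' j (y - lam j * \<sigma>) (tt (y + \<mu> * \<sigma>)))"
          unfolding line
          using LINT_interval_reflect[OF l, of y s 0 "\<lambda>x. src w w' j x ((\<tau> + - c * y) + 1 / lam j * x)"] by simp
        finally show "w j (y - lam j * s) (tt (y + \<mu> * s)) = w j (y - lam j * 0) (tt (y + \<mu> * 0))
            + (LINT \<sigma>:{0..s}|lborel. - src w w' j (y - lam j * \<sigma>) (tt (y + \<mu> * \<sigma>)))"
          using l by (simp add: LINT_neg)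
      qed (rule S)
      then show "K j (y + \<mu> * S) (y - lam j * S) * w j (y - lam j * S) (tt (y + \<mu> * S)) = K j y y * w j y (tt y)
        + (LINT \<sigma>:{0..S}|lborel. kA j (y + \<mu> * \<sigma>) (y - lam j * \<sigma>) * w j (y - lam j * \<sigma>) (tt (y + \<mu> * \<sigma>))
          - K j (y + \<mu> * \<sigma>) (y - lam j * \<sigma>) * src w w' j (y - lam j * \<sigma>) (tt (y + \<mu> * \<sigma>)))"
        by simp
    qed
  qed
qed (use L in simp)

text \<open>Parallel to the diagonal, the position \<open>\<xi>\<close> grows with speed
  \<open>\<mu>\<close> as time runs backwards, so \<open>w'\<close> is followed along its own
  characteristic.\<close>

lemma divergence_K':
  "(LINT x:{0..L}|lborel. LINT \<xi>:{0..x}|lborel. kB x \<xi> * w' \<xi> (tt x) - K' x \<xi> * src' w \<xi> (tt x))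
   = \<mu> * (LINT \<xi>:{0..L}|lborel. K' L \<xi> * w' \<xi> (tt L)) - \<mu> * (LINT x:{0..L}|lborel. K' x 0 * w' 0 (tt x))"
proof (rule divergence_parallel[OF mu])
  show "bm2 (triangle L) (\<lambda>x \<xi>. K' x \<xi> * w' \<xi> (tt x))"
    by (intro bm2_mult K' tt_bm w')
  show "bm2 (triangle L) (\<lambda>x \<xi>. kB x \<xi> * w' \<xi> (tt x) - K' x \<xi> * src' w \<xi> (tt x))"
    by (intro bm2_diff bm2_mult kB_bm K' tt_bm strip_bm_src' w w')
  have "- (1 / \<mu>) \<noteq> 0" using mu by simp
  from AE_affine[OF this w'_sol[unfolded char_sol_def], of \<tau>]
  show "AE y in lborel. y \<in> {0..L} \<longrightarrow> (\<forall>s\<ge>0. y + \<mu> * s \<le> L \<longrightarrow>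
      K' (y + \<mu> * s) (\<mu> * s) * w' (\<mu> * s) (tt (y + \<mu> * s)) = K' y 0 * w' 0 (tt y)
      + (LINT \<sigma>:{0..s}|lborel. kB (y + \<mu> * \<sigma>) (\<mu> * \<sigma>) * w' (\<mu> * \<sigma>) (tt (y + \<mu> * \<sigma>))
          - K' (y + \<mu> * \<sigma>) (\<mu> * \<sigma>) * src' w (\<mu> * \<sigma>) (tt (y + \<mu> * \<sigma>))))"
  proof eventually_elim
    case (elim y)
    show ?case
    proof (intro impI allI)
      fix S assume y: "y \<in> {0..L}" and S: "0 \<le> S" "y + \<mu> * S \<le> L"
      have inside: "0 \<le> \<mu> * s" "y + \<mu> * s \<le> L" if "0 \<le> s" "s \<le> S" for s
      proof -
        have "\<mu> * s \<le> \<mu> * S" using that mu by (auto intro: mult_left_mono)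
        then show "y + \<mu> * s \<le> L" using S by linarith
        show "0 \<le> \<mu> * s" using that mu by simp
      qed
      have line: "tt (y + \<mu> * s) = (\<tau> + - (1 / \<mu>) * y) + - (1 / \<mu>) * (\<mu> * s)" for s
        using mu by (simp add: tt_def field_simps)
      have comp: "bm_on {0..S} (\<lambda>s. k (y + \<mu> * s) (\<mu> * s))" if "bm2 (triangle L) k" for k
        by (rule bm_on_compose_Pair[OF that])
           (use inside y in \<open>auto intro!: continuous_intros simp: triangle_def\<close>)
      have "K' (y + \<mu> * S) (\<mu> * S) * w' (\<mu> * S) (tt (y + \<mu> * S))
          = K' (y + \<mu> * 0) (\<mu> * 0) * w' (\<mu> * 0) (tt (y + \<mu> * 0))
          + (LINT \<sigma>:{0..S}|lborel. kB (y + \<mu> * \<sigma>) (\<mu> * \<sigma>) * w' (\<mu> * \<sigma>) (tt (y + \<mu> * \<sigma>))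
          + K' (y + \<mu> * \<sigma>) (\<mu> * \<sigma>) * - src' w (\<mu> * \<sigma>) (tt (y + \<mu> * \<sigma>)))"
      proof (rule LINT_product_rule[where u="\<lambda>s. K' (y + \<mu> * s) (\<mu> * s)"
            and v="\<lambda>s. w' (\<mu> * s) (tt (y + \<mu> * s))"])
        show "bm_on {0..S} (\<lambda>\<sigma>. kB (y + \<mu> * \<sigma>) (\<mu> * \<sigma>))" by (rule comp[OF kB_bm])
        show "bm_on {0..S} (\<lambda>\<sigma>. - src' w (\<mu> * \<sigma>) (tt (y + \<mu> * \<sigma>)))"
          by (intro bm_on_uminus comp[OF tt_bm] strip_bm_src' w)
        fix s assume s: "0 \<le> s" "s \<le> S"
        show "K' (y + \<mu> * s) (\<mu> * s) = K' (y + \<mu> * 0) (\<mu> * 0)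
            + (LINT \<sigma>:{0..s}|lborel. kB (y + \<mu> * \<sigma>) (\<mu> * \<sigma>))"
          using K'_char[of y s] inside[OF s] y s by (simp add: kB_def)
        have "w' (\<mu> * s) (tt (y + \<mu> * s)) = w' 0 (tt (y + \<mu> * 0))
            + - (1 / \<mu>) * (LINT x:{0..\<mu> * s}|lborel. src' w x ((\<tau> + - (1 / \<mu>) * y) + - (1 / \<mu>) * x))"
          using elim[rule_format, of 0 "\<mu> * s"] tt_range[of y] tt_range[of "y + \<mu> * s"] inside[OF s] y
            line[of s] line[of 0] by simp
        also have "(LINT x:{0..\<mu> * s}|lborel. src' w x ((\<tau> + - (1 / \<mu>) * y) + - (1 / \<mu>) * x))
            = \<mu> * (LINT \<sigma>:{0..s}|lborel. src' w (\<mu> * \<sigma>) (tt (y + \<mu> * \<sigma>)))"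
          unfolding line
          using LINT_interval_affine[OF mu, of 0 0 s "\<lambda>x. src' w x ((\<tau> + - (1 / \<mu>) * y) + - (1 / \<mu>) * x)"] by simp
        finally show "w' (\<mu> * s) (tt (y + \<mu> * s)) = w' (\<mu> * 0) (tt (y + \<mu> * 0))
            + (LINT \<sigma>:{0..s}|lborel. - src' w (\<mu> * \<sigma>) (tt (y + \<mu> * \<sigma>)))"
          using mu by (simp add: LINT_neg)
      qed (rule S)
      then show "K' (y + \<mu> * S) (\<mu> * S) * w' (\<mu> * S) (tt (y + \<mu> * S)) = K' y 0 * w' 0 (tt y)
        + (LINT \<sigma>:{0..S}|lborel. kB (y + \<mu> * \<sigma>) (\<mu> * \<sigma>) * w' (\<mu> * \<sigma>) (tt (y + \<mu> * \<sigma>))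
          - K' (y + \<mu> * \<sigma>) (\<mu> * \<sigma>) * src' w (\<mu> * \<sigma>) (tt (y + \<mu> * \<sigma>)))"
        by simp
    qed
  qed
qed (use L in simp)

text \<open>Sum of all the divergence identities. Interior terms cancel by adjointness, the bottom
  terms cancel by \<open>K'_0\<close> and the inflow condition, and the diagonal terms add up to the
  source of \<open>w'\<close> along its arriving characteristic.\<close>

lemma kernel_identity:
  "\<mu> * ((\<Sum>j\<in>UNIV. LINT \<xi>:{0..L}|lborel. K j L \<xi> * w j \<xi> (tt L)) + (LINT \<xi>:{0..L}|lborel. K' L \<xi> * w' \<xi> (tt L)))
   + (LINT x:{0..L}|lborel. src' w x (tt x)) = 0"
proof -
  have m: "bm_on {0..L} (\<lambda>x. u x (tt x))" if "strip_bm u" for u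
    using bm2_diag[OF tt_bm[OF that]] .
  have m0: "bm_on {0..L} (\<lambda>x. u 0 (tt x))" if "strip_bm u" for u
    using bm2_bottom[OF tt_bm[OF that]] .
  let ?I = "\<lambda>j. LINT x:{0..L}|lborel. LINT \<xi>:{0..x}|lborel. kA j x \<xi> * w j \<xi> (tt x) - K j x \<xi> * src w w' j \<xi> (tt x)"
  let ?I' = "LINT x:{0..L}|lborel. LINT \<xi>:{0..x}|lborel. kB x \<xi> * w' \<xi> (tt x) - K' x \<xi> * src' w \<xi> (tt x)"
  \<comment> \<open>Adjointness in pointwise form; the only manipulation beyond distributivity is
    the exchange of the double sum with \<open>A\<close>.\<close>
  have cancel: "(\<Sum>j\<in>UNIV. kA j x \<xi> * w j \<xi> t - K j x \<xi> * src w w' j \<xi> t) + (kB x \<xi> * w' \<xi> t - K' x \<xi> * src' w \<xi> t) = 0"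
    for x \<xi> t
  proof -
    have "(\<Sum>j\<in>UNIV. \<Sum>i\<in>UNIV. K i x \<xi> * A \<xi> i j * w j \<xi> t) = (\<Sum>i\<in>UNIV. \<Sum>j\<in>UNIV. K i x \<xi> * A \<xi> i j * w j \<xi> t)"
      by (rule sum.swap)
    then show ?thesis
      by (simp add: kA_def kB_def src_def src'_def sum_subtractf sum.distrib distrib_left distrib_right
          sum_distrib_left sum_distrib_right mult.assoc)
  qed
  have "(\<Sum>j\<in>UNIV. ?I j) + ?I' = (LINT x:{0..L}|lborel. LINT \<xi>:{0..x}|lborel.
      (\<Sum>j\<in>UNIV. kA j x \<xi> * w j \<xi> (tt x) - K j x \<xi> * src w w' j \<xi> (tt x))
      + (kB x \<xi> * w' \<xi> (tt x) - K' x \<xi> * src' w \<xi> (tt x)))"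
    by (rule nested_LINT_sum) (intro bm2_diff bm2_mult kA_bm kB_bm K K' tt_bm strip_bm_src strip_bm_src' w w')+
  also have "\<dots> = 0" by (simp add: cancel)
  finally have zero: "(\<Sum>j\<in>UNIV. ?I j) + ?I' = 0" .
  have inflow: "lam j * (LINT x:{0..L}|lborel. K j x 0 * w j 0 (tt x))
      = (LINT x:{0..L}|lborel. lam j * K j x 0 * Q j * w' 0 (tt x))" for j
  proof -
    have "(LINT x:{0..L}|lborel. K j x 0 * w j 0 (tt x)) = (LINT x:{0..L}|lborel. K j x 0 * (Q j * w' 0 (tt x)))"
    proof (rule LINT_cong_AE)
      have "AE x in lborel. 0 < \<tau> + - (1 / \<mu>) * x \<longrightarrow> w j 0 (\<tau> + - (1 / \<mu>) * x) = Q j * w' 0 (\<tau> + - (1 / \<mu>) * x)"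
        by (rule AE_affine[OF _ w_0]) (use mu in simp)
      then show "AE x in lborel. x \<in> {0..L} \<longrightarrow> K j x 0 * w j 0 (tt x) = K j x 0 * (Q j * w' 0 (tt x))"
      proof eventually_elim
        case (elim x)
        show ?case
        proof
          assume "x \<in> {0..L}"
          then have "0 < tt x" using tt_range[of x] T0 by simp
          then show "K j x 0 * w j 0 (tt x) = K j x 0 * (Q j * w' 0 (tt x))" using elim by (simp add: tt_def)
        qed
      qed
    qed (intro bm_on_interval_integrable bm_on_mult bm_on_const bm2_bottom K m0 w w')+
    then show ?thesis by (simp add: set_integral_mult_right[symmetric] mult.assoc del: set_integral_mult_right)
  qed
  have "(\<Sum>j\<in>UNIV. lam j * (LINT x:{0..L}|lborel. K j x 0 * w j 0 (tt x)))
      = (LINT x:{0..L}|lborel. \<Sum>j\<in>UNIV. lam j * K j x 0 * Q j * w' 0 (tt x))"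
    unfolding inflow
    by (rule LINT_bm_sum[symmetric]) (intro bm_on_mult bm_on_const bm2_bottom K m0 w')
  also have "\<dots> = (LINT x:{0..L}|lborel. \<mu> * (K' x 0 * w' 0 (tt x)))"
    by (rule set_lebesgue_integral_cong) (auto simp: sum_distrib_right[symmetric] K'_0[symmetric])
  finally have b0: "(\<Sum>j\<in>UNIV. lam j * (LINT x:{0..L}|lborel. K j x 0 * w j 0 (tt x)))
      = \<mu> * (LINT x:{0..L}|lborel. K' x 0 * w' 0 (tt x))" by simp
  have "(\<Sum>j\<in>UNIV. (\<mu> + lam j) * (LINT x:{0..L}|lborel. K j x x * w j x (tt x)))
      = (\<Sum>j\<in>UNIV. LINT x:{0..L}|lborel. - (C x j * w j x (tt x)))"
  proof (rule sum.cong)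
    fix j
    have "(\<mu> + lam j) * (LINT x:{0..L}|lborel. K j x x * w j x (tt x))
        = (LINT x:{0..L}|lborel. (\<mu> + lam j) * (K j x x * w j x (tt x)))" by simp
    also have "\<dots> = (LINT x:{0..L}|lborel. - (C x j * w j x (tt x)))"
      by (rule set_lebesgue_integral_cong) (auto simp: K_diag mult.assoc[symmetric])
    finally show "(\<mu> + lam j) * (LINT x:{0..L}|lborel. K j x x * w j x (tt x))
        = (LINT x:{0..L}|lborel. - (C x j * w j x (tt x)))" .
  qed simp
  also have "\<dots> = - (LINT x:{0..L}|lborel. src' w x (tt x))"
    unfolding src'_def LINT_neg sum_negf
    by (subst LINT_bm_sum) (intro bm_on_mult C m w, simp)
  finally have bd: "(\<Sum>j\<in>UNIV. (\<mu> + lam j) * (LINT x:{0..L}|lborel. K j x x * w j x (tt x)))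
      = - (LINT x:{0..L}|lborel. src' w x (tt x))" .
  show ?thesis
    using zero b0 bd unfolding divergence_K divergence_K'
    by (simp add: sum.distrib sum_subtractf sum_distrib_left[symmetric] distrib_left)
qed

end

text \<open>The source collected by \<open>w'\<close> on its way from \<open>x = L\<close> to
  \<open>x = 0\<close> is, by \<open>kernel_identity\<close>, exactly what the feedback had
  subtracted in advance.\<close>

lemma outflow_vanish: "AE t in lborel. T0 + L / \<mu> < t \<longrightarrow> w' 0 t = 0"
proof -
  have "AE t in lborel. T0 < - (L / \<mu>) + 1 * t \<longrightarrow> w' L (- (L / \<mu>) + 1 * t) =
      (\<Sum>i\<in>UNIV. LINT \<xi>:{0..L}|lborel. K i L \<xi> * w i \<xi> (- (L / \<mu>) + 1 * t))
      + (LINT \<xi>:{0..L}|lborel. K' L \<xi> * w' \<xi> (- (L / \<mu>) + 1 * t))"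
    by (rule AE_affine[OF _ w'_L]) simp
  then show ?thesis using w'_sol[unfolded char_sol_def]
  proof eventually_elim
    case (elim \<tau>)
    show ?case
    proof
      assume "T0 + L / \<mu> < \<tau>"
      then have \<tau>: "T0 < \<tau> - L / \<mu>" by simp
      have ttL: "- (L / \<mu>) + 1 * \<tau> = tt \<tau> L" by (simp add: tt_def[OF \<tau>])
      have "\<mu> * w' L (tt \<tau> L) + (LINT x:{0..L}|lborel. src' w x (tt \<tau> x)) = 0"
        using kernel_identity[OF \<tau>] elim(1) tt_range[OF \<tau>, of L] L unfolding ttL by simp
      moreover have "w' L (tt \<tau> L) = w' 0 \<tau> - 1 / \<mu> * (LINT x:{0..L}|lborel. src' w x (tt \<tau> x))"
        using elim(2)[rule_format, of 0 L] tt_range[OF \<tau>, of L] tt_range[OF \<tau>, of 0] L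
        by (simp add: tt_def[OF \<tau>])
      ultimately have "\<mu> * w' 0 \<tau> = 0" using mu by (simp add: field_simps)
      then show "w' 0 \<tau> = 0" using mu by simp
    qed
  qed
qed

theorem state_vanishes:
  "AE \<tau> in lborel. \<forall>x\<in>{0..L}. T0 + L / \<mu> + 1 / v * x < \<tau> + 1 / lam i * x \<longrightarrow> w i x (\<tau> + 1 / lam i * x) = 0"
  "AE \<tau> in lborel. \<forall>x\<in>{0..L}. T0 + L / \<mu> + 1 / v * x < \<tau> + - (1 / \<mu>) * x \<longrightarrow> w' x (\<tau> + - (1 / \<mu>) * x) = 0"
proof -
  \<comment> \<open>From \<open>T0 + L / \<mu>\<close> on, \<open>w'\<close> is zero at
    \<open>x = 0\<close>, and then so are the reflected inflows \<open>Q i * w' 0 t\<close>; this is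
    the starting time for \<open>vanish_from_zero_inflow\<close>.\<close>
  have T1: "0 \<le> T0 + L / \<mu>" using T0 L mu by simp
  have eq: "AE \<tau> in lborel. \<forall>x\<in>{0..L}. T0 + L / \<mu> + 1 / v * x < \<tau> + 1 / lam i * x \<longrightarrow>
      w i x (\<tau> + 1 / lam i * x) = 1 / lam i * (LINT y:{0..x}|lborel. src w w' i y (\<tau> + 1 / lam i * y))" for i
    using char_sol_from_inflow[OF w_sol[of i] w_0[of i]] outflow_vanish
  proof eventually_elim
    case (elim \<tau>)
    show ?case
    proof (intro ballI impI)
      fix x assume x: "x \<in> {0..L}" and "T0 + L / \<mu> + 1 / v * x < \<tau> + 1 / lam i * x"
      then have "T0 + L / \<mu> < \<tau>" using entry_time_pos[OF _ T1] by auto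
      then show "w i x (\<tau> + 1 / lam i * x) = 1 / lam i * (LINT y:{0..x}|lborel. src w w' i y (\<tau> + 1 / lam i * y))"
        using elim x T1 by simp
    qed
  qed
  have eq': "AE \<tau> in lborel. \<forall>x\<in>{0..L}. T0 + L / \<mu> + 1 / v * x < \<tau> + - (1 / \<mu>) * x \<longrightarrow>
      w' x (\<tau> + - (1 / \<mu>) * x) = - (1 / \<mu>) * (LINT y:{0..x}|lborel. src' w y (\<tau> + - (1 / \<mu>) * y))"
    using w'_sol[unfolded char_sol_def] outflow_vanish
  proof eventually_elim
    case (elim \<tau>)
    show ?case
    proof (intro ballI impI)
      fix x assume x: "x \<in> {0..L}" and *: "T0 + L / \<mu> + 1 / v * x < \<tau> + - (1 / \<mu>) * x"
      have p: "0 \<le> 1 / v * x" "0 \<le> 1 / \<mu> * x" using x v mu by auto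
      have t: "T0 + L / \<mu> < \<tau>" "0 \<le> \<tau> + - (1 / \<mu>) * x" "0 \<le> \<tau> + - (1 / \<mu>) * 0"
        using * p T1 by auto
      then show "w' x (\<tau> + - (1 / \<mu>) * x) = - (1 / \<mu>) * (LINT y:{0..x}|lborel. src' w y (\<tau> + - (1 / \<mu>) * y))"
        using elim(1)[rule_format, of 0 x] elim(2) x by simp
    qed
  qed
  show "AE \<tau> in lborel. \<forall>x\<in>{0..L}. T0 + L / \<mu> + 1 / v * x < \<tau> + 1 / lam i * x \<longrightarrow> w i x (\<tau> + 1 / lam i * x) = 0"
    "AE \<tau> in lborel. \<forall>x\<in>{0..L}. T0 + L / \<mu> + 1 / v * x < \<tau> + - (1 / \<mu>) * x \<longrightarrow> w' x (\<tau> + - (1 / \<mu>) * x) = 0"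
    by (rule vanish_from_zero_inflow[OF T1 w w' eq eq'])+
qed

end

section \<open>Linear algebra\<close>

lemma matrix_inv_invertible:
  fixes A :: "real^'n^'n"
  assumes "invertible A" shows "A ** matrix_inv A = mat 1" "matrix_inv A ** A = mat 1"
  using someI_ex[OF assms[unfolded invertible_def]] unfolding matrix_inv_def by auto

lemma vector_4 [simp]:
  "(vector [x, y, z, w] :: 'a::zero^4) $ 1 = x" "(vector [x, y, z, w] :: 'a^4) $ 2 = y"
  "(vector [x, y, z, w] :: 'a^4) $ 3 = z" "(vector [x, y, z, w] :: 'a^4) $ 4 = w"
  unfolding vector_def by simp_all

lemma matrix_mul_minus: "(A :: real^'n^'m) ** (- B) = - (A ** B)"
  by (simp add: vec_eq_iff matrix_matrix_mult_def sum_negf)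

section \<open>Rows, inner products, and components as bounded Borel functions\<close>

lemma row_vector_matrix_mult: "M $ i v* N = (M ** N) $ i"
  by (simp add: vec_eq_iff vector_matrix_mult_def matrix_matrix_mult_def)

lemma inner_3: "(a::real^3) \<bullet> b = a$1 * b$1 + a$2 * b$2 + a$3 * b$3"
  by (simp add: inner_vec_def sum_3)

lemma Linf_loc_strip_inner:
  fixes u :: "real \<Rightarrow> real \<Rightarrow> 'a::euclidean_space"
  assumes "Linf_loc_strip L u" shows "bm2 ({0..L} \<times> {0..T}) (\<lambda>x t. a \<bullet> u x t)"
proof -
  have m: "(\<lambda>(x, t). u x t) \<in> borel_measurable (restrict_space borel ({0..L} \<times> {0..T}))"
    by (rule measurable_restrict_mono[of _ _ "{0..L} \<times> {0..}"]) (use assms in \<open>auto simp: Linf_loc_strip_def\<close>)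
  obtain B where B: "\<forall>x\<in>{0..L}. \<forall>t\<in>{0..T}. norm (u x t) \<le> B"
    using assms unfolding Linf_loc_strip_def by blast
  show ?thesis
  proof (rule bm_onI)
    show "(\<lambda>(x, t). a \<bullet> u x t) \<in> borel_measurable (restrict_space borel ({0..L} \<times> {0..T}))"
      using borel_measurable_inner[OF borel_measurable_const m, of a] by (simp add: split_beta')
    fix p assume "p \<in> {0..L} \<times> {0..T}"
    then have "norm (u (fst p) (snd p)) \<le> B" using B by auto
    then have "norm a * norm (u (fst p) (snd p)) \<le> norm a * B" by (intro mult_left_mono) auto
    then show "\<bar>case p of (x, t) \<Rightarrow> a \<bullet> u x t\<bar> \<le> norm a * B"
      using Cauchy_Schwarz_ineq2[of a "u (fst p) (snd p)"] by (simp add: split_beta')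
  qed
qed

lemma Linf_loc_strip_component:
  fixes u :: "real \<Rightarrow> real \<Rightarrow> real^'n"
  assumes "Linf_loc_strip L u" shows "bm2 ({0..L} \<times> {0..T}) (\<lambda>x t. u x t $ i)"
  using Linf_loc_strip_inner[OF assms, of T "axis i 1"] by (simp add: inner_axis')

lemma Linf_loc_strip_real:
  fixes u :: "real \<Rightarrow> real \<Rightarrow> real"
  assumes "Linf_loc_strip L u" shows "bm2 ({0..L} \<times> {0..T}) u"
  using Linf_loc_strip_inner[OF assms, of T 1] by simp

lemma Linf_triangle_component:
  assumes "Linf_triangle L k" shows "bm2 (triangle L) (\<lambda>x \<xi>. k x \<xi> $ i)"
proof -
  have m: "(\<lambda>(x, \<xi>). k x \<xi>) \<in> borel_measurable (restrict_space borel (triangle L))"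
    using assms by (simp add: Linf_triangle_def)
  obtain B where B: "\<forall>(x, \<xi>)\<in>triangle L. norm (k x \<xi>) \<le> B"
    using assms unfolding Linf_triangle_def by blast
  show ?thesis
  proof (rule bm_onI)
    show "(\<lambda>(x, \<xi>). k x \<xi> $ i) \<in> borel_measurable (restrict_space borel (triangle L))"
      using borel_measurable_inner[OF borel_measurable_const m, of "axis i 1"]
      by (simp add: split_beta' inner_axis')
    fix p assume "p \<in> triangle L"
    then show "\<bar>case p of (x, \<xi>) \<Rightarrow> k x \<xi> $ i\<bar> \<le> B"
      using B component_le_norm_cart[of "k (fst p) (snd p)" i] by (auto simp: split_beta')
  qed
qed

section \<open>Characteristic coordinates of the linearized system\<close>

text \<open>The control design coordinates 1, 2, 3 are the characteristic coordinates 2, 3, 1.\<close>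

definition perm :: "3 \<Rightarrow> 4" where
  "perm i = (if i = 1 then 2 else if i = 2 then 3 else 1)"

lemma perm_simps [simp]: "perm 1 = 2" "perm 2 = 3" "perm 3 = 1"
  by (simp_all add: perm_def)

lemma perm_cases: "k = 4 \<or> (\<exists>i. k = perm i)"
  using exhaust_4[of k] perm_simps by metis

lemma Sig_pp_component: "Sig_pp P V x $ i $ j = (if i = j then 0 else coef P V (perm i) (perm j) x)"
  using exhaust_3[of i] exhaust_3[of j] by (elim disjE) (simp_all add: Sig_pp_def)

lemma Sig_pm_component: "Sig_pm P V x $ i = coef P V (perm i) 4 x"
  using exhaust_3[of i] by (elim disjE) (simp_all add: Sig_pm_def)

lemma Sig_mp_component: "Sig_mp P V x $ i = coef P V 4 (perm i) x"
  using exhaust_3[of i] by (elim disjE) (simp_all add: Sig_mp_def)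

lemma Lam_p_component: "Lam_p P $ i $ j = (if i = j then lam P $ perm i else 0)"
  using exhaust_3[of i] by (elim disjE) (simp_all add: Lam_p_def diag_mat_def lam_def)

lemma alpha_2_pos:
  assumes "valid_params P" shows "0 < alpha P 2"
proof -
  define c where "c = (area P 1 * rhoeq P 1 + area P 2 * rhoeq P 2) / width P / occmax P 2"
  have pos: "0 < width P" "0 < area P i" "0 < vmax P i" "0 < expo P i" "0 < occmax P i" "0 < rhoeq P i" for i
    using assms unfolding valid_params_def by (auto intro: less_trans[of 0 1])
  have c: "0 < c" unfolding c_def using pos by (intro divide_pos_pos add_pos_pos mult_pos_pos) auto
  have "((\<lambda>r. (area P 1 * rhoeq P 1 + area P 2 * r) / width P / occmax P 2)
      has_real_derivative area P 2 / width P / occmax P 2) (at (rhoeq P 2))"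
    using pos(1) pos(5)[of 2] by (auto intro!: derivative_eq_intros)
  from DERIV_cmult[OF DERIV_chain2[OF has_real_derivative_powr[OF c[unfolded c_def]] this]]
  have "((\<lambda>r. vmax P 2 * ((area P 1 * rhoeq P 1 + area P 2 * r) / width P / occmax P 2) powr expo P 2)
      has_real_derivative vmax P 2 * (expo P 2 * c powr (expo P 2 - 1) * (area P 2 / width P / occmax P 2))) (at (rhoeq P 2))"
    unfolding c_def .
  moreover have "(\<lambda>r. pressure P 2 (AO P ((rhoeq P)(2 := r))))
      = (\<lambda>r. vmax P 2 * ((area P 1 * rhoeq P 1 + area P 2 * r) / width P / occmax P 2) powr expo P 2)"
    by (simp add: pressure_def AO_def)
  ultimately have "alpha P 2 = vmax P 2 * (expo P 2 * c powr (expo P 2 - 1) * (area P 2 / width P / occmax P 2))"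
    unfolding alpha_def beta_def by (simp add: DERIV_imp_deriv)
  also have "\<dots> > 0" using pos c by (intro mult_pos_pos divide_pos_pos) auto
  finally show ?thesis .
qed

locale congested_ar =
  fixes P :: ar_params and V :: "real^4^4"
  assumes valid: "valid_params P" and congested: "congested P" and diag: "diagonalizes P V"
begin

lemma lam_signs: "0 < lam P $ 1" "0 < lam P $ 2" "0 < lam P $ 3" "lam P $ 4 < 0" "lam P $ 2 = veq P 2" "lam P $ 1 = veq P 1"
  using congested by (auto simp: congested_def lam_def)

lemma len_pos: "0 < len P"
  using valid by (simp add: valid_params_def)

text \<open>Only \<open>lam P $ 3\<close> needs an argument: the claim is
  \<open>a + b - d \<le> Delta P\<close>, and the difference of the squares is
  \<open>4 * d * b\<close>. It is nonnegative because class 1 is faster and the pressure of class 2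
  increases with its own density.\<close>

lemma veq_le: "veq P 2 \<le> lam P $ perm i"
proof -
  have "veq P 2 \<le> lam P $ 3"
  proof -
    define b where "b = alpha P 2 * rhoeq P 2"
    define a where "a = alpha P 1 * rhoeq P 1"
    define d where "d = veq P 1 - veq P 2"
    have "0 < rhoeq P 2" using valid by (simp add: valid_params_def)
    then have "0 \<le> b" unfolding b_def using alpha_2_pos[OF valid] by (intro mult_nonneg_nonneg) auto
    moreover have "0 \<le> d" using congested by (simp add: d_def congested_def)
    ultimately have "0 \<le> 4 * (d * b)" by simp
    then have "(a + b - d)\<^sup>2 \<le> (b - a + d)\<^sup>2 + 4 * (a * b)"
      by (simp add: power2_eq_square algebra_simps)
    then have "\<bar>a + b - d\<bar> \<le> sqrt ((b - a + d)\<^sup>2 + 4 * (a * b))"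
      by (metis real_sqrt_abs real_sqrt_le_mono)
    moreover have "Delta P = sqrt ((b - a + d)\<^sup>2 + 4 * (a * b))"
      by (simp add: Delta_def a_def b_def d_def algebra_simps)
    ultimately have "a + b - d \<le> Delta P" by linarith
    then show ?thesis by (simp add: lam_def a_def b_def d_def)
  qed
  moreover have "veq P 2 \<le> lam P $ 1" "veq P 2 \<le> lam P $ 2"
    using congested by (simp_all add: lam_def congested_def)
  ultimately show ?thesis using exhaust_3[of i] by auto
qed

lemma V_inverse: "V ** matrix_inv V = mat 1" "matrix_inv V ** V = mat 1"
  using diag by (auto simp: diagonalizes_def matrix_inv_invertible)

lemma Jt_inverse: "matrix_inv (Jt P) ** Jt P = mat 1"
proof -
  \<comment> \<open>\<open>Jt P\<close> is the identity plus a matrix whose square is zero, so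
    flipping the signs of the \<open>beta\<close> entries inverts it.\<close>
  define I :: "real^4^4" where "I = vector
    [vector [1, 0, 0, 0],
     vector [- beta P 1 1, 1, - beta P 1 2, 0],
     vector [0, 0, 1, 0],
     vector [- beta P 2 1, 0, - beta P 2 2, 1]]"
  have "Jt P ** I = mat 1"
    by (simp add: vec_eq_iff forall_4 matrix_matrix_mult_def sum_4 Jt_def I_def mat_def)
  moreover from this have "I ** Jt P = mat 1" by (simp add: matrix_left_right_inverse)
  ultimately have "invertible (Jt P)" unfolding invertible_def by blast
  then show ?thesis by (rule matrix_inv_invertible)
qed

text \<open>These rows are left eigenvectors of the pencil formed by \<open>Jx P\<close> and
  \<open>Jt P\<close>, the test vectors over which \<open>system_solution\<close> quantifies. They
  turn the vector equation into scalar transport equations for the coordinates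
  \<open>matrix_inv V *v z\<close>.\<close>

lemma left_eigenvector:
  fixes k :: 4
  defines "l \<equiv> (matrix_inv V ** matrix_inv (Jt P)) $ k"
  shows "l v* Jx P = lam P $ k *\<^sub>R (l v* Jt P)" and "l v* Jt P = matrix_inv V $ k"
    and "l \<bullet> - (Jsrc P *v z) = (J_hat P V *v (matrix_inv V *v z)) $ k"
proof -
  have "matrix_inv V ** Jx_tilde P = matrix_inv V ** Jx_tilde P ** (V ** matrix_inv V)"
    by (simp add: V_inverse)
  also have "\<dots> = diag_mat (lam P) ** matrix_inv V"
    using diag by (simp add: diagonalizes_def matrix_mul_assoc)
  finally have "matrix_inv V ** matrix_inv (Jt P) ** Jx P = diag_mat (lam P) ** matrix_inv V"
    by (simp add: Jx_tilde_def matrix_mul_assoc)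
  moreover have "(diag_mat (lam P) ** matrix_inv V) $ k = lam P $ k *\<^sub>R matrix_inv V $ k"
    by (simp add: vec_eq_iff matrix_matrix_mult_def diag_mat_def if_distrib[where f="\<lambda>x. x * _"] cong: if_cong)
  moreover show "l v* Jt P = matrix_inv V $ k"
    unfolding l_def row_vector_matrix_mult by (simp add: matrix_mul_assoc[symmetric] Jt_inverse)
  ultimately show "l v* Jx P = lam P $ k *\<^sub>R (l v* Jt P)"
    unfolding l_def row_vector_matrix_mult by simp
  have "J_hat P V ** matrix_inv V = matrix_inv V ** J_tilde P"
    by (simp add: J_hat_def matrix_mul_assoc[symmetric] V_inverse)
  also have "\<dots> = - (matrix_inv V ** matrix_inv (Jt P) ** Jsrc P)"
    by (simp add: J_tilde_def matrix_mul_assoc matrix_mul_minus)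
  finally have "(J_hat P V *v (matrix_inv V *v z)) $ k = (- (matrix_inv V ** matrix_inv (Jt P) ** Jsrc P) *v z) $ k"
    by (simp add: matrix_vector_mul_assoc)
  also have "\<dots> = - (((matrix_inv V ** matrix_inv (Jt P) ** Jsrc P) $ k) \<bullet> z)"
    by (simp add: matrix_vector_mul_component)
  also have "(matrix_inv V ** matrix_inv (Jt P) ** Jsrc P) $ k = l v* Jsrc P"
    unfolding l_def row_vector_matrix_mult ..
  also have "- ((l v* Jsrc P) \<bullet> z) = l \<bullet> - (Jsrc P *v z)" by (simp add: dot_lmul_matrix)
  finally show "l \<bullet> - (Jsrc P *v z) = (J_hat P V *v (matrix_inv V *v z)) $ k" by simp
qed

text \<open>Characteristic coordinates with the exponential scaling but in the order of the
  eigenvalues; \<open>T_inv\<close> merely permutes them by \<open>perm\<close>.\<close>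

definition W :: "(real \<Rightarrow> real \<Rightarrow> real^4) \<Rightarrow> 4 \<Rightarrow> real \<Rightarrow> real \<Rightarrow> real" where
  "W z k x t = exp (- theta P V k * x) * (matrix_inv V *v z x t) $ k"

lemma W_bm:
  assumes "Linf_loc_strip (len P) z" shows "bm2 ({0..len P} \<times> {0..T}) (W z k)"
proof -
  have "bm2 ({0..len P} \<times> {0..T}) (\<lambda>x t. exp (- theta P V k * x))"
    by (rule bm_on_continuous) (auto intro!: continuous_intros compact_Times simp: split_beta')
  moreover have "bm2 ({0..len P} \<times> {0..T}) (\<lambda>x t. (matrix_inv V *v z x t) $ k)"
    unfolding matrix_vector_mul_component by (rule Linf_loc_strip_inner[OF assms])
  ultimately have "bm2 ({0..len P} \<times> {0..T}) (\<lambda>x t. exp (- theta P V k * x) * (matrix_inv V *v z x t) $ k)"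
    by (rule bm2_mult)
  then show ?thesis unfolding W_def[abs_def] .
qed

lemma W_sol:
  assumes z: "Linf_loc_strip (len P) z"
    and sol: "system_solution (len P) (Jt P) (Jx P) (\<lambda>x t. - (Jsrc P *v z x t)) z"
  shows "char_sol (len P) (1 / lam P $ k)
    (\<lambda>x t. \<Sum>j\<in>UNIV. if j = k then 0 else coef P V k j x * W z j x t) (W z k)"
proof -
  define l where "l = (matrix_inv V ** matrix_inv (Jt P)) $ k"
  note ev = left_eigenvector[of k, folded l_def]
  have lam0: "lam P $ k \<noteq> 0" using lam_signs exhaust_4[of k] by auto
  have "transport_solution (len P) (lam P $ k) (\<lambda>x t. l \<bullet> - (Jsrc P *v z x t)) (\<lambda>x t. l \<bullet> (Jt P *v z x t))"
    using sol ev(1) unfolding system_solution_def by blast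
  then have tr: "transport_solution (len P) (lam P $ k) (\<lambda>x t. (J_hat P V *v (matrix_inv V *v z x t)) $ k)
      (\<lambda>x t. (matrix_inv V *v z x t) $ k)"
    unfolding dot_lmul_matrix[symmetric, of l "Jt P"] ev(2,3) matrix_vector_mul_component[symmetric] .
  have bm: "bm2 ({0..len P} \<times> {0..T}) (\<lambda>x t. (J_hat P V *v (matrix_inv V *v z x t)) $ k)" for T
    unfolding matrix_vector_mul_assoc matrix_vector_mul_component by (rule Linf_loc_strip_inner[OF z])
  have "char_sol (len P) (1 / lam P $ k) (\<lambda>x t. (J_hat P V *v (matrix_inv V *v z x t)) $ k)
      (\<lambda>x t. (matrix_inv V *v z x t) $ k)"
    by (rule transport_imp_char_sol[OF lam0 _ tr bm]) (use len_pos in simp)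
  from char_sol_rescale[OF _ this bm, of "theta P V k"] lam0
  have "char_sol (len P) (1 / lam P $ k)
    (\<lambda>x t. exp (- theta P V k * x) * ((J_hat P V *v (matrix_inv V *v z x t)) $ k
        - theta P V k / (1 / lam P $ k) * (matrix_inv V *v z x t) $ k))
    (\<lambda>x t. exp (- theta P V k * x) * (matrix_inv V *v z x t) $ k)" by simp
  then show ?thesis
  proof (rule char_sol_cong)
    fix x t
    define y where "y = matrix_inv V *v z x t"
    \<comment> \<open>\<open>theta\<close> is chosen for this: the term produced by the rescaling is
      the diagonal entry of \<open>J_hat\<close>.\<close>
    have "theta P V k / (1 / lam P $ k) * y $ k = J_hat P V $ k $ k * y $ k"
      using lam0 by (simp add: theta_def)
    also have "(J_hat P V *v y) $ k - \<dots> = (\<Sum>j\<in>UNIV. if j = k then 0 else J_hat P V $ k $ j * y $ j)"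
      using exhaust_4[of k] by (elim disjE) (simp_all add: matrix_vector_mult_def sum_4)
    finally have "exp (- theta P V k * x) * ((J_hat P V *v y) $ k - theta P V k / (1 / lam P $ k) * y $ k)
      = (\<Sum>j\<in>UNIV. exp (- theta P V k * x) * (if j = k then 0 else J_hat P V $ k $ j * y $ j))"
      by (simp add: sum_distrib_left)
    also have "\<dots> = (\<Sum>j\<in>UNIV. if j = k then 0 else coef P V k j x * W z j x t)"
      by (rule sum.cong) (auto simp: coef_def W_def y_def exp_diff exp_minus left_diff_distrib field_simps)
    finally show "exp (- theta P V k * x) * ((J_hat P V *v (matrix_inv V *v z x t)) $ k
        - theta P V k / (1 / lam P $ k) * (matrix_inv V *v z x t) $ k)
      = (\<Sum>j\<in>UNIV. if j = k then 0 else coef P V k j x * W z j x t)" by (simp only: y_def)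
  qed (simp add: W_def)
qed

lemma W_zero_imp:
  assumes "W z 4 x t = 0" "\<And>i. W z (perm i) x t = 0" shows "z x t = 0"
proof -
  have "(matrix_inv V *v z x t) $ k = 0" for k
    using perm_cases[of k] assms by (auto simp: W_def)
  then have "matrix_inv V *v z x t = 0" by (simp add: vec_eq_iff)
  then have "V *v (matrix_inv V *v z x t) = 0" by simp
  then show ?thesis by (simp add: matrix_vector_mul_assoc V_inverse)
qed

lemma T_inv_component:
  "(T_inv P V x *v z x t) $ 1 = W z 2 x t" "(T_inv P V x *v z x t) $ 2 = W z 3 x t"
  "(T_inv P V x *v z x t) $ 3 = W z 1 x t" "(T_inv P V x *v z x t) $ 4 = W z 4 x t"
  unfolding T_inv_def matrix_vector_mul_assoc[symmetric]
  by (simp_all add: matrix_vector_mult_def[of "vector _"] sum_4 W_def)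

lemma w4_meas_eq: "w4_meas P V z t = W z 4 0 t"
  unfolding w4_meas_def Tl_inv_def matrix_vector_mul_component[symmetric] by (rule T_inv_component)

lemma T_inv_T_mat: "T_inv P V x ** T_mat P V x = mat 1"
proof -
  define D E :: "real^4^4" where "D = vector
    [vector [0, exp (- theta P V 2 * x), 0, 0],
     vector [0, 0, exp (- theta P V 3 * x), 0],
     vector [exp (- theta P V 1 * x), 0, 0, 0],
     vector [0, 0, 0, exp (- theta P V 4 * x)]]" and "E = vector
    [vector [0, 0, exp (theta P V 1 * x), 0],
     vector [exp (theta P V 2 * x), 0, 0, 0],
     vector [0, exp (theta P V 3 * x), 0, 0],
     vector [0, 0, 0, exp (theta P V 4 * x)]]"
  have "T_inv P V x ** T_mat P V x = D ** (matrix_inv V ** V) ** E"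
    unfolding T_inv_def T_mat_def D_def E_def by (simp add: matrix_mul_assoc)
  also have "\<dots> = D ** E" by (simp add: V_inverse)
  also have "\<dots> = mat 1"
    by (simp add: vec_eq_iff forall_4 matrix_matrix_mult_def sum_4 D_def E_def mat_def exp_add[symmetric])
  finally show ?thesis .
qed

lemma z_estimate_coords:
  "Tu_inv P V x *v z_estimate P V w w4 x t = w x t" "Tl_inv P V x \<bullet> z_estimate P V w w4 x t = w4 x t"
proof -
  have T: "T_inv P V x *v z_estimate P V w w4 x t = vector [w x t $ 1, w x t $ 2, w x t $ 3, w4 x t]"
    unfolding z_estimate_def by (simp add: matrix_vector_mul_assoc T_inv_T_mat)
  show "Tl_inv P V x \<bullet> z_estimate P V w w4 x t = w4 x t"
    unfolding Tl_inv_def matrix_vector_mul_component[symmetric] T by simp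
  show "Tu_inv P V x *v z_estimate P V w w4 x t = w x t"
    unfolding vec_eq_iff forall_3 matrix_vector_mul_component
    by (simp add: Tu_inv_def matrix_vector_mul_component[symmetric] T)
qed

end

context congested_ar
begin

abbreviation \<mu> :: real where "\<mu> \<equiv> Lam_m P"

lemma coef_bm: "bm_on {0..len P} (coef P V i j)"
  unfolding coef_def[abs_def] by (intro bm_on_continuous continuous_intros) auto

sublocale hc: hyperbolic_coeffs "len P" \<mu> "veq P 2" "\<lambda>i. lam P $ perm i"
  "\<lambda>x i j. Sig_pp P V x $ i $ j" "\<lambda>x i. Sig_pm P V x $ i" "\<lambda>x i. Sig_mp P V x $ i"
proof
  show "0 < len P" by (rule len_pos)
  show "0 < \<mu>" using lam_signs by (simp add: Lam_m_def)
  show "0 < veq P 2" using lam_signs by simp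
  show "veq P 2 \<le> lam P $ perm i" for i by (rule veq_le)
  show "bm_on {0..len P} (\<lambda>x. Sig_pp P V x $ i $ j)" for i j
    by (cases "i = j") (auto simp: Sig_pp_component coef_bm)
  show "bm_on {0..len P} (\<lambda>x. Sig_pm P V x $ i)" "bm_on {0..len P} (\<lambda>x. Sig_mp P V x $ i)" for i
    by (simp_all add: Sig_pm_component Sig_mp_component coef_bm)
qed

lemma lam4: "lam P $ 4 = - \<mu>"
  by (simp add: Lam_m_def)

lemma t_F_eq: "t_F P = len P / veq P 2 + len P / \<mu>"
  by (simp add: t_F_def Lam_m_def)

lemma W_strip: "Linf_loc_strip (len P) z \<Longrightarrow> hc.strip_bm (W z k)"
  by (simp add: hc.strip_bm_def W_bm)

lemma W_plant:
  assumes "Linf_loc_strip (len P) z"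
    and "system_solution (len P) (Jt P) (Jx P) (\<lambda>x t. - (Jsrc P *v z x t)) z"
  shows "char_sol (len P) (1 / lam P $ perm i) (hc.src (\<lambda>j. W z (perm j)) (W z 4) i) (W z (perm i))"
    and "char_sol (len P) (- (1 / \<mu>)) (hc.src' (\<lambda>j. W z (perm j))) (W z 4)"
proof -
  show "char_sol (len P) (1 / lam P $ perm i) (hc.src (\<lambda>j. W z (perm j)) (W z 4) i) (W z (perm i))"
  proof (rule char_sol_cong[OF W_sol[OF assms]])
    fix x t
    show "(\<Sum>j\<in>UNIV. if j = perm i then 0 else coef P V (perm i) j x * W z j x t)
        = hc.src (\<lambda>j. W z (perm j)) (W z 4) i x t"
      unfolding hc.src_def unfolding Sig_pp_component Sig_pm_component sum_3 sum_4
      using exhaust_3[of i] by (elim disjE) simp_all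
  qed simp
  have "char_sol (len P) (1 / lam P $ 4) (hc.src' (\<lambda>j. W z (perm j))) (W z 4)"
  proof (rule char_sol_cong[OF W_sol[OF assms]])
    fix x t
    show "(\<Sum>j\<in>UNIV. if j = 4 then 0 else coef P V 4 j x * W z j x t) = hc.src' (\<lambda>j. W z (perm j)) x t"
      unfolding hc.src'_def unfolding Sig_mp_component sum_3 sum_4 by simp
  qed simp
  then show "char_sol (len P) (- (1 / \<mu>)) (hc.src' (\<lambda>j. W z (perm j))) (W z 4)" by (simp add: lam4)
qed

section \<open>Boundary conditions in the control design coordinates\<close>

lemma flux_pert_coords:
  "flux_pert P (V *v y) = kappa P V 1 * y$1 + kappa P V 2 * y$2 + kappa P V 3 * y$3 + kappa P V 4 * y$4"
  by (simp add: flux_pert_def kappa_def matrix_vector_mult_def sum_4 algebra_simps)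

lemma coords_inverse: "V *v (matrix_inv V *v a) = a"
  by (simp add: matrix_vector_mul_assoc V_inverse)

lemma inflow_W:
  assumes inv: "invertible (inflow_mat P V)"
    and bc: "z 0 t $ 1 = 0" "z 0 t $ 3 = 0" "flux_pert P (z 0 t) = 0"
  shows "W z (perm i) 0 t = Q0_bar P V $ i * W z 4 0 t"
proof -
  define y where "y = matrix_inv V *v z 0 t"
  have Vy: "V *v y = z 0 t" by (simp add: y_def coords_inverse)
  have W0: "W z k 0 t = y $ k" for k by (simp add: W_def y_def)
  define c :: "real^3" where "c = vector [V$1$4, V$3$4, kappa P V 4]"
  have "(V *v y) $ 1 = 0" "(V *v y) $ 3 = 0" using bc Vy by simp_all
  moreover have "kappa P V 1 * y$1 + kappa P V 2 * y$2 + kappa P V 3 * y$3 + kappa P V 4 * y$4 = 0"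
    using bc(3) unfolding Vy[symmetric] flux_pert_coords .
  ultimately have "inflow_mat P V *v vector [y$1, y$2, y$3] = (- (y$4)) *\<^sub>R c"
    by (simp add: vec_eq_iff forall_3 inflow_mat_def c_def matrix_vector_mult_def sum_3 sum_4 algebra_simps)
  \<comment> \<open>The three conditions at \<open>x = 0\<close> are linear in four coordinates;
    with the fourth moved to the right they determine the other three.\<close>
  then have "matrix_inv (inflow_mat P V) *v (inflow_mat P V *v vector [y$1, y$2, y$3])
      = (- (y$4)) *\<^sub>R (matrix_inv (inflow_mat P V) *v c)" by (simp only: matrix_vector_mult_scaleR)
  then have Q: "vector [y$1, y$2, y$3] = y$4 *\<^sub>R Q0_hat P V"
    by (simp add: matrix_vector_mul_assoc matrix_inv_invertible[OF inv] Q0_hat_def c_def)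
  \<comment> \<open>\<open>S\<close> is the permutation matrix in \<open>Q0_bar\<close>; its inverse
    reorders the coordinates 1, 2, 3 into 2, 3, 1.\<close>
  define S :: "real^3^3" where "S = vector [vector [0, 0, 1], vector [1, 0, 0], vector [0, 1, 0]]"
  define S' :: "real^3^3" where "S' = vector [vector [0, 1, 0], vector [0, 0, 1], vector [1, 0, 0]]"
  have "S ** S' = mat 1" "S' ** S = mat 1"
    by (simp_all add: S_def S'_def vec_eq_iff forall_3 matrix_matrix_mult_def sum_3 mat_def)
  then have S: "invertible S" unfolding invertible_def by blast
  have "S *v vector [y$2, y$3, y$1] = vector [y$1, y$2, y$3]"
    by (simp add: S_def vec_eq_iff forall_3 matrix_vector_mult_def sum_3)
  then have "matrix_inv S *v (S *v vector [y$2, y$3, y$1]) = matrix_inv S *v (y$4 *\<^sub>R Q0_hat P V)"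
    by (simp add: Q)
  then have "vector [y$2, y$3, y$1] = y$4 *\<^sub>R Q0_bar P V"
    by (simp add: matrix_vector_mul_assoc matrix_inv_invertible[OF S] Q0_bar_def S_def[symmetric] matrix_vector_mult_scaleR)
  then show ?thesis
    unfolding W0 vec_eq_iff forall_3 using exhaust_3[of i] by (elim disjE) (simp_all add: mult.commute)
qed

lemma outflow_W:
  assumes k4: "kappa P V 4 \<noteq> 0" and bc: "flux_pert P (z (len P) t) = U t"
  shows "W z 4 (len P) t = (\<Sum>j\<in>UNIV. R1_bar P V $ j * W z (perm j) (len P) t) + U_bar P V U t"
proof -
  define y where "y = matrix_inv V *v z (len P) t"
  define E where "E = exp (- theta P V 4 * len P)"
  have "V *v y = z (len P) t" by (simp add: y_def coords_inverse)
  then have flux: "kappa P V 1 * y$1 + kappa P V 2 * y$2 + kappa P V 3 * y$3 + kappa P V 4 * y$4 = U t"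
    using bc flux_pert_coords by metis
  \<comment> \<open>The exponentials in \<open>R1_bar\<close> replace the scaling of each coordinate
    at \<open>x = L\<close> by that of the fourth, so the common factor \<open>E\<close> can be
    pulled out of the flux condition.\<close>
  have e: "exp ((theta P V k - theta P V 4) * len P) * W z k (len P) t = E * y $ k" for k
    by (simp add: W_def y_def E_def exp_add[symmetric] mult.assoc[symmetric] algebra_simps)
  have W4: "W z 4 (len P) t = E * y $ 4" by (simp add: W_def y_def E_def)
  have "R1_bar P V $ 1 = R1_hat P V $ 2 * exp ((theta P V 2 - theta P V 4) * len P)"
    "R1_bar P V $ 2 = R1_hat P V $ 3 * exp ((theta P V 3 - theta P V 4) * len P)"
    "R1_bar P V $ 3 = R1_hat P V $ 1 * exp ((theta P V 1 - theta P V 4) * len P)"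
    by (simp_all add: R1_bar_def vector_matrix_mult_def sum_3)
  then have "(\<Sum>j\<in>UNIV. R1_bar P V $ j * W z (perm j) (len P) t)
      = R1_hat P V $ 2 * (E * y $ 2) + R1_hat P V $ 3 * (E * y $ 3) + R1_hat P V $ 1 * (E * y $ 1)"
    by (simp add: sum_3 mult.assoc e)
  also have "\<dots> = E * (R1_hat P V $ 1 * y $ 1 + R1_hat P V $ 2 * y $ 2 + R1_hat P V $ 3 * y $ 3)"
    by (simp add: algebra_simps)
  also have "\<dots> = - E * ((kappa P V 1 * y$1 + kappa P V 2 * y$2 + kappa P V 3 * y$3) / kappa P V 4)"
    by (simp add: R1_hat_def add_divide_distrib algebra_simps)
  also have "kappa P V 1 * y$1 + kappa P V 2 * y$2 + kappa P V 3 * y$3 = U t - kappa P V 4 * y$4"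
    using flux by simp
  finally have "(\<Sum>j\<in>UNIV. R1_bar P V $ j * W z (perm j) (len P) t)
      = - E * ((U t - kappa P V 4 * y$4) / kappa P V 4)" .
  moreover have "U_bar P V U t = E * (U t / kappa P V 4)"
    by (simp add: U_bar_def E_def theta_def)
  ultimately show ?thesis using k4 W4 by (simp add: diff_divide_distrib right_diff_distrib)
qed

text \<open>The prefactor of the feedback is the reciprocal of the factor in \<open>U_bar\<close>,
  and \<open>T_inv\<close> undoes \<open>T_mat\<close>, so only the observer coordinates
  remain.\<close>

lemma feedback_U_bar:
  assumes "kappa P V 4 \<noteq> 0" and "U t = output_feedback P V K (z_estimate P V w w4) t"
  shows "U_bar P V U t = - (R1_bar P V \<bullet> w (len P) t)
    + (LINT \<xi>:{0..len P}|lborel. K (len P) \<xi> \<bullet> w \<xi> t) + (LINT \<xi>:{0..len P}|lborel. L11 P V K (len P) \<xi> * w4 \<xi> t)"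
proof -
  have "U_bar P V U t = exp (- (J_hat P V $ 4 $ 4 / lam P $ 4 * len P)) * exp (J_hat P V $ 4 $ 4 / lam P $ 4 * len P)
      * (- (R1_bar P V \<bullet> w (len P) t)
    + (LINT \<xi>:{0..len P}|lborel. K (len P) \<xi> \<bullet> w \<xi> t) + (LINT \<xi>:{0..len P}|lborel. L11 P V K (len P) \<xi> * w4 \<xi> t))"
    using assms by (simp add: U_bar_def output_feedback_def z_estimate_coords)
  then show ?thesis by (simp add: exp_add[symmetric])
qed

section \<open>Observer and kernels along characteristics\<close>

lemma observer_sol:
  assumes obs: "observer P V M y U w0 w40 w w4"
    and M: "\<And>i. bm2 (triangle (len P)) (\<lambda>x \<xi>. M x \<xi> $ i)" and N: "bm2 (triangle (len P)) (N11 P V M)"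
    and y: "\<And>T. bm_on {0..T} y"
  defines "wc \<equiv> \<lambda>j x t. w x t $ j"
  shows "char_sol (len P) (1 / lam P $ perm i)
      (\<lambda>x t. hc.src wc w4 i x t - \<mu> * M x 0 $ i * (w4 0 t - y t)) (wc i)"
    and "char_sol (len P) (- (1 / \<mu>)) (\<lambda>x t. hc.src' wc x t - \<mu> * N11 P V M x 0 * (w4 0 t - y t)) w4"
    and "hc.strip_bm (\<lambda>x t. hc.src wc w4 i x t - \<mu> * M x 0 $ i * (w4 0 t - y t))"
    and "hc.strip_bm (\<lambda>x t. hc.src' wc x t - \<mu> * N11 P V M x 0 * (w4 0 t - y t))"
    and "\<And>j. hc.strip_bm (wc j)" and "hc.strip_bm w4"
proof -
  show wb: "hc.strip_bm (wc j)" for j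
    using obs Linf_loc_strip_component[of "len P" w] by (simp add: observer_def hc.strip_bm_def wc_def)
  show w4b: "hc.strip_bm w4"
    using obs Linf_loc_strip_real[of "len P" w4] by (simp add: observer_def hc.strip_bm_def)
  have out: "bm_on {0..T} (\<lambda>t. w4 0 t - y t)" for T
    by (intro bm_on_diff y hc.strip_bm_trace[OF w4b]) (use len_pos in simp)
  have g: "bm_on {0..len P} (\<lambda>x. \<mu> * M x 0 $ i)" "bm_on {0..len P} (\<lambda>x. \<mu> * N11 P V M x 0)"
    by (intro bm_on_mult bm_on_const bm2_bottom M N)+
  show sb: "hc.strip_bm (\<lambda>x t. hc.src wc w4 i x t - \<mu> * M x 0 $ i * (w4 0 t - y t))"
    by (rule hc.strip_bm_diff hc.strip_bm_src wb w4b hc.strip_bm_mult hc.strip_bm_fst[OF g(1)]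
        hc.strip_bm_snd out)+
  show sb': "hc.strip_bm (\<lambda>x t. hc.src' wc x t - \<mu> * N11 P V M x 0 * (w4 0 t - y t))"
    by (rule hc.strip_bm_diff hc.strip_bm_src' wb hc.strip_bm_mult hc.strip_bm_fst[OF g(2)]
        hc.strip_bm_snd out)+
  define f where "f x t = Sig_pp P V x *v w x t + w4 x t *\<^sub>R Sig_pm P V x - (w4 0 t - y t) *\<^sub>R gain_p P M x" for x t
  have "system_solution (len P) (mat 1) (Lam_p P) f w"
    using obs unfolding observer_def f_def by blast
  \<comment> \<open>\<open>Lam_p\<close> is diagonal, so unit vectors are admissible test vectors
    and the observer splits into its components.\<close>
  moreover have "axis i 1 v* Lam_p P = lam P $ perm i *\<^sub>R (axis i 1 v* (mat 1 :: real^3^3))"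
    using exhaust_3[of i]
    by (elim disjE) (simp_all add: vec_eq_iff forall_3 vector_matrix_mult_def sum_3 axis_def mat_def Lam_p_component)
  ultimately have "transport_solution (len P) (lam P $ perm i) (\<lambda>x t. axis i 1 \<bullet> f x t) (\<lambda>x t. axis i 1 \<bullet> (mat 1 *v w x t))"
    unfolding system_solution_def by blast
  moreover have "axis i 1 \<bullet> f x t = hc.src wc w4 i x t - \<mu> * M x 0 $ i * (w4 0 t - y t)" for x t
    by (simp add: inner_axis' f_def hc.src_def wc_def matrix_vector_mult_def gain_p_def lam4 algebra_simps)
  ultimately have tr: "transport_solution (len P) (lam P $ perm i)
      (\<lambda>x t. hc.src wc w4 i x t - \<mu> * M x 0 $ i * (w4 0 t - y t)) (wc i)"
    by (simp add: inner_axis' wc_def)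
  show "char_sol (len P) (1 / lam P $ perm i)
      (\<lambda>x t. hc.src wc w4 i x t - \<mu> * M x 0 $ i * (w4 0 t - y t)) (wc i)"
    by (rule transport_imp_char_sol[OF _ _ tr])
       (use hc.lam_pos[of i] len_pos sb in \<open>auto simp: hc.strip_bm_def\<close>)
  have "transport_solution (len P) (- \<mu>) (\<lambda>x t. Sig_mp P V x \<bullet> w x t - gain_m P V M x * (w4 0 t - y t)) w4"
    using obs unfolding observer_def by blast
  moreover have "Sig_mp P V x \<bullet> w x t - gain_m P V M x * (w4 0 t - y t)
      = hc.src' wc x t - \<mu> * N11 P V M x 0 * (w4 0 t - y t)" for x t
    by (simp add: gain_m_def lam4 hc.src'_def wc_def inner_vec_def)
  ultimately have tr': "transport_solution (len P) (- \<mu>) (\<lambda>x t. hc.src' wc x t - \<mu> * N11 P V M x 0 * (w4 0 t - y t)) w4"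
    by simp
  have "char_sol (len P) (1 / - \<mu>) (\<lambda>x t. hc.src' wc x t - \<mu> * N11 P V M x 0 * (w4 0 t - y t)) w4"
    by (rule transport_imp_char_sol[OF _ _ tr'])
       (use hc.mu len_pos sb' in \<open>auto simp: hc.strip_bm_def\<close>)
  then show "char_sol (len P) (- (1 / \<mu>)) (\<lambda>x t. hc.src' wc x t - \<mu> * N11 P V M x 0 * (w4 0 t - y t)) w4"
    by simp
qed

text \<open>\<open>N11\<close> is given by an explicit formula, not by an equation. Moving parallel
  to the diagonal keeps \<open>x - \<xi>\<close> fixed and shortens the integral from below; this is
  its characteristic identity. At \<open>x = len P\<close> the integral is empty, which leaves the
  reflection of \<open>M\<close>.\<close>

lemma observer_kernel_facts:
  assumes "observer_kernel P V M"
  defines "m \<equiv> \<lambda>j x \<xi>. M x \<xi> $ j"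
  shows "\<And>i. bm2 (triangle (len P)) (m i)" and "bm2 (triangle (len P)) (N11 P V M)"
    and "\<And>i x \<xi> s. (x, \<xi>) \<in> triangle (len P) \<Longrightarrow> 0 \<le> s \<Longrightarrow>
      (x + lam P $ perm i * s, \<xi> - \<mu> * s) \<in> triangle (len P) \<Longrightarrow>
      m i (x + lam P $ perm i * s) (\<xi> - \<mu> * s) = m i x \<xi>
        + (LINT \<sigma>:{0..s}|lborel. hc.src m (N11 P V M) i (x + lam P $ perm i * \<sigma>) (\<xi> - \<mu> * \<sigma>))"
    and "\<And>i x. x \<in> {0..len P} \<Longrightarrow> (lam P $ perm i + \<mu>) * m i x x = Sig_pm P V x $ i"
    and "\<And>y s. 0 \<le> y \<Longrightarrow> 0 \<le> s \<Longrightarrow> y + \<mu> * s \<le> len P \<Longrightarrow>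
      N11 P V M (y + \<mu> * s) (\<mu> * s) = N11 P V M y 0 - (LINT \<sigma>:{0..s}|lborel. hc.src' m (y + \<mu> * \<sigma>) (\<mu> * \<sigma>))"
    and "\<And>\<xi>. N11 P V M (len P) \<xi> = (\<Sum>j\<in>UNIV. R1_bar P V $ j * m j (len P) \<xi>)"
proof -
  note mu = hc.mu
  show m: "bm2 (triangle (len P)) (m i)" for i
    using assms(1) unfolding m_def by (intro Linf_triangle_component) (simp add: observer_kernel_def)
  have N: "N11 P V M x \<xi> = (\<Sum>j\<in>UNIV. R1_bar P V $ j * m j (len P) (len P - (x - \<xi>)))
      + (LINT \<nu>:{0..(len P - x) / \<mu>}|lborel. hc.src' m (x + \<mu> * \<nu>) (\<xi> + \<mu> * \<nu>))" for x \<xi>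
  proof -
    have "(x - len P) / - \<mu> = (len P - x) / \<mu>" using mu by (simp add: field_simps)
    then show ?thesis by (simp add: N11_def lam4 hc.src'_def m_def inner_vec_def)
  qed
  show "N11 P V M (len P) \<xi> = (\<Sum>j\<in>UNIV. R1_bar P V $ j * m j (len P) \<xi>)" for \<xi>
    by (simp add: N set_integral_at_point)
  have "bm_on (triangle (len P)) (\<lambda>p. LINT \<nu>:{0..(len P - fst p) / \<mu>}|lborel. hc.src' m (fst p + \<mu> * \<nu>) (snd p + \<mu> * \<nu>))"
  proof (rule bm_on_param_integral[where C="len P / \<mu>", OF borel_closed[OF closed_triangle]])
    let ?D = "{(p, \<nu>). p \<in> triangle (len P) \<and> 0 \<le> \<nu> \<and> \<nu> \<le> (len P - fst p) / \<mu>}"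
    have "bm_on ?D (\<lambda>q. hc.src' m (fst (fst q) + \<mu> * snd q) (snd (fst q) + \<mu> * snd q))"
    proof (rule bm_on_compose_Pair[OF hc.bm2_triangle_src(2)[OF m]])
      fix q assume q: "q \<in> ?D"
      then have "\<mu> * snd q \<le> len P - fst (fst q)" "0 \<le> \<mu> * snd q"
        using mu by (auto simp: field_simps)
      then show "(fst (fst q) + \<mu> * snd q, snd (fst q) + \<mu> * snd q) \<in> triangle (len P)"
        using q by (auto simp: triangle_def)
    qed (auto intro!: continuous_intros)
    then show "bm_on ?D (\<lambda>(p, \<nu>). hc.src' m (fst p + \<mu> * \<nu>) (snd p + \<mu> * \<nu>))" by (simp add: split_beta')
  qed (use mu in \<open>auto intro!: continuous_intros divide_right_mono simp: triangle_def\<close>)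
  then have i: "bm2 (triangle (len P)) (\<lambda>x \<xi>. LINT \<nu>:{0..(len P - x) / \<mu>}|lborel. hc.src' m (x + \<mu> * \<nu>) (\<xi> + \<mu> * \<nu>))"
    by (simp add: split_beta')
  have "bm2 (triangle (len P)) (\<lambda>x \<xi>. m j (len P) (len P - (x - \<xi>)))" for j
    by (rule bm2_compose[OF m]) (auto intro!: continuous_intros simp: split_beta' triangle_def)
  then show "bm2 (triangle (len P)) (N11 P V M)"
    unfolding N by (intro bm2_add bm2_sum bm2_mult bm2_const i)
  show "m i (x + lam P $ perm i * s) (\<xi> - \<mu> * s) = m i x \<xi>
        + (LINT \<sigma>:{0..s}|lborel. hc.src m (N11 P V M) i (x + lam P $ perm i * \<sigma>) (\<xi> - \<mu> * \<sigma>))"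
    if "(x, \<xi>) \<in> triangle (len P)" "0 \<le> s" "(x + lam P $ perm i * s, \<xi> - \<mu> * s) \<in> triangle (len P)" for i x \<xi> s
  proof -
    have "triangle_solution (len P) (Lam_p P $ i $ i) (- \<mu>)
        (\<lambda>x \<xi>. (Sig_pp P V x *v M x \<xi> + N11 P V M x \<xi> *\<^sub>R Sig_pm P V x) $ i) (\<lambda>x \<xi>. M x \<xi> $ i)"
      using assms(1) by (simp add: observer_kernel_def)
    from this[unfolded triangle_solution_def, rule_format, of x \<xi> s] that
    show ?thesis
      by (simp add: Lam_p_component m_def hc.src_def matrix_vector_mult_def mult.commute)
  qed
  show "(lam P $ perm i + \<mu>) * m i x x = Sig_pm P V x $ i" if "x \<in> {0..len P}" for i x
  proof -
    have "0 = \<mu> *\<^sub>R M x x + Lam_p P *v M x x - Sig_pm P V x"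
      using assms(1) that by (simp add: observer_kernel_def)
    then have "0 = (\<mu> *\<^sub>R M x x + Lam_p P *v M x x - Sig_pm P V x) $ i"
      by (metis zero_index)
    also have "\<dots> = \<mu> * M x x $ i + lam P $ perm i * M x x $ i - Sig_pm P V x $ i"
      by (simp add: matrix_vector_mult_def Lam_p_component if_distrib[where f="\<lambda>a. a * _"] cong: if_cong)
    finally show ?thesis by (simp add: m_def algebra_simps)
  qed
  show "N11 P V M (y + \<mu> * s) (\<mu> * s) = N11 P V M y 0 - (LINT \<sigma>:{0..s}|lborel. hc.src' m (y + \<mu> * \<sigma>) (\<mu> * \<sigma>))"
    if y: "0 \<le> y" and s: "0 \<le> s" "y + \<mu> * s \<le> len P" for y s
  proof -
    define G where "G \<nu> = hc.src' m (y + \<mu> * \<nu>) (\<mu> * \<nu>)" for \<nu>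
    have sle: "s \<le> (len P - y) / \<mu>" using s mu by (simp add: field_simps)
    have "bm_on {0..(len P - y) / \<mu>} G"
      unfolding G_def
      by (rule bm_on_compose_Pair[OF hc.bm2_triangle_src(2)[OF m]])
         (use y mu in \<open>auto intro!: continuous_intros simp: triangle_def field_simps\<close>)
    then have split: "(LINT \<nu>:{0..(len P - y) / \<mu>}|lborel. G \<nu>)
        = (LINT \<nu>:{0..s}|lborel. G \<nu>) + (LINT \<nu>:{s..(len P - y) / \<mu>}|lborel. G \<nu>)"
      by (rule LINT_interval_split) (use s sle in auto)
    have "(len P - (y + \<mu> * s)) / \<mu> = (len P - y) / \<mu> - s" using mu by (simp add: field_simps)
    moreover have "hc.src' m (y + \<mu> * s + \<mu> * \<nu>) (\<mu> * s + \<mu> * \<nu>) = G (s + 1 * \<nu>)" for \<nu>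
      by (simp add: G_def algebra_simps)
    ultimately have "N11 P V M (y + \<mu> * s) (\<mu> * s) = (\<Sum>j\<in>UNIV. R1_bar P V $ j * m j (len P) (len P - y))
        + (LINT \<nu>:{0..(len P - y) / \<mu> - s}|lborel. G (s + 1 * \<nu>))"
      by (simp add: N)
    also have "(LINT \<nu>:{0..(len P - y) / \<mu> - s}|lborel. G (s + 1 * \<nu>)) = (LINT \<nu>:{s..(len P - y) / \<mu>}|lborel. G \<nu>)"
      using LINT_interval_affine[of 1 s 0 "(len P - y) / \<mu> - s" G] by simp
    also have "\<dots> = (LINT \<nu>:{0..(len P - y) / \<mu>}|lborel. G \<nu>) - (LINT \<nu>:{0..s}|lborel. G \<nu>)"
      using split by simp
    finally show ?thesis by (simp add: N G_def)
  qed
qed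

text \<open>Likewise for \<open>L11\<close>: in the direction of the diagonal the boundary term is
  constant, while the integral, which reaches back to \<open>\<xi> = 0\<close>, grows at its upper
  end. On \<open>\<xi> = 0\<close> only the boundary term survives.\<close>

lemma control_kernel_facts:
  assumes "control_kernel P V K"
  defines "k \<equiv> \<lambda>j x \<xi>. K x \<xi> $ j"
  shows "\<And>i. bm2 (triangle (len P)) (k i)" and "bm2 (triangle (len P)) (L11 P V K)"
    and "\<And>j x \<xi> s. (x, \<xi>) \<in> triangle (len P) \<Longrightarrow> 0 \<le> s \<Longrightarrow>
      (x + \<mu> * s, \<xi> - lam P $ perm j * s) \<in> triangle (len P) \<Longrightarrow>
      k j (x + \<mu> * s) (\<xi> - lam P $ perm j * s) = k j x \<xi> + (LINT \<sigma>:{0..s}|lborel.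
        (\<Sum>i\<in>UNIV. k i (x + \<mu> * \<sigma>) (\<xi> - lam P $ perm j * \<sigma>) * Sig_pp P V (\<xi> - lam P $ perm j * \<sigma>) $ i $ j)
        + L11 P V K (x + \<mu> * \<sigma>) (\<xi> - lam P $ perm j * \<sigma>) * Sig_mp P V (\<xi> - lam P $ perm j * \<sigma>) $ j)"
    and "\<And>i x. x \<in> {0..len P} \<Longrightarrow> (\<mu> + lam P $ perm i) * k i x x = - Sig_mp P V x $ i"
    and "\<And>y s. 0 \<le> y \<Longrightarrow> 0 \<le> s \<Longrightarrow> y + \<mu> * s \<le> len P \<Longrightarrow>
      L11 P V K (y + \<mu> * s) (\<mu> * s) = L11 P V K y 0
        + (LINT \<sigma>:{0..s}|lborel. \<Sum>i\<in>UNIV. k i (y + \<mu> * \<sigma>) (\<mu> * \<sigma>) * Sig_pm P V (\<mu> * \<sigma>) $ i)"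
    and "\<And>x. \<mu> * L11 P V K x 0 = (\<Sum>i\<in>UNIV. lam P $ perm i * k i x 0 * Q0_bar P V $ i)"
proof -
  note mu = hc.mu
  show k: "bm2 (triangle (len P)) (k i)" for i
    using assms(1) unfolding k_def by (intro Linf_triangle_component) (simp add: control_kernel_def)
  define kB where "kB x \<xi> = (\<Sum>i\<in>UNIV. k i x \<xi> * Sig_pm P V \<xi> $ i)" for x \<xi>
  have kB: "bm2 (triangle (len P)) kB"
  proof -
    have "bm2 (triangle (len P)) (\<lambda>x \<xi>. Sig_pm P V \<xi> $ i)" for i
      by (rule bm_on_snd[OF hc.B]) (auto simp: triangle_def)
    then show ?thesis unfolding kB_def[abs_def] by (intro bm2_sum bm2_mult k)
  qed
  have l: "L11 P V K x \<xi> = 1 / \<mu> * (\<Sum>i\<in>UNIV. lam P $ perm i * k i (x - \<xi>) 0 * Q0_bar P V $ i)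
      + (LINT \<nu>:{0..\<xi> / \<mu>}|lborel. kB (x - \<mu> * \<nu>) (\<xi> - \<mu> * \<nu>))" for x \<xi>
  proof -
    have "(K (x - \<xi>) 0 v* Lam_p P) \<bullet> Q0_bar P V = (\<Sum>i\<in>UNIV. lam P $ perm i * k i (x - \<xi>) 0 * Q0_bar P V $ i)"
      by (simp add: inner_3 sum_3 vector_matrix_mult_def Lam_p_component k_def)
    then show ?thesis by (simp add: L11_def lam4 kB_def k_def inner_vec_def add.commute)
  qed
  have "bm_on (triangle (len P)) (\<lambda>p. LINT \<nu>:{0..snd p / \<mu>}|lborel. kB (fst p - \<mu> * \<nu>) (snd p - \<mu> * \<nu>))"
  proof (rule bm_on_param_integral[where C="len P / \<mu>", OF borel_closed[OF closed_triangle]])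
    let ?D = "{(p, \<nu>). p \<in> triangle (len P) \<and> 0 \<le> \<nu> \<and> \<nu> \<le> snd p / \<mu>}"
    have "bm_on ?D (\<lambda>q. kB (fst (fst q) - \<mu> * snd q) (snd (fst q) - \<mu> * snd q))"
    proof (rule bm_on_compose_Pair[OF kB])
      fix q assume q: "q \<in> ?D"
      then have "\<mu> * snd q \<le> snd (fst q)" "0 \<le> \<mu> * snd q"
        using mu by (auto simp: field_simps)
      then show "(fst (fst q) - \<mu> * snd q, snd (fst q) - \<mu> * snd q) \<in> triangle (len P)"
        using q by (auto simp: triangle_def)
    qed (auto intro!: continuous_intros)
    then show "bm_on ?D (\<lambda>(p, \<nu>). kB (fst p - \<mu> * \<nu>) (snd p - \<mu> * \<nu>))" by (simp add: split_beta')
  qed (use mu in \<open>auto intro!: continuous_intros divide_right_mono simp: triangle_def\<close>)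
  then have i: "bm2 (triangle (len P)) (\<lambda>x \<xi>. LINT \<nu>:{0..\<xi> / \<mu>}|lborel. kB (x - \<mu> * \<nu>) (\<xi> - \<mu> * \<nu>))"
    by (simp add: split_beta')
  have "bm2 (triangle (len P)) (\<lambda>x \<xi>. k j (x - \<xi>) 0)" for j
    by (rule bm2_compose[OF k]) (auto intro!: continuous_intros simp: split_beta' triangle_def)
  then show "bm2 (triangle (len P)) (L11 P V K)"
    unfolding l by (intro bm2_add bm2_sum bm2_mult bm2_const i)
  show l0: "\<mu> * L11 P V K x 0 = (\<Sum>i\<in>UNIV. lam P $ perm i * k i x 0 * Q0_bar P V $ i)" for x
    using mu by (simp add: l set_integral_at_point)
  show "L11 P V K (y + \<mu> * s) (\<mu> * s) = L11 P V K y 0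
        + (LINT \<sigma>:{0..s}|lborel. \<Sum>i\<in>UNIV. k i (y + \<mu> * \<sigma>) (\<mu> * \<sigma>) * Sig_pm P V (\<mu> * \<sigma>) $ i)"
    for y s
  proof -
    have "kB (y + \<mu> * s - \<mu> * \<nu>) (\<mu> * s - \<mu> * \<nu>) = (\<lambda>\<sigma>. kB (y + \<mu> * \<sigma>) (\<mu> * \<sigma>)) (s - 1 * \<nu>)" for \<nu>
      by (simp add: algebra_simps)
    then have "L11 P V K (y + \<mu> * s) (\<mu> * s) = L11 P V K y 0
        + (LINT \<nu>:{0..s}|lborel. (\<lambda>\<sigma>. kB (y + \<mu> * \<sigma>) (\<mu> * \<sigma>)) (s - 1 * \<nu>))"
      using mu by (simp add: l set_integral_at_point)
    also have "(LINT \<nu>:{0..s}|lborel. (\<lambda>\<sigma>. kB (y + \<mu> * \<sigma>) (\<mu> * \<sigma>)) (s - 1 * \<nu>))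
        = (LINT \<sigma>:{0..s}|lborel. kB (y + \<mu> * \<sigma>) (\<mu> * \<sigma>))"
      using LINT_interval_reflect[of 1 s s 0 "\<lambda>\<sigma>. kB (y + \<mu> * \<sigma>) (\<mu> * \<sigma>)"] by simp
    finally show ?thesis by (simp add: kB_def)
  qed
  show "k j (x + \<mu> * s) (\<xi> - lam P $ perm j * s) = k j x \<xi> + (LINT \<sigma>:{0..s}|lborel.
        (\<Sum>i\<in>UNIV. k i (x + \<mu> * \<sigma>) (\<xi> - lam P $ perm j * \<sigma>) * Sig_pp P V (\<xi> - lam P $ perm j * \<sigma>) $ i $ j)
        + L11 P V K (x + \<mu> * \<sigma>) (\<xi> - lam P $ perm j * \<sigma>) * Sig_mp P V (\<xi> - lam P $ perm j * \<sigma>) $ j)"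
    if "(x, \<xi>) \<in> triangle (len P)" "0 \<le> s" "(x + \<mu> * s, \<xi> - lam P $ perm j * s) \<in> triangle (len P)" for j x \<xi> s
  proof -
    have "triangle_solution (len P) (- lam P $ 4) (- Lam_p P $ j $ j)
        (\<lambda>x \<xi>. (K x \<xi> v* Sig_pp P V \<xi> + L11 P V K x \<xi> *\<^sub>R Sig_mp P V \<xi>) $ j) (\<lambda>x \<xi>. K x \<xi> $ j)"
      using assms(1) by (simp add: control_kernel_def)
    from this[unfolded triangle_solution_def, rule_format, of x \<xi> s] that
    show ?thesis
      by (simp add: Lam_p_component lam4 k_def vector_matrix_mult_def)
  qed
  show "(\<mu> + lam P $ perm i) * k i x x = - Sig_mp P V x $ i" if "x \<in> {0..len P}" for i x
  proof -
    have "0 = K x x v* Lam_p P + \<mu> *\<^sub>R K x x + Sig_mp P V x"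
      using assms(1) that by (simp add: control_kernel_def)
    then have "0 = (K x x v* Lam_p P + \<mu> *\<^sub>R K x x + Sig_mp P V x) $ i"
      by (metis zero_index)
    also have "\<dots> = lam P $ perm i * K x x $ i + \<mu> * K x x $ i + Sig_mp P V x $ i"
      by (simp add: vector_matrix_mult_def Lam_p_component if_distrib[where f="\<lambda>a. _ * a"] cong: if_cong)
    finally show ?thesis by (simp add: k_def algebra_simps)
  qed
qed

end

theorem theorem3:
  fixes P :: ar_params and V :: "real^4^4"
    and K M :: "real \<Rightarrow> real \<Rightarrow> real^3"
    and U :: "real \<Rightarrow> real"
    and z0 :: "real \<Rightarrow> real^4" and z :: "real \<Rightarrow> real \<Rightarrow> real^4"
    and what0 :: "real \<Rightarrow> real^3" and w4hat0 :: "real \<Rightarrow> real"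
    and what :: "real \<Rightarrow> real \<Rightarrow> real^3" and w4hat :: "real \<Rightarrow> real \<Rightarrow> real"
  assumes "valid_params P" and "congested P"
    and "diagonalizes P V"
    and "invertible (inflow_mat P V)" and "kappa P V 4 \<noteq> 0"
    and "control_kernel P V K" and "observer_kernel P V M"
    and "Linf_on {0..len P} z0"
    and "Linf_on {0..len P} what0" and "Linf_on {0..len P} w4hat0"
    and "linearized_AR P U z0 z"
    and "observer P V M (w4_meas P V z) U what0 w4hat0 what w4hat"
    and "\<And>t. t \<ge> 0 \<Longrightarrow> U t = output_feedback P V K (z_estimate P V what w4hat) t"
  shows "\<forall>t \<ge> 2 * t_F P. AE x in lborel. x \<in> {0..len P} \<longrightarrow> z x t = 0"
proof -
  interpret congested_ar P V by standard fact+
  define wh where "wh j x t = what x t $ j" for j x t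
  define m where "m j x \<xi> = M x \<xi> $ j" for j x \<xi>
  define k where "k j x \<xi> = K x \<xi> $ j" for j x \<xi>
  define w where "w j = W z (perm j)" for j
  define w' where "w' = W z 4"
  define e where "e j x t = wh j x t - w j x t" for j x t
  define e' where "e' x t = w4hat x t - w' x t" for x t
  have z: "Linf_loc_strip (len P) z"
    and zs: "system_solution (len P) (Jt P) (Jx P) (\<lambda>x t. - (Jsrc P *v z x t)) z"
    and zb: "AE t in lborel. t > 0 \<longrightarrow> z 0 t $ 1 = 0 \<and> z 0 t $ 3 = 0 \<and>
        flux_pert P (z 0 t) = 0 \<and> flux_pert P (z (len P) t) = U t"
    using assms(11) by (auto simp: linearized_AR_def)
  have ob: "AE t in lborel. t > 0 \<longrightarrow> what 0 t = w4_meas P V z t *\<^sub>R Q0_bar P V \<and>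
        w4hat (len P) t = R1_bar P V \<bullet> what (len P) t + U_bar P V U t"
    using assms(12) unfolding observer_def by blast
  have wb: "hc.strip_bm (w j)" and w'b: "hc.strip_bm w'" for j
    unfolding w_def w'_def by (rule W_strip[OF z])+
  have w_sol: "char_sol (len P) (1 / lam P $ perm i) (hc.src w w' i) (w i)" for i
    using W_plant(1)[OF z zs, of i] unfolding w_def[abs_def] w'_def .
  have w'_sol: "char_sol (len P) (- (1 / \<mu>)) (hc.src' w) w'"
    using W_plant(2)[OF z zs] unfolding w_def[abs_def] w'_def .
  have w_0: "AE t in lborel. 0 < t \<longrightarrow> w i 0 t = Q0_bar P V $ i * w' 0 t" for i
    using zb by eventually_elim (auto simp: w_def w'_def inflow_W[OF assms(4)])
  have w'_L: "AE t in lborel. 0 < t \<longrightarrow> w' (len P) t = (\<Sum>j\<in>UNIV. R1_bar P V $ j * w j (len P) t) + U_bar P V U t"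
    using zb by eventually_elim (auto simp: w_def w'_def outflow_W[OF assms(5)])
  note mk = observer_kernel_facts[OF assms(7), folded m_def]
  note kk = control_kernel_facts[OF assms(6), folded k_def]
  have meas: "w4_meas P V z = w' 0"
    by (simp add: fun_eq_iff w4_meas_eq w'_def)
  have "bm_on {0..T} (w4_meas P V z)" for T
    unfolding meas by (rule hc.strip_bm_trace[OF w'b]) (use len_pos in simp)
  note os = observer_sol[OF assms(12) mk(1)[unfolded m_def] mk(2) this, folded wh_def m_def, unfolded meas]
  have eb: "hc.strip_bm (e j)" and e'b: "hc.strip_bm e'" for j
    unfolding e_def[abs_def] e'_def[abs_def] by (intro hc.strip_bm_diff os(5,6) wb w'b)+
  have e_sol: "char_sol (len P) (1 / lam P $ perm i) (\<lambda>x t. hc.src e e' i x t - \<mu> * m i x 0 * e' 0 t) (e i)" for i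
  proof (rule char_sol_cong[OF char_sol_diff[OF os(1)[of i] w_sol[of i]]])
    show "bm2 ({0..len P} \<times> {0..T}) (\<lambda>x t. hc.src wh w4hat i x t - \<mu> * m i x 0 * (w4hat 0 t - w' 0 t))" for T
      using os(3)[of i] by (simp add: hc.strip_bm_def)
    show "bm2 ({0..len P} \<times> {0..T}) (hc.src w w' i)" for T
      using hc.strip_bm_src[OF wb w'b] by (simp add: hc.strip_bm_def)
  qed (simp_all add: hc.src_def e_def e'_def right_diff_distrib sum_subtractf)
  have e'_sol: "char_sol (len P) (- (1 / \<mu>)) (\<lambda>x t. hc.src' e x t - \<mu> * N11 P V M x 0 * e' 0 t) e'"
  proof (rule char_sol_cong[OF char_sol_diff[OF os(2) w'_sol]])
    show "bm2 ({0..len P} \<times> {0..T}) (\<lambda>x t. hc.src' wh x t - \<mu> * N11 P V M x 0 * (w4hat 0 t - w' 0 t))" for T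
      using os(4) by (simp add: hc.strip_bm_def)
    show "bm2 ({0..len P} \<times> {0..T}) (hc.src' w)" for T
      using hc.strip_bm_src'[OF wb] by (simp add: hc.strip_bm_def)
  qed (simp_all add: hc.src'_def e_def e'_def right_diff_distrib sum_subtractf)
  have e_0: "AE t in lborel. 0 < t \<longrightarrow> e i 0 t = 0" for i
    using ob w_0[of i] by eventually_elim (auto simp: e_def wh_def meas)
  have e'_L: "AE t in lborel. 0 < t \<longrightarrow> e' (len P) t = (\<Sum>j\<in>UNIV. R1_bar P V $ j * e j (len P) t)"
    using ob w'_L
    by eventually_elim (auto simp: e_def e'_def wh_def inner_vec_def right_diff_distrib sum_subtractf)
  interpret oe: observer_error "len P" \<mu> "veq P 2" "\<lambda>i. lam P $ perm i"
    "\<lambda>x i j. Sig_pp P V x $ i $ j" "\<lambda>x i. Sig_pm P V x $ i" "\<lambda>x i. Sig_mp P V x $ i"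
    m "N11 P V M" "\<lambda>j. R1_bar P V $ j" e e'
    by standard (rule mk eb e'b e_sol e'_sol e_0 e'_L; assumption?)+
  have T0: "0 \<le> t_F P" using len_pos hc.v hc.mu by (simp add: t_F_eq)
  \<comment> \<open>The feedback sees the error in two ways: through the trace at
    \<open>x = len P\<close>, for almost every time, and under an integral over the profile at one
    given time. Hence the two forms, here and in \<open>e_t\<close> and \<open>e'_t\<close>.\<close>
  have e_L: "AE t in lborel. \<forall>j. t_F P \<le> t \<longrightarrow> e j (len P) t = 0"
    unfolding t_F_eq
    by (intro AE_all_countable[THEN iffD2] allI char_AE_at_x[OF oe.error_vanishes(1)]) (use len_pos in simp)
  have e_t: "AE x in lborel. x \<in> {0..len P} \<longrightarrow> e j x t = 0" if "t_F P \<le> t" for j t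
    using char_AE_at_t[OF oe.error_vanishes(1)[of j], of t] that hc.lam_pos[of j] unfolding t_F_eq
    by (auto elim!: eventually_mono)
  have e'_t: "AE x in lborel. x \<in> {0..len P} \<longrightarrow> e' x t = 0" if "t_F P \<le> t" for t
    using char_AE_at_t[OF oe.error_vanishes(2), of t] that hc.mu unfolding t_F_eq
    by (auto elim!: eventually_mono)
  \<comment> \<open>With exact estimates the term
    \<open>- R1_bar P V \<bullet> what (len P) t\<close> in the control removes the reflection of
    the plant, and the integrals may be read with the true state.\<close>
  have w'_feedback: "AE t in lborel. t_F P < t \<longrightarrow> w' (len P) t =
      (\<Sum>i\<in>UNIV. LINT \<xi>:{0..len P}|lborel. k i (len P) \<xi> * w i \<xi> t)
      + (LINT \<xi>:{0..len P}|lborel. L11 P V K (len P) \<xi> * w' \<xi> t)"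
    using w'_L e_L
  proof eventually_elim
    case (elim t)
    show ?case
    proof
      assume t: "t_F P < t"
      then have t0: "0 < t" using T0 by simp
      have L: "len P \<in> {0..len P}" using len_pos by simp
      have kL: "bm_on {0..len P} (k i (len P))" "bm_on {0..len P} (L11 P V K (len P))" for i
        by (rule bm2_row[OF kk(1) L] bm2_row[OF kk(2) L])+
      have sb: "bm_on {0..len P} (\<lambda>\<xi>. u \<xi> t)" if "hc.strip_bm u" for u
        by (rule hc.strip_bm_at_time[OF that]) (use t0 in simp)
      have "(LINT \<xi>:{0..len P}|lborel. K (len P) \<xi> \<bullet> what \<xi> t)
          = (LINT \<xi>:{0..len P}|lborel. \<Sum>i\<in>UNIV. k i (len P) \<xi> * wh i \<xi> t)"
        by (simp add: inner_vec_def k_def wh_def)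
      also have "\<dots> = (\<Sum>i\<in>UNIV. LINT \<xi>:{0..len P}|lborel. k i (len P) \<xi> * wh i \<xi> t)"
        by (rule LINT_bm_sum) (rule bm_on_mult[OF kL(1) sb[OF os(5)]])
      also have "\<dots> = (\<Sum>i\<in>UNIV. LINT \<xi>:{0..len P}|lborel. k i (len P) \<xi> * w i \<xi> t)"
      proof (rule sum.cong[OF refl], rule LINT_cong_AE)
        fix i
        show "AE \<xi> in lborel. \<xi> \<in> {0..len P} \<longrightarrow> k i (len P) \<xi> * wh i \<xi> t = k i (len P) \<xi> * w i \<xi> t"
          using e_t[of t i] t by (auto simp: e_def elim!: eventually_mono)
      qed (intro bm_on_interval_integrable bm_on_mult kL sb wb os(5))+
      finally have 1: "(LINT \<xi>:{0..len P}|lborel. K (len P) \<xi> \<bullet> what \<xi> t)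
          = (\<Sum>i\<in>UNIV. LINT \<xi>:{0..len P}|lborel. k i (len P) \<xi> * w i \<xi> t)" .
      have 2: "(LINT \<xi>:{0..len P}|lborel. L11 P V K (len P) \<xi> * w4hat \<xi> t)
          = (LINT \<xi>:{0..len P}|lborel. L11 P V K (len P) \<xi> * w' \<xi> t)"
      proof (rule LINT_cong_AE)
        show "AE \<xi> in lborel. \<xi> \<in> {0..len P} \<longrightarrow> L11 P V K (len P) \<xi> * w4hat \<xi> t = L11 P V K (len P) \<xi> * w' \<xi> t"
          using e'_t[of t] t by (auto simp: e'_def elim!: eventually_mono)
      qed (intro bm_on_interval_integrable bm_on_mult kL sb w'b os(6))+
      have "U_bar P V U t = - (R1_bar P V \<bullet> what (len P) t)
          + (\<Sum>i\<in>UNIV. LINT \<xi>:{0..len P}|lborel. k i (len P) \<xi> * w i \<xi> t)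
          + (LINT \<xi>:{0..len P}|lborel. L11 P V K (len P) \<xi> * w' \<xi> t)"
        using feedback_U_bar[OF assms(5), of U t K what w4hat] assms(13)[of t] t0 by (simp add: 1 2)
      moreover have "R1_bar P V \<bullet> what (len P) t = (\<Sum>j\<in>UNIV. R1_bar P V $ j * w j (len P) t)"
        using elim(2) t by (simp add: inner_vec_def e_def wh_def)
      ultimately show "w' (len P) t =
          (\<Sum>i\<in>UNIV. LINT \<xi>:{0..len P}|lborel. k i (len P) \<xi> * w i \<xi> t)
          + (LINT \<xi>:{0..len P}|lborel. L11 P V K (len P) \<xi> * w' \<xi> t)"
        using elim(1) t0 by simp
    qed
  qed
  interpret cs: controlled_system "len P" \<mu> "veq P 2" "\<lambda>i. lam P $ perm i"
    "\<lambda>x i j. Sig_pp P V x $ i $ j" "\<lambda>x i. Sig_pm P V x $ i" "\<lambda>x i. Sig_mp P V x $ i"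
    k "L11 P V K" "\<lambda>j. Q0_bar P V $ j" w w' "t_F P"
    by standard (rule kk wb w'b w_sol w'_sol w_0 w'_feedback T0; assumption?)+
  show ?thesis
  proof (intro allI impI)
    fix t assume t: "2 * t_F P \<le> t"
    have "AE x in lborel. \<forall>j. x \<in> {0..len P} \<longrightarrow> t_F P + len P / \<mu> + 1 / veq P 2 * x < t \<longrightarrow> w j x t = 0"
    proof (intro AE_all_countable[THEN iffD2] allI)
      fix j
      show "AE x in lborel. x \<in> {0..len P} \<longrightarrow> t_F P + len P / \<mu> + 1 / veq P 2 * x < t \<longrightarrow> w j x t = 0"
        by (rule char_AE_at_t[OF cs.state_vanishes(1)]) (use hc.lam_pos[of j] in simp)
    qed
    moreover have "AE x in lborel. x \<in> {0..len P} \<longrightarrow> t_F P + len P / \<mu> + 1 / veq P 2 * x < t \<longrightarrow> w' x t = 0"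
      by (rule char_AE_at_t[OF cs.state_vanishes(2)]) (use hc.mu in simp)
    \<comment> \<open>At \<open>t = 2 * t_F P\<close> the strict inequality required by
      \<open>state_vanishes\<close> fails exactly at the end point \<open>x = len P\<close>, a null
      set.\<close>
    moreover have "AE x in lborel. x \<noteq> len P" by (rule AE_lborel_singleton)
    ultimately show "AE x in lborel. x \<in> {0..len P} \<longrightarrow> z x t = 0"
    proof eventually_elim
      case (elim x)
      show ?case
      proof
        assume x: "x \<in> {0..len P}"
        then have "x / veq P 2 < len P / veq P 2" using elim(3) hc.v by (auto intro: divide_strict_right_mono)
        then have "t_F P + len P / \<mu> + 1 / veq P 2 * x < t" using t by (simp add: t_F_eq)
        then show "z x t = 0"
          using elim(1,2) x by (intro W_zero_imp) (auto simp: w_def w'_def)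
      qed
    qed
  qed
qed

end
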